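(* Let $Co^n$ be the lightcone of Minkowski space $\mathbb{R}^{1+n}$, with its induced lightlike metric. (1) For $n\ge 3$, any isometry of $Co^n$ belongs to $O^+(1,n)$ (i.e. it is the restriction to $Co^n$ of an element of $O^+(1,n)$). (2) For $n\ge 4$ this is true even locally: any isometry between two connected open subsets of $Co^n$ is the restriction of an element of $O^+(1,n)$. (3) For $n=3$, the local isometries of $Co^3$ are in one-to-one correspondence with the local conformal transformations of the round sphere $\mathbf{S}^2$. (4) For $n=2$ there is no rigidity at all, even globally: to any diffeomorphism of the circle there corresponds an isometry of $Co^2$.
   Context: A lightlike scalar product on a real vector space is a symmetric bilinear form that is positive semi-definite with exactly 1-dimensional kernel; a lightlike metric on a manifold is a smooth symmetric 2-tensor that is a lightlike scalar product on each tangent space. An isometry between lightlike manifolds is a diffeomorphism pulling back one metric to the other. Let $q=-x_0^2+x_1^2+\dots+x_n^2$ on $\mathbb{R}^{1+n}$. The lightcone is $Co^n=\{x : q(x)=0,\ x_0>0\}$ (an $n$-dimensional manifold); the metric induced by $q$ on it is lightlike. Equivalently $Co^n$ is $\mathbb{R}\times\mathbf{S}^{n-1}$ with the metric $0\oplus e^{2t}g_{\mathbf{S}^{n-1}}$, where $g_{\mathbf{S}^{n-1}}$ is the round metric. $O^+(1,n)$ is the subgroup of the orthogonal group $O(1,n)$ of $q$ preserving $Co^n$; it acts isometrically on $Co^n$. The correspondences in (3) and (4) associate to an isometry (of $Co^2$, or between open subsets of $Co^3$) the transformation it induces on the space of null half-lines of the cone, $\mathbf{S}^{n-1}$.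
   Formalization: In (3) the one-to-one correspondence is stated for isometries between open subsets of the cone meeting each null half-line in a connected set (otherwise no map on half-lines need be induced); every isometry between arbitrary open subsets is shown to be of this kind near each point. *)

theory Defs
  imports "HOL-Analysis.Analysis"
begin

section \<open>Smooth maps, tangent spaces and metrics on subsets of Euclidean spaces\<close>

text \<open>
  Manifolds occur here only as embedded submanifolds of Euclidean spaces (open subsets of the
  lightcone and of round spheres), and are represented by the underlying sets.
\<close>

text \<open>The following two notions are meant for open sets \<open>W\<close>: \<open>Ck_on k W f\<close> says that \<open>f\<close> is of class
  \<open>C\<^sup>k\<close> on \<open>W\<close>.\<close>

primrec Ck_on :: "nat \<Rightarrow> 'a::euclidean_space set \<Rightarrow> ('a \<Rightarrow> 'b::euclidean_space) \<Rightarrow> bool" where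
  "Ck_on 0 W f \<longleftrightarrow> continuous_on W f"
| "Ck_on (Suc k) W f \<longleftrightarrow> (\<forall>x\<in>W. f differentiable (at x)) \<and>
     (\<forall>v. Ck_on k W (\<lambda>x. frechet_derivative f (at x) v))"

definition smooth_on :: "'a::euclidean_space set \<Rightarrow> ('a \<Rightarrow> 'b::euclidean_space) \<Rightarrow> bool" where
  "smooth_on W f \<longleftrightarrow> (\<forall>k. Ck_on k W f)"

text \<open>Smoothness on a submanifold \<open>M\<close>: locally the restriction of a smooth map of the ambient space.\<close>

definition smooth_map :: "'a::euclidean_space set \<Rightarrow> ('a \<Rightarrow> 'b::euclidean_space) \<Rightarrow> bool" where
  "smooth_map M f \<longleftrightarrow>
     (\<forall>p\<in>M. \<exists>W F. open W \<and> p \<in> W \<and> smooth_on W F \<and> (\<forall>x\<in>M \<inter> W. f x = F x))"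

definition diffeomorphism ::
  "'a::euclidean_space set \<Rightarrow> 'b::euclidean_space set \<Rightarrow> ('a \<Rightarrow> 'b) \<Rightarrow> bool" where
  "diffeomorphism M N f \<longleftrightarrow> bij_betw f M N \<and> smooth_map M f \<and> smooth_map N (inv_into M f)"

definition tangent_space :: "'a::euclidean_space set \<Rightarrow> 'a \<Rightarrow> 'a set" where
  "tangent_space M p = {v. \<exists>e>0. \<exists>c. smooth_on {-e<..<e} c \<and> c ` {-e<..<e} \<subseteq> M \<and>
     c (0::real) = p \<and> (c has_vector_derivative v) (at 0)}"

text \<open>
  A metric is a field of bilinear forms on the ambient space, of which only the values on the
  tangent spaces matter. Likewise, \<open>frechet_derivative f (at p within M)\<close> is an arbitrarily chosen
  linear extension of the differential of \<open>f\<close> at \<open>p\<close>; it is determined on \<open>tangent_space M p\<close>.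
\<close>

type_synonym 'a metric = "'a \<Rightarrow> 'a \<Rightarrow> 'a \<Rightarrow> real"

definition pullback ::
  "'a::euclidean_space set \<Rightarrow> ('a \<Rightarrow> 'b::euclidean_space) \<Rightarrow> 'b metric \<Rightarrow> 'a metric" where
  "pullback M f h p v w =
     (let df = frechet_derivative f (at p within M) in h (f p) (df v) (df w))"

definition isometry_between :: "'a::euclidean_space set \<Rightarrow> 'a metric \<Rightarrow>
    'b::euclidean_space set \<Rightarrow> 'b metric \<Rightarrow> ('a \<Rightarrow> 'b) \<Rightarrow> bool" where
  "isometry_between M g N h f \<longleftrightarrow> diffeomorphism M N f \<and>
     (\<forall>p\<in>M. \<forall>v\<in>tangent_space M p. \<forall>w\<in>tangent_space M p. pullback M f h p v w = g p v w)"

definition conformal_between :: "'a::euclidean_space set \<Rightarrow> 'a metric \<Rightarrow>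
    'b::euclidean_space set \<Rightarrow> 'b metric \<Rightarrow> ('a \<Rightarrow> 'b) \<Rightarrow> bool" where
  "conformal_between M g N h f \<longleftrightarrow> diffeomorphism M N f \<and>
     (\<exists>\<mu>::'a \<Rightarrow> real. \<forall>p\<in>M. 0 < \<mu> p \<and>
       (\<forall>v\<in>tangent_space M p. \<forall>w\<in>tangent_space M p. pullback M f h p v w = \<mu> p * g p v w))"


section \<open>Minkowski space and its lightcone\<close>

text \<open>Minkowski space of dimension \<open>1 + n\<close> is \<open>real \<times> (real ^ 'n)\<close> with \<open>n = CARD('n)\<close>.\<close>

type_synonym 'n minkowski = "real \<times> (real ^ 'n)"

definition mink :: "'n::finite minkowski \<Rightarrow> 'n minkowski \<Rightarrow> real" where
  "mink v w = - (fst v * fst w) + snd v \<bullet> snd w"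

definition lightcone :: "'n::finite minkowski set" where
  "lightcone = {p. mink p p = 0 \<and> fst p > 0}"

definition open_in_cone :: "'n::finite minkowski set \<Rightarrow> bool" where
  "open_in_cone U \<longleftrightarrow> openin (top_of_set lightcone) U"

definition O_lorentz :: "('n::finite minkowski \<Rightarrow> 'n minkowski) set" where
  "O_lorentz = {A. linear A \<and> (\<forall>p. mink (A p) (A p) = mink p p)}"

definition O_plus :: "('n::finite minkowski \<Rightarrow> 'n minkowski) set" where
  "O_plus = {A \<in> O_lorentz. A ` lightcone = lightcone}"

definition cone_isometry ::
  "'n::finite minkowski set \<Rightarrow> 'n minkowski set \<Rightarrow> ('n minkowski \<Rightarrow> 'n minkowski) \<Rightarrow> bool" where
  "cone_isometry U V f \<longleftrightarrow> isometry_between U (\<lambda>_. mink) V (\<lambda>_. mink) f"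


section \<open>Induced transformations of the space of null half-lines\<close>

text \<open>
  The null half-lines of the cone are the rays \<open>{r *\<^sub>R (1, x) | r. r > 0}\<close> with \<open>x\<close> in the unit
  sphere; \<open>null_direction\<close> is the quotient map of the cone onto the sphere.
\<close>

definition null_direction :: "'n::finite minkowski \<Rightarrow> real ^ 'n" where
  "null_direction p = snd p /\<^sub>R fst p"

definition sphere_conformal ::
  "(real ^ 'n::finite) set \<Rightarrow> (real ^ 'n) set \<Rightarrow> (real ^ 'n \<Rightarrow> real ^ 'n) \<Rightarrow> bool" where
  "sphere_conformal \<Omega> \<Omega>' \<phi> \<longleftrightarrow> conformal_between \<Omega> (\<lambda>_. inner) \<Omega>' (\<lambda>_. inner) \<phi>"

definition induces ::
  "'n::finite minkowski set \<Rightarrow> ('n minkowski \<Rightarrow> 'n minkowski) \<Rightarrow> (real ^ 'n \<Rightarrow> real ^ 'n) \<Rightarrow> bool" where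
  "induces U f \<phi> \<longleftrightarrow> (\<forall>p\<in>U. \<phi> (null_direction p) = null_direction (f p))"

text \<open>
  An isometry \<open>f\<close> between open subsets \<open>U\<close>, \<open>V\<close> of the cone maps null segments to null segments, but
  if a null half-line meets \<open>U\<close> in several pieces, \<open>f\<close> may send them to different half-lines (think
  of a spiral strip \<open>U\<close> lying over an annulus and a branch of the square root), and then \<open>f\<close> induces
  no map on the set of half-lines meeting \<open>U\<close>; dually for \<open>V\<close> and the inverse of \<open>f\<close>. The following
  condition excludes this. Every point has arbitrarily small neighbourhoods satisfying it, and so
  do the cones over arbitrary open subsets of the sphere.
\<close>

definition null_connected :: "'n::finite minkowski set \<Rightarrow> bool" where
  "null_connected U \<longleftrightarrow> (\<forall>x. connected {p \<in> U. null_direction p = x})"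

text \<open>Maps with a given domain are represented by extensional functions, so that equality of the
  functions is equality on the domain.\<close>

definition local_isometries :: "'n::finite minkowski set \<Rightarrow> ('n minkowski \<Rightarrow> 'n minkowski) set" where
  "local_isometries U =
     {f \<in> extensional U. \<exists>V. open_in_cone V \<and> null_connected V \<and> cone_isometry U V f}"

definition local_conformal_maps :: "(real ^ 'n::finite) set \<Rightarrow> (real ^ 'n \<Rightarrow> real ^ 'n) set" where
  "local_conformal_maps \<Omega> =
     {\<phi> \<in> extensional \<Omega>. \<exists>\<Omega>'. openin (top_of_set (sphere 0 1)) \<Omega>' \<and> sphere_conformal \<Omega> \<Omega>' \<phi>}"

end

theory Submission
  imports Defs "HOL-Complex_Analysis.Cauchy_Integral_Formula"
begin

text \<open>
  Write \<open>\<langle>_, _\<rangle>\<close> for the Minkowski product. Let \<open>f\<close> be an isometry between open pieces of the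
  lightcone. At a point \<open>q\<close> the kernel of the metric is the line of \<open>q\<close>, so \<open>f\<close> maps null segments
  into null segments and acts on null directions. The projection of the cone to the sphere of null
  directions multiplies squared lengths by \<open>1 / q\<^sub>0\<^sup>2\<close> (\<open>null_direction_conformal\<close>). Measuring on
  the sphere therefore shows two things: \<open>f\<close> is homogeneous of degree one along null segments
  (\<open>cone_isometry_homogeneous\<close>), and the induced map of directions is conformal with factor
  \<open>(p\<^sub>0 / f(p)\<^sub>0)\<^sup>2\<close> (\<open>isometry_direction_factor\<close>). The factor determines the time coordinate of
  \<open>f\<close>, so that conversely every conformal map of the sphere has exactly one isometric lift. This is
  the correspondence for the cone over the two-sphere (\<open>isometry_conformal_correspondence\<close>). On the
  circle every diffeomorphism is conformal and therefore lifts, which is the absence of rigidity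
  there.

  For rigidity, the cone is cut by an affine null hyperplane in a paraboloid on which the metric is
  the flat metric of a Euclidean space. Let \<open>F\<close> be the restriction of \<open>f\<close> to it, a map with
  \<open>\<langle>F, F\<rangle> = 0\<close> and \<open>\<langle>F\<^sub>v, F\<^sub>w\<rangle> = v \<bullet> w\<close>, where indices denote directional derivatives.
  Differentiating, the vectors \<open>F\<^sub>v\<^sub>w\<close> are orthogonal to all \<open>F\<^sub>z\<close>, and for orthogonal \<open>v\<close> and \<open>w\<close>
  also to \<open>F\<close>; hence \<open>F\<^sub>v\<^sub>w\<close> is a multiple \<open>a F\<close>. If this multiple is zero for all orthogonal pairs,
  then \<open>F\<close> is a quadratic polynomial of the same shape as the paraboloid, and by homogeneity \<open>f\<close> is
  near the given point the restriction of a Lorentz transformation (\<open>umbilic_lift_lorentz\<close>). This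
  transformation is locally constant in the point, which gives the conclusion on connected sets.

  The multiple vanishes for two different reasons. If the sphere has dimension at least three, there
  is a third direction orthogonal to \<open>v\<close> and \<open>w\<close>, and the symmetry of third derivatives forces
  \<open>a = 0\<close> (\<open>second_orthogonal_vanishes\<close>); this is local. For the two-sphere, \<open>a\<close> is a component of a
  holomorphic quadratic differential. An isometry of the whole cone makes it an entire function in
  the flat chart. Since \<open>F\<close> grows quadratically while its second derivatives remain bounded, by
  homogeneity and smoothness of \<open>f\<close> at the point opposite to the chart, this entire function tends
  to zero at infinity and vanishes by Liouville's theorem (\<open>second_orthogonal_vanishes_entire\<close>,
  \<open>global_rigidity\<close>).
\<close>

section \<open>Smooth maps between Euclidean spaces\<close>

text \<open>
  The class \<open>C\<^sup>k\<close> is defined through derivatives in fixed directions, regarded as functions of the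
  point; the direction therefore comes first.
\<close>

definition dir_deriv :: "'a::euclidean_space \<Rightarrow> ('a \<Rightarrow> 'b::euclidean_space) \<Rightarrow> 'a \<Rightarrow> 'b" where
  "dir_deriv v f x = frechet_derivative f (at x) v"

lemma Ck_on_Suc:
  "Ck_on (Suc k) W f \<longleftrightarrow> (\<forall>x\<in>W. f differentiable (at x)) \<and> (\<forall>v. Ck_on k W (dir_deriv v f))"
  by (simp add: dir_deriv_def[abs_def])

declare Ck_on.simps(2) [simp del]

lemma dir_deriv_eqI: "(f has_derivative D) (at x) \<Longrightarrow> dir_deriv v f x = D v"
  unfolding dir_deriv_def by (drule frechet_derivative_at) simp

lemma has_derivative_dir_deriv:
  "f differentiable (at x) \<Longrightarrow> (f has_derivative (\<lambda>v. dir_deriv v f x)) (at x)"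
  unfolding dir_deriv_def by (simp add: frechet_derivative_works)

lemma dir_deriv_transform:
  assumes "f differentiable (at x)" "open W" "x \<in> W" "\<And>y. y \<in> W \<Longrightarrow> f y = g y"
  shows "g differentiable (at x)" "dir_deriv v g x = dir_deriv v f x"
proof -
  have *: "(g has_derivative (\<lambda>v. dir_deriv v f x)) (at x)"
    by (rule has_derivative_transform_within_open[OF has_derivative_dir_deriv[OF assms(1)] assms(2,3,4)])
  show "g differentiable (at x)" using * by (rule differentiableI)
  show "dir_deriv v g x = dir_deriv v f x" using * by (rule dir_deriv_eqI)
qed

lemma Ck_on_cong:
  assumes "open W" "\<And>x. x \<in> W \<Longrightarrow> f x = g x" "Ck_on k W f"
  shows "Ck_on k W g"
  using assms(2,3)
proof (induction k arbitrary: f g)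
  case 0
  then show ?case by (simp cong: continuous_on_cong)
next
  case (Suc k)
  have d: "f differentiable (at x)" if "x \<in> W" for x using Suc.prems(2) that by (simp add: Ck_on_Suc)
  note t = dir_deriv_transform[OF d assms(1) _ Suc.prems(1)]
  have "Ck_on k W (dir_deriv v g)" for v
  proof (rule Suc.IH)
    show "dir_deriv v f x = dir_deriv v g x" if "x \<in> W" for x using t(2) that by metis
    show "Ck_on k W (dir_deriv v f)" using Suc.prems(2) by (simp add: Ck_on_Suc)
  qed
  then show ?case using t(1) by (simp add: Ck_on_Suc)
qed

lemma Ck_on_subset: "Ck_on k W f \<Longrightarrow> V \<subseteq> W \<Longrightarrow> Ck_on k V f"
  by (induction k arbitrary: f) (auto simp: Ck_on_Suc continuous_on_subset)

lemma Ck_on_SucD: "Ck_on (Suc k) W f \<Longrightarrow> Ck_on k W f"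
proof (induction k arbitrary: f)
  case 0
  then have "f differentiable_on W"
    by (auto simp: Ck_on_Suc differentiable_on_def intro: differentiable_at_withinI)
  then show ?case by (simp add: differentiable_imp_continuous_on)
next
  case (Suc k)
  then show ?case by (subst Ck_on_Suc) (auto simp: Ck_on_Suc[of "Suc k"])
qed

lemma Ck_on_const: "Ck_on k W (\<lambda>x. c)"
proof (induction k arbitrary: c)
  case (Suc k)
  have "dir_deriv v (\<lambda>x. c) = (\<lambda>x. 0)" for v :: 'a by (auto simp: dir_deriv_def)
  then show ?case using Suc by (simp add: Ck_on_Suc)
qed simp

lemma Ck_on_bounded_linear:
  assumes "bounded_linear L" shows "Ck_on k W L"
proof (cases k)
  case 0
  then show ?thesis using assms by (simp add: linear_continuous_on)
next
  case (Suc j)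
  have "dir_deriv v L = (\<lambda>x. L v)" for v
    using bounded_linear_imp_has_derivative[OF assms] by (intro ext dir_deriv_eqI)
  then show ?thesis using Suc bounded_linear_imp_differentiable[OF assms]
    by (auto simp: Ck_on_Suc Ck_on_const)
qed

lemma Ck_on_add:
  assumes "open W" "Ck_on k W f" "Ck_on k W g" shows "Ck_on k W (\<lambda>x. f x + g x)"
  using assms(2,3)
proof (induction k arbitrary: f g)
  case 0
  then show ?case by (auto intro: continuous_intros)
next
  case (Suc k)
  then have d: "f differentiable (at x)" "g differentiable (at x)" if "x \<in> W" for x
    using that by (auto simp: Ck_on_Suc)
  have e: "dir_deriv v (\<lambda>x. f x + g x) x = dir_deriv v f x + dir_deriv v g x" if "x \<in> W" for v x
    by (rule dir_deriv_eqI) (intro derivative_intros has_derivative_dir_deriv d that)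
  have "Ck_on k W (dir_deriv v (\<lambda>x. f x + g x))" for v
    by (rule Ck_on_cong[OF assms(1) _ Suc.IH[of "dir_deriv v f" "dir_deriv v g"]])
       (use e Suc.prems in \<open>auto simp: Ck_on_Suc\<close>)
  then show ?case using d by (auto simp: Ck_on_Suc)
qed

text \<open>
  The product rule for an arbitrary bounded bilinear map covers at once scalar multiples, inner
  products and the Minkowski form.
\<close>

lemma Ck_on_bilinear:
  assumes "bounded_bilinear B" "open W" "Ck_on k W f" "Ck_on k W g"
  shows "Ck_on k W (\<lambda>x. B (f x) (g x))"
  using assms(3,4)
proof (induction k arbitrary: f g)
  case 0
  then show ?case by (auto intro: bounded_bilinear.continuous_on[OF assms(1)])
next
  case (Suc k)
  then have d: "f differentiable (at x)" "g differentiable (at x)" if "x \<in> W" for x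
    using that by (auto simp: Ck_on_Suc)
  have D: "((\<lambda>x. B (f x) (g x)) has_derivative
      (\<lambda>v. B (f x) (dir_deriv v g x) + B (dir_deriv v f x) (g x))) (at x)" if "x \<in> W" for x
    by (rule bounded_bilinear.FDERIV[OF assms(1)]) (intro has_derivative_dir_deriv d that)+
  have "Ck_on k W (dir_deriv v f)" "Ck_on k W (dir_deriv v g)" for v
    using Suc.prems by (simp_all add: Ck_on_Suc)
  then have "Ck_on k W (\<lambda>x. B (f x) (dir_deriv v g x) + B (dir_deriv v f x) (g x))" for v
    by (intro Ck_on_add[OF assms(2)] Suc.IH Suc.prems[THEN Ck_on_SucD])
  then have "Ck_on k W (dir_deriv v (\<lambda>x. B (f x) (g x)))" for v
    by (rule Ck_on_cong[OF assms(2), rotated]) (use dir_deriv_eqI[OF D] in auto)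
  then show ?case using differentiableI[OF D] by (auto simp: Ck_on_Suc)
qed

lemma Ck_on_sum:
  assumes "open W" "\<And>i. i \<in> I \<Longrightarrow> Ck_on k W (f i)" shows "Ck_on k W (\<lambda>x. \<Sum>i\<in>I. f i x)"
  using assms(2)
  by (induction I rule: infinite_finite_induct) (auto intro: Ck_on_const Ck_on_add[OF assms(1)])

lemma has_derivative_compose_dir_deriv:
  assumes "f differentiable (at x)" "g differentiable (at (f x))"
  shows "((\<lambda>x. g (f x)) has_derivative (\<lambda>v. dir_deriv (dir_deriv v f x) g (f x))) (at x)"
  using has_derivative_compose[OF has_derivative_dir_deriv[OF assms(1)]
      has_derivative_dir_deriv[OF assms(2)]] .

lemma dir_deriv_linear: "f differentiable (at x) \<Longrightarrow> linear (\<lambda>v. dir_deriv v f x)"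
  unfolding dir_deriv_def by (rule linear_frechet_derivative)

lemma dir_deriv_expand:
  assumes "g differentiable (at y)"
  shows "dir_deriv w g y = (\<Sum>b\<in>Basis. (w \<bullet> b) *\<^sub>R dir_deriv b g y)"
proof -
  have "dir_deriv w g y = dir_deriv (\<Sum>b\<in>Basis. (w \<bullet> b) *\<^sub>R b) g y"
    by (simp add: euclidean_representation)
  also have "\<dots> = (\<Sum>b\<in>Basis. (w \<bullet> b) *\<^sub>R dir_deriv b g y)"
    by (simp add: linear_sum[OF dir_deriv_linear[OF assms]] linear_cmul[OF dir_deriv_linear[OF assms]])
  finally show ?thesis .
qed

text \<open>
  By the chain rule, the derivative of \<open>g \<circ> f\<close> in direction \<open>v\<close> is the sum over the basis vectors
  \<open>b\<close> of the products of \<open>\<partial>\<^sub>v f \<bullet> b\<close> with \<open>\<partial>\<^sub>b g \<circ> f\<close>; the second factor is again a composition, of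
  one order less, and so the induction on the order closes.
\<close>

lemma Ck_on_compose:
  fixes f :: "'a::euclidean_space \<Rightarrow> 'b::euclidean_space" and g :: "'b \<Rightarrow> 'c::euclidean_space"
  assumes "open W" "Ck_on k W f" "Ck_on k V g" "f ` W \<subseteq> V"
  shows "Ck_on k W (\<lambda>x. g (f x))"
  using assms(2,3)
proof (induction k arbitrary: g)
  case 0
  then show ?case using assms(4) continuous_on_compose2 by auto
next
  case (Suc k)
  have fd: "f differentiable (at x)" and gd: "g differentiable (at (f x))" if "x \<in> W" for x
    using that Suc.prems assms(4) by (auto simp: Ck_on_Suc)
  note D = has_derivative_compose_dir_deriv[OF fd gd]
  have f': "Ck_on k W (dir_deriv v f)" for v using Suc.prems(1) by (simp add: Ck_on_Suc)
  have g': "Ck_on k W (\<lambda>x. dir_deriv b g (f x))" for b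
    by (rule Suc.IH[OF Ck_on_SucD[OF Suc.prems(1)]]) (use Suc.prems(2) in \<open>simp add: Ck_on_Suc\<close>)
  have "Ck_on k W (\<lambda>x. \<Sum>b\<in>Basis. (dir_deriv v f x \<bullet> b) *\<^sub>R dir_deriv b g (f x))" for v
    by (intro Ck_on_sum[OF assms(1)] Ck_on_bilinear[OF bounded_bilinear_scaleR assms(1)]
        Ck_on_bilinear[OF bounded_bilinear_inner assms(1)] Ck_on_const f' g')
  then have "Ck_on k W (dir_deriv v (\<lambda>x. g (f x)))" for v
    by (rule Ck_on_cong[OF assms(1), rotated])
       (simp add: dir_deriv_eqI[OF D] dir_deriv_expand[OF gd, symmetric])
  then show ?case using differentiableI[OF D] by (auto simp: Ck_on_Suc)
qed

lemma smooth_on_cong: "open W \<Longrightarrow> (\<And>x. x \<in> W \<Longrightarrow> f x = g x) \<Longrightarrow> smooth_on W f \<Longrightarrow> smooth_on W g"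
  unfolding smooth_on_def using Ck_on_cong by blast

lemma smooth_on_subset: "smooth_on W f \<Longrightarrow> V \<subseteq> W \<Longrightarrow> smooth_on V f"
  unfolding smooth_on_def using Ck_on_subset by blast

lemma smooth_on_const [intro!]: "smooth_on W (\<lambda>x. c)"
  unfolding smooth_on_def using Ck_on_const by blast

lemma smooth_on_bounded_linear: "bounded_linear L \<Longrightarrow> smooth_on W L"
  unfolding smooth_on_def using Ck_on_bounded_linear by blast

lemma smooth_on_id [intro!]: "smooth_on W (\<lambda>x. x)"
  by (rule smooth_on_bounded_linear) (rule bounded_linear_ident)

lemma smooth_on_bilinear:
  "bounded_bilinear B \<Longrightarrow> open W \<Longrightarrow> smooth_on W f \<Longrightarrow> smooth_on W g \<Longrightarrow> smooth_on W (\<lambda>x. B (f x) (g x))"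
  unfolding smooth_on_def using Ck_on_bilinear by blast

lemma smooth_on_add: "open W \<Longrightarrow> smooth_on W f \<Longrightarrow> smooth_on W g \<Longrightarrow> smooth_on W (\<lambda>x. f x + g x)"
  unfolding smooth_on_def using Ck_on_add by blast

lemma smooth_on_sum: "open W \<Longrightarrow> (\<And>i. i \<in> I \<Longrightarrow> smooth_on W (f i)) \<Longrightarrow> smooth_on W (\<lambda>x. \<Sum>i\<in>I. f i x)"
  unfolding smooth_on_def by (auto intro: Ck_on_sum)

lemma smooth_on_compose:
  "open W \<Longrightarrow> smooth_on W f \<Longrightarrow> smooth_on V g \<Longrightarrow> f ` W \<subseteq> V \<Longrightarrow> smooth_on W (\<lambda>x. g (f x))"
  unfolding smooth_on_def using Ck_on_compose by blast

lemma smooth_on_linear_compose: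
  "bounded_linear L \<Longrightarrow> open W \<Longrightarrow> smooth_on W f \<Longrightarrow> smooth_on W (\<lambda>x. L (f x))"
  by (rule smooth_on_compose[where V = UNIV and g = L]) (auto intro: smooth_on_bounded_linear)

lemma smooth_on_scaleR:
  "open W \<Longrightarrow> smooth_on W f \<Longrightarrow> smooth_on W g \<Longrightarrow> smooth_on W (\<lambda>x. f x *\<^sub>R g x)"
  by (rule smooth_on_bilinear[OF bounded_bilinear_scaleR])

lemma smooth_on_mult:
  "open W \<Longrightarrow> smooth_on W f \<Longrightarrow> smooth_on W g \<Longrightarrow> smooth_on W (\<lambda>x. f x * g x :: real)"
  by (rule smooth_on_bilinear[OF bounded_bilinear_mult])

lemma smooth_on_inner:
  "open W \<Longrightarrow> smooth_on W f \<Longrightarrow> smooth_on W g \<Longrightarrow> smooth_on W (\<lambda>x. f x \<bullet> g x)"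
  by (rule smooth_on_bilinear[OF bounded_bilinear_inner])

lemma smooth_on_minus: "open W \<Longrightarrow> smooth_on W f \<Longrightarrow> smooth_on W (\<lambda>x. - f x)"
  by (rule smooth_on_linear_compose[OF bounded_linear_minus[OF bounded_linear_ident]])

lemma smooth_on_diff: "open W \<Longrightarrow> smooth_on W f \<Longrightarrow> smooth_on W g \<Longrightarrow> smooth_on W (\<lambda>x. f x - g x)"
  using smooth_on_add[of W f "\<lambda>x. - g x"] smooth_on_minus[of W g] by simp

lemma smooth_on_fst: "open W \<Longrightarrow> smooth_on W f \<Longrightarrow> smooth_on W (\<lambda>x. fst (f x))"
  by (rule smooth_on_linear_compose[OF bounded_linear_fst])

lemma smooth_on_snd: "open W \<Longrightarrow> smooth_on W f \<Longrightarrow> smooth_on W (\<lambda>x. snd (f x))"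
  by (rule smooth_on_linear_compose[OF bounded_linear_snd])

lemma smooth_on_Pair:
  assumes "open W" "smooth_on W f" "smooth_on W g" shows "smooth_on W (\<lambda>x. (f x, g x))"
proof -
  have "smooth_on W (\<lambda>x. (f x, 0) + (0, g x))"
    by (intro smooth_on_add assms smooth_on_linear_compose[where f=f and L="\<lambda>x. (x,0)"]
        smooth_on_linear_compose[where f=g and L="\<lambda>x. (0,x)"] bounded_linear_Pair
        bounded_linear_ident bounded_linear_zero)
  then show ?thesis by simp
qed

lemma smooth_onD:
  assumes "smooth_on W f" 
  shows "x \<in> W \<Longrightarrow> f differentiable (at x)" "smooth_on W (dir_deriv v f)" "continuous_on W f"
  using assms unfolding smooth_on_def
  by (metis Ck_on_Suc, metis Ck_on_Suc, metis Ck_on.simps(1))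

lemma smooth_on_dir_deriv_along:
  assumes "open W" "smooth_on W f" "smooth_on W X"
  shows "smooth_on W (\<lambda>x. dir_deriv (X x) f x)"
proof -
  have "smooth_on W (\<lambda>x. \<Sum>b\<in>Basis. (X x \<bullet> b) *\<^sub>R dir_deriv b f x)"
    by (intro smooth_on_sum smooth_on_scaleR smooth_on_inner smooth_on_const assms smooth_onD(2))
  then show ?thesis
    by (rule smooth_on_cong[OF assms(1), rotated])
       (use dir_deriv_expand smooth_onD(1)[OF assms(2)] in metis)
qed

lemma smooth_on_local:
  assumes "\<And>x. x \<in> W \<Longrightarrow> \<exists>V. open V \<and> x \<in> V \<and> smooth_on V f"
  shows "smooth_on W f"
proof -
  have "Ck_on k W f" if "\<And>x. x \<in> W \<Longrightarrow> \<exists>V. open V \<and> x \<in> V \<and> Ck_on k V f" for k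
    using that
  proof (induction k arbitrary: f)
    case 0
    then show ?case
      by (metis Ck_on.simps(1) continuous_at_imp_continuous_on continuous_on_eq_continuous_at)
  next
    case (Suc k)
    then show ?case unfolding Ck_on_Suc by meson
  qed
  then show ?thesis using assms unfolding smooth_on_def by meson
qed

lemma smooth_on_inverse_real: "smooth_on {x::real. x \<noteq> 0} inverse"
proof -
  have o: "open {x::real. x \<noteq> 0}" by (simp add: open_Collect_neq)
  have D: "(inverse has_derivative (\<lambda>v. - (inverse x * v * inverse x))) (at x)" if "x \<noteq> 0" for x :: real
    using has_derivative_inverse'[OF that] by simp
  have "Ck_on k {x::real. x \<noteq> 0} inverse" for k
  proof (induction k)
    case 0
    then show ?case by (auto intro!: continuous_intros)
  next
    case (Suc k)
    have "Ck_on k {x::real. x \<noteq> 0} (\<lambda>x. - (inverse x * v * inverse x))" for v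
    proof -
      have "Ck_on k {x::real. x \<noteq> 0} (\<lambda>x. (-v) * (inverse x * inverse x))"
        by (intro Ck_on_bilinear[OF bounded_bilinear_mult o] Ck_on_const Suc)
      then show ?thesis by (rule Ck_on_cong[OF o, rotated]) auto
    qed
    then have "Ck_on k {x::real. x \<noteq> 0} (dir_deriv v inverse)" for v
      by (rule Ck_on_cong[OF o, rotated]) (use dir_deriv_eqI[OF D] in auto)
    then show ?case using differentiableI[OF D] by (auto simp: Ck_on_Suc)
  qed
  then show ?thesis by (simp add: smooth_on_def)
qed

lemma smooth_on_inverse:
  "open W \<Longrightarrow> smooth_on W f \<Longrightarrow> (\<And>x. x \<in> W \<Longrightarrow> f x \<noteq> 0) \<Longrightarrow> smooth_on W (\<lambda>x. inverse (f x :: real))"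
  by (rule smooth_on_compose[OF _ _ smooth_on_inverse_real]) auto

lemma smooth_on_divide:
  "open W \<Longrightarrow> smooth_on W f \<Longrightarrow> smooth_on W g \<Longrightarrow> (\<And>x. x \<in> W \<Longrightarrow> g x \<noteq> 0) \<Longrightarrow>
    smooth_on W (\<lambda>x. f x / g x :: real)"
  using smooth_on_mult[of W f "\<lambda>x. inverse (g x)"] smooth_on_inverse[of W g]
  by (simp add: divide_inverse)

lemma smooth_on_sqrt_real: "smooth_on {0<..} sqrt"
proof -
  have D: "(sqrt has_derivative (\<lambda>v. v * (inverse (sqrt x) / 2))) (at x)" if "x > 0" for x :: real
  proof -
    have "(\<lambda>v. v * (inverse (sqrt x) / 2)) = (*) (inverse (sqrt x) / 2)" by (auto simp: fun_eq_iff)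
    then show ?thesis using DERIV_real_sqrt[OF that] by (simp add: has_field_derivative_def)
  qed
  have "Ck_on k {0<..} sqrt" for k
  proof (induction k)
    case 0
    then show ?case by (auto intro!: continuous_intros)
  next
    case (Suc k)
    have "Ck_on k {0<..} (\<lambda>x. inverse (sqrt x))"
      by (rule Ck_on_compose[OF _ Suc]) (use smooth_on_inverse_real in \<open>auto simp: smooth_on_def\<close>)
    then have "Ck_on k {0<..} (\<lambda>x. v / 2 * (inverse (sqrt x)))" for v
      by (intro Ck_on_bilinear[OF bounded_bilinear_mult] Ck_on_const) auto
    then have "Ck_on k {0<..} (dir_deriv v sqrt)" for v
      by (rule Ck_on_cong[rotated 2]) (use dir_deriv_eqI[OF D] in auto)
    then show ?case using differentiableI[OF D] by (auto simp: Ck_on_Suc)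
  qed
  then show ?thesis by (simp add: smooth_on_def)
qed

lemma smooth_on_sqrt:
  "open W \<Longrightarrow> smooth_on W f \<Longrightarrow> (\<And>x. x \<in> W \<Longrightarrow> f x > 0) \<Longrightarrow> smooth_on W (\<lambda>x. sqrt (f x))"
  by (rule smooth_on_compose[OF _ _ smooth_on_sqrt_real]) auto

lemmas smooth_intros = smooth_on_const smooth_on_id smooth_on_add smooth_on_diff smooth_on_minus
  smooth_on_scaleR smooth_on_mult smooth_on_inner smooth_on_fst smooth_on_snd smooth_on_Pair
  smooth_on_inverse smooth_on_divide smooth_on_sqrt

section \<open>Symmetry of second derivatives\<close>

text \<open>
  The second difference on the left is symmetric in \<open>v\<close> and \<open>w\<close>, while the mean value theorem,
  applied first along \<open>v\<close> and then along \<open>w\<close>, expresses it by one of the two mixed derivatives.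
\<close>

lemma second_difference_mean_value:
  fixes f :: "'a::euclidean_space \<Rightarrow> real"
  assumes f: "smooth_on W f" and h: "0 < h"
    and W: "\<And>s t. 0 \<le> s \<Longrightarrow> s \<le> h \<Longrightarrow> 0 \<le> t \<Longrightarrow> t \<le> h \<Longrightarrow> x + s *\<^sub>R v + t *\<^sub>R w \<in> W"
  shows "\<exists>s t. 0 < s \<and> s < h \<and> 0 < t \<and> t < h \<and>
    f (x + h *\<^sub>R v + h *\<^sub>R w) - f (x + h *\<^sub>R v) - f (x + h *\<^sub>R w) + f x
      = h\<^sup>2 * dir_deriv w (dir_deriv v f) (x + s *\<^sub>R v + t *\<^sub>R w)"
proof -
  have line: "((\<lambda>s. g (y + s *\<^sub>R u)) has_real_derivative dir_deriv u g (y + s *\<^sub>R u)) (at s)"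
    if "g differentiable (at (y + s *\<^sub>R u))" for g :: "'a \<Rightarrow> real" and y u s
  proof -
    have "((\<lambda>s. y + s *\<^sub>R u) has_derivative (\<lambda>r. r *\<^sub>R u)) (at s)"
      by (auto intro!: derivative_eq_intros)
    from has_derivative_compose[OF this has_derivative_dir_deriv[OF that]]
    have "((\<lambda>s. g (y + s *\<^sub>R u)) has_derivative (\<lambda>x. dir_deriv (x *\<^sub>R u) g (y + s *\<^sub>R u))) (at s)" .
    moreover have "(\<lambda>x. dir_deriv (x *\<^sub>R u) g (y + s *\<^sub>R u)) = (*) (dir_deriv u g (y + s *\<^sub>R u))"
      by (simp add: fun_eq_iff linear_cmul[OF dir_deriv_linear[OF that]])
    ultimately show ?thesis by (simp add: has_field_derivative_def)
  qed
  define \<psi> where "\<psi> = (\<lambda>s. f (x + h *\<^sub>R w + s *\<^sub>R v) - f (x + s *\<^sub>R v))"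
  have "(\<psi> has_real_derivative
     (dir_deriv v f (x + h *\<^sub>R w + s *\<^sub>R v) - dir_deriv v f (x + s *\<^sub>R v))) (at s)"
    if "0 \<le> s" "s \<le> h" for s
    unfolding \<psi>_def
    by (intro derivative_intros line smooth_onD(1)[OF f])
       (use W[of s 0] W[of s h] that h in \<open>auto simp: algebra_simps\<close>)
  from MVT2[OF h this] obtain s where s: "0 < s" "s < h"
    "\<psi> h - \<psi> 0 = h * (dir_deriv v f (x + h *\<^sub>R w + s *\<^sub>R v) - dir_deriv v f (x + s *\<^sub>R v))"
    by auto
  have "((\<lambda>t. dir_deriv v f (x + s *\<^sub>R v + t *\<^sub>R w)) has_real_derivative
      dir_deriv w (dir_deriv v f) (x + s *\<^sub>R v + t *\<^sub>R w)) (at t)" if "0 \<le> t" "t \<le> h" for t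
    by (intro line smooth_onD(1)[OF smooth_onD(2)[OF f]]) (use W[of s t] that s in auto)
  from MVT2[OF h this] obtain t where t: "0 < t" "t < h"
    "dir_deriv v f (x + s *\<^sub>R v + h *\<^sub>R w) - dir_deriv v f (x + s *\<^sub>R v) =
      h * dir_deriv w (dir_deriv v f) (x + s *\<^sub>R v + t *\<^sub>R w)" by auto
  have "x + h *\<^sub>R w + s *\<^sub>R v = x + s *\<^sub>R v + h *\<^sub>R w" "x + h *\<^sub>R w + h *\<^sub>R v = x + h *\<^sub>R v + h *\<^sub>R w"
    by simp_all
  then have "f (x + h *\<^sub>R v + h *\<^sub>R w) - f (x + h *\<^sub>R v) - f (x + h *\<^sub>R w) + f x
      = h\<^sup>2 * dir_deriv w (dir_deriv v f) (x + s *\<^sub>R v + t *\<^sub>R w)"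
    using s(3) t(3) by (simp add: \<psi>_def power2_eq_square algebra_simps)
  then show ?thesis using s t by blast
qed

lemma dir_deriv_inner_left:
  assumes "f differentiable (at x)" shows "dir_deriv v (\<lambda>x. f x \<bullet> b) x = dir_deriv v f x \<bullet> b"
  by (rule dir_deriv_eqI) (intro has_derivative_inner_left has_derivative_dir_deriv assms)

text \<open>
  Both mixed derivatives, at suitable points as near to \<open>x\<close> as desired, equal the same second
  difference quotient; continuity carries the equality to \<open>x\<close>.
\<close>

lemma dir_deriv_commute_real:
  fixes f :: "'a::euclidean_space \<Rightarrow> real"
  assumes "open W" "smooth_on W f" "x \<in> W"
  shows "dir_deriv w (dir_deriv v f) x = dir_deriv v (dir_deriv w f) x" (is "?P x = ?Q x")
proof (rule ccontr)
  assume ne: "?P x \<noteq> ?Q x"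
  define e where "e = \<bar>?P x - ?Q x\<bar> / 2"
  have e: "e > 0" using ne by (simp add: e_def)
  have cont: "isCont ?P x" "isCont ?Q x"
    using smooth_onD(3)[OF smooth_onD(2)[OF smooth_onD(2)[OF assms(2)]]] assms(1,3)
    by (auto simp: continuous_on_eq_continuous_at)
  have "\<forall>\<^sub>F y in nhds x. y \<in> W \<and> dist (?P y) (?P x) < e \<and> dist (?Q y) (?Q x) < e"
    using cont e assms(1,3) unfolding isCont_def tendsto_at_iff_tendsto_nhds
    by (intro eventually_conj eventually_nhds_in_open) (auto dest: tendstoD)
  then obtain d where d: "d > 0" "\<And>y. dist y x < d \<Longrightarrow> y \<in> W \<and> dist (?P y) (?P x) < e \<and> dist (?Q y) (?Q x) < e"
    unfolding eventually_nhds_metric by blast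
  \<comment> \<open>The parallelogram with sides \<open>h v\<close> and \<open>h w\<close> stays within distance \<open>d\<close> of \<open>x\<close>.\<close>
  define h where "h = d / (norm v + norm w + 1)"
  have h: "h > 0" unfolding h_def using d(1) by (intro divide_pos_pos add_nonneg_pos) auto
  have hd: "dist (x + s *\<^sub>R v + t *\<^sub>R w) x < d" if "0 \<le> s" "s \<le> h" "0 \<le> t" "t \<le> h" for s t
  proof -
    have "norm (s *\<^sub>R v + t *\<^sub>R w) \<le> s * norm v + t * norm w"
      using norm_triangle_ineq[of "s *\<^sub>R v" "t *\<^sub>R w"] that by simp
    also have "\<dots> \<le> h * norm v + h * norm w" using that by (intro add_mono mult_right_mono) auto
    also have "\<dots> < h * (norm v + norm w + 1)" using h by (simp add: algebra_simps)
    also have "\<dots> = d" 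
      unfolding h_def using add_nonneg_pos[of "norm v + norm w" 1] by simp
    finally show ?thesis by (simp add: dist_norm)
  qed
  obtain s t where 1: "0 < s" "s < h" "0 < t" "t < h"
    "f (x + h *\<^sub>R v + h *\<^sub>R w) - f (x + h *\<^sub>R v) - f (x + h *\<^sub>R w) + f x
      = h\<^sup>2 * ?P (x + s *\<^sub>R v + t *\<^sub>R w)"
    using second_difference_mean_value[OF assms(2) h, of x v w] hd d(2) by blast
  have "x + s *\<^sub>R w + t *\<^sub>R v \<in> W" if "0 \<le> s" "s \<le> h" "0 \<le> t" "t \<le> h" for s t
  proof -
    have "x + s *\<^sub>R w + t *\<^sub>R v = x + t *\<^sub>R v + s *\<^sub>R w" by simp
    then show ?thesis using hd[of t s] d(2) that by metis
  qed
  then obtain s' t' where 2: "0 < s'" "s' < h" "0 < t'" "t' < h"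
    "f (x + h *\<^sub>R w + h *\<^sub>R v) - f (x + h *\<^sub>R w) - f (x + h *\<^sub>R v) + f x
      = h\<^sup>2 * ?Q (x + s' *\<^sub>R w + t' *\<^sub>R v)"
    using second_difference_mean_value[OF assms(2) h, of x w v] by blast
  have eq: "x + s' *\<^sub>R w + t' *\<^sub>R v = x + t' *\<^sub>R v + s' *\<^sub>R w"
    "x + h *\<^sub>R w + h *\<^sub>R v = x + h *\<^sub>R v + h *\<^sub>R w" by simp_all
  have "h\<^sup>2 * ?P (x + s *\<^sub>R v + t *\<^sub>R w) = h\<^sup>2 * ?Q (x + t' *\<^sub>R v + s' *\<^sub>R w)"
    using 1(5) 2(5) unfolding eq by linarith
  then have "?P (x + s *\<^sub>R v + t *\<^sub>R w) = ?Q (x + t' *\<^sub>R v + s' *\<^sub>R w)" using h by simp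
  moreover have "dist (?P (x + s *\<^sub>R v + t *\<^sub>R w)) (?P x) < e"
    "dist (?Q (x + t' *\<^sub>R v + s' *\<^sub>R w)) (?Q x) < e"
    using d(2)[OF hd[of s t]] d(2)[OF hd[of t' s']] 1 2 by auto
  ultimately show False using e unfolding e_def dist_real_def by (smt (verit) field_sum_of_halves)
qed

lemma dir_deriv_commute:
  fixes f :: "'a::euclidean_space \<Rightarrow> 'b::euclidean_space"
  assumes "open W" "smooth_on W f" "x \<in> W"
  shows "dir_deriv w (dir_deriv v f) x = dir_deriv v (dir_deriv w f) x"
proof (rule euclidean_eqI)
  fix b :: 'b assume "b \<in> Basis"
  have sb: "smooth_on W (\<lambda>x. f x \<bullet> b)" by (intro smooth_intros assms)
  have *: "dir_deriv u (dir_deriv u' f) x \<bullet> b = dir_deriv u (dir_deriv u' (\<lambda>x. f x \<bullet> b)) x" for u u'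
  proof -
    have "dir_deriv u (dir_deriv u' (\<lambda>x. f x \<bullet> b)) x = dir_deriv u (\<lambda>x. dir_deriv u' f x \<bullet> b) x"
    proof (rule dir_deriv_transform(2)[OF _ assms(1,3), symmetric])
      show "dir_deriv u' (\<lambda>x. f x \<bullet> b) differentiable at x"
        by (rule smooth_onD(1)[OF smooth_onD(2)[OF sb] assms(3)])
      show "dir_deriv u' (\<lambda>x. f x \<bullet> b) y = dir_deriv u' f y \<bullet> b" if "y \<in> W" for y
        by (rule dir_deriv_inner_left[OF smooth_onD(1)[OF assms(2) that]])
    qed
    also have "\<dots> = dir_deriv u (dir_deriv u' f) x \<bullet> b"
      by (rule dir_deriv_inner_left) (rule smooth_onD(1)[OF smooth_onD(2)[OF assms(2)] assms(3)])
    finally show ?thesis by simp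
  qed
  show "dir_deriv w (dir_deriv v f) x \<bullet> b = dir_deriv v (dir_deriv w f) x \<bullet> b"
    unfolding * by (rule dir_deriv_commute_real[OF assms(1) sb assms(3)])
qed

section \<open>Differentials on tangent spaces\<close>

text \<open>
  On vectors that are not tangent to \<open>M\<close> the value is arbitrary. Facts about its values are
  therefore stated for tangent vectors, and obtained by following a curve in \<open>M\<close>.
\<close>

abbreviation differential ::
  "'a::euclidean_space set \<Rightarrow> ('a \<Rightarrow> 'b::euclidean_space) \<Rightarrow> 'a \<Rightarrow> 'a \<Rightarrow> 'b" where
  "differential M f p \<equiv> frechet_derivative f (at p within M)"

lemma smooth_mapE:
  assumes "smooth_map M f" "p \<in> M"
  obtains W F where "open W" "p \<in> W" "smooth_on W F" "\<And>x. x \<in> M \<Longrightarrow> x \<in> W \<Longrightarrow> f x = F x"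
  using assms unfolding smooth_map_def by (metis IntI)

lemma smooth_mapI:
  assumes "\<And>p. p \<in> M \<Longrightarrow> \<exists>W F. open W \<and> p \<in> W \<and> smooth_on W F \<and> (\<forall>x\<in>M \<inter> W. f x = F x)"
  shows "smooth_map M f"
  using assms unfolding smooth_map_def by blast

lemma smooth_map_restrict:
  assumes "smooth_map M f" "N \<subseteq> M" "\<And>x. x \<in> N \<Longrightarrow> f x = g x" shows "smooth_map N g"
proof (rule smooth_mapI)
  fix p assume "p \<in> N"
  then have p: "p \<in> M" using assms(2) by blast
  obtain W F where W: "open W" "p \<in> W" "smooth_on W F" "\<And>x. x \<in> M \<Longrightarrow> x \<in> W \<Longrightarrow> f x = F x"
    using smooth_mapE[OF assms(1) p] by metis
  have "\<forall>x\<in>N \<inter> W. g x = F x" using W(4) assms(2,3) by force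
  then show "\<exists>W F. open W \<and> p \<in> W \<and> smooth_on W F \<and> (\<forall>x\<in>N \<inter> W. g x = F x)"
    using W(1-3) by blast
qed

lemma smooth_map_cong: "smooth_map M f \<Longrightarrow> (\<And>x. x \<in> M \<Longrightarrow> f x = g x) \<Longrightarrow> smooth_map M g"
  by (rule smooth_map_restrict[OF _ subset_refl])

lemma smooth_map_of_smooth_on: "open W \<Longrightarrow> smooth_on W F \<Longrightarrow> M \<subseteq> W \<Longrightarrow> smooth_map M F"
  unfolding smooth_map_def by blast

lemma smooth_map_has_derivative:
  assumes "smooth_map M f" "p \<in> M"
  shows "(f has_derivative differential M f p) (at p within M)"
proof -
  obtain W F where W: "open W" "p \<in> W" "smooth_on W F" "\<And>x. x \<in> M \<Longrightarrow> x \<in> W \<Longrightarrow> f x = F x"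
    using smooth_mapE[OF assms] by metis
  have "(F has_derivative (\<lambda>v. dir_deriv v F p)) (at p within M)"
    using has_derivative_dir_deriv[OF smooth_onD(1)[OF W(3,2)]] by (rule has_derivative_at_withinI)
  moreover obtain d where "d > 0" "ball p d \<subseteq> W" using W(1,2) openE by blast
  ultimately have "(f has_derivative (\<lambda>v. dir_deriv v F p)) (at p within M)"
    using has_derivative_transform_within[OF _ _ assms(2), of F _ d f] W(4)
    by (auto simp: dist_commute subset_iff)
  then show ?thesis unfolding frechet_derivative_works[symmetric] differentiable_def by blast
qed

lemma smooth_map_continuous_on: "smooth_map M f \<Longrightarrow> continuous_on M f"
  unfolding continuous_on_eq_continuous_within
  using smooth_map_has_derivative has_derivative_continuous by blast

lemma linear_differential: "smooth_map M f \<Longrightarrow> p \<in> M \<Longrightarrow> linear (differential M f p)"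
  using smooth_map_has_derivative has_derivative_linear by blast

lemma smooth_map_compose:
  assumes f: "smooth_map M f" and g: "smooth_map N g" and "f ` M \<subseteq> N"
  shows "smooth_map M (\<lambda>x. g (f x))"
proof (rule smooth_mapI)
  fix p assume p: "p \<in> M"
  obtain W F where W: "open W" "p \<in> W" "smooth_on W F" "\<And>x. x \<in> M \<Longrightarrow> x \<in> W \<Longrightarrow> f x = F x"
    using smooth_mapE[OF f p] by metis
  have fp: "f p \<in> N" using p assms(3) by blast
  obtain V G where V: "open V" "f p \<in> V" "smooth_on V G" "\<And>x. x \<in> N \<Longrightarrow> x \<in> V \<Longrightarrow> g x = G x"
    using smooth_mapE[OF g fp] by metis
  let ?W = "W \<inter> F -` V"
  have o: "open ?W" using W(1,3) V(1) continuous_on_open_vimage smooth_onD(3) by (metis inf_commute)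
  moreover have "smooth_on ?W (\<lambda>x. G (F x))"
    by (rule smooth_on_compose[OF o smooth_on_subset[OF W(3)] V(3)]) auto
  moreover have "p \<in> ?W" using p W V by auto
  moreover have "g (f x) = G (F x)" if "x \<in> M \<inter> ?W" for x
    using that W(4)[of x] V(4)[of "f x"] assms(3) by auto
  ultimately show "\<exists>W F. open W \<and> p \<in> W \<and> smooth_on W F \<and> (\<forall>x\<in>M \<inter> W. g (f x) = F x)"
    by blast
qed

lemma tangent_spaceE:
  assumes "v \<in> tangent_space M p"
  obtains e c where "e > 0" "smooth_on {-e<..<e} c" "\<And>s. \<bar>s\<bar> < e \<Longrightarrow> c s \<in> M" "c 0 = p"
    "(c has_vector_derivative v) (at (0::real))"
proof -
  obtain e c where "e > 0" "smooth_on {-e<..<e} c" "c ` {-e<..<e} \<subseteq> M" "c 0 = p"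
    "(c has_vector_derivative v) (at (0::real))" using assms unfolding tangent_space_def by auto
  then show ?thesis by (intro that[of e c]) (auto simp: image_subset_iff abs_less_iff)
qed

lemma tangent_spaceI:
  assumes "e > 0" "smooth_on {-e<..<e} c" "\<And>s. \<bar>s\<bar> < e \<Longrightarrow> c s \<in> M" "c 0 = p"
    "(c has_vector_derivative v) (at (0::real))"
  shows "v \<in> tangent_space M p"
proof -
  have "c ` {-e<..<e} \<subseteq> M" using assms(3) by (auto simp: abs_less_iff)
  then show ?thesis unfolding tangent_space_def using assms(1,2,4,5) by blast
qed

lemma isCont_eventually_in_open:
  assumes "isCont c x" "open W" "c x \<in> W"
  shows "\<forall>\<^sub>F y in nhds x. c y \<in> W"
  using assms unfolding isCont_def by (metis tendsto_at_iff_tendsto_nhds topological_tendstoD)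

lemma curve_eventually_in_open:
  fixes c :: "real \<Rightarrow> 'a::topological_space"
  assumes "isCont c 0" "open W" "c 0 \<in> W"
  obtains d where "d > 0" "\<And>s. \<bar>s\<bar> < d \<Longrightarrow> c s \<in> W"
  using isCont_eventually_in_open[OF assms] that unfolding eventually_nhds_metric by auto

text \<open>
  The velocity of the image curve pins the differential down on tangent vectors: whenever two
  expressions describe the same image curve, their values agree by uniqueness of the velocity.
\<close>

lemma differential_curve:
  assumes f: "smooth_map M f" and e: "e > 0" and c: "\<And>s. \<bar>s\<bar> < e \<Longrightarrow> c s \<in> M" "c 0 = p"
    and v: "(c has_vector_derivative v) (at (0::real))"
  shows "((\<lambda>s. f (c s)) has_vector_derivative differential M f p v) (at 0)"
proof -
  let ?I = "{-e<..<e}"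
  have I: "at 0 within ?I = at 0" using e by (intro at_within_open) auto
  have p: "p \<in> M" using c(1)[of 0] c(2) e by simp
  have "(f has_derivative differential M f p) (at p within c ` ?I)"
    by (rule has_derivative_subset[OF smooth_map_has_derivative[OF f p]])
       (use c(1) in \<open>auto simp: abs_less_iff\<close>)
  then have "(f \<circ> c has_vector_derivative differential M f p v) (at 0 within ?I)"
    using c(2) v I by (intro vector_derivative_diff_chain_within) simp_all
  then show ?thesis using I by (simp add: o_def)
qed

lemma dir_deriv_curve:
  assumes "F differentiable (at (c s))" "(c has_vector_derivative v) (at s)"
  shows "((\<lambda>s. F (c s)) has_vector_derivative dir_deriv v F (c s)) (at s)"
  using vector_derivative_diff_chain_within[OF assms(2)
      has_derivative_at_withinI[OF has_derivative_dir_deriv[OF assms(1)]]] by (simp add: o_def)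

text \<open>
  This allows a differential to be computed with any smooth extension to the ambient space.
\<close>

lemma differential_extension:
  assumes f: "smooth_map M f" and p: "p \<in> M" and v: "v \<in> tangent_space M p"
    and W: "open W" "p \<in> W" "F differentiable (at p)" "\<And>x. x \<in> M \<Longrightarrow> x \<in> W \<Longrightarrow> f x = F x"
  shows "differential M f p v = dir_deriv v F p"
proof -
  obtain e c where c: "e > 0" "\<And>s. \<bar>s\<bar> < e \<Longrightarrow> c s \<in> M" "c 0 = p"
    "(c has_vector_derivative v) (at (0::real))"
    using tangent_spaceE[OF v] by metis
  have 1: "((\<lambda>s. f (c s)) has_vector_derivative differential M f p v) (at 0)"
    by (rule differential_curve[OF f c])
  have 2: "((\<lambda>s. F (c s)) has_vector_derivative dir_deriv v F (c 0)) (at 0)"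
    by (rule dir_deriv_curve[OF _ c(4)]) (use W c in simp)
  have "isCont c 0" using c(4) has_vector_derivative_continuous by blast
  then obtain d where d: "d > 0" "\<And>s. \<bar>s\<bar> < d \<Longrightarrow> c s \<in> W"
    using curve_eventually_in_open[of c W] W(1,2) c(3) by auto
  have "((\<lambda>s. f (c s)) has_vector_derivative dir_deriv v F p) (at 0)"
    using has_vector_derivative_transform_within[OF 2, of "min d e" "\<lambda>s. f (c s)"] c d W(4)
    by (simp add: dist_norm)
  then show ?thesis using 1 vector_derivative_unique_at by blast
qed

lemma differential_in_tangent_space:
  assumes f: "smooth_map M f" and fM: "f ` M \<subseteq> N" and p: "p \<in> M" and v: "v \<in> tangent_space M p"
  shows "differential M f p v \<in> tangent_space N (f p)"
proof -
  obtain e c where c: "e > 0" "smooth_on {-e<..<e} c" "\<And>s. \<bar>s\<bar> < e \<Longrightarrow> c s \<in> M" "c 0 = p"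
    "(c has_vector_derivative v) (at (0::real))"
    using tangent_spaceE[OF v] by metis
  obtain W F where W: "open W" "p \<in> W" "smooth_on W F" "\<And>x. x \<in> M \<Longrightarrow> x \<in> W \<Longrightarrow> f x = F x"
    using smooth_mapE[OF f p] by metis
  have "isCont c 0" using c(5) has_vector_derivative_continuous by blast
  then obtain d where d: "d > 0" "\<And>s. \<bar>s\<bar> < d \<Longrightarrow> c s \<in> W"
    using curve_eventually_in_open[of c W] W(1,2) c(4) by auto
  let ?e = "min d e"
  have sub: "{-?e<..<?e} \<subseteq> {-e<..<e}" by auto
  have "smooth_on {-?e<..<?e} (\<lambda>s. F (c s))"
    by (rule smooth_on_compose[OF _ smooth_on_subset[OF c(2) sub] W(3)])
       (use d in \<open>auto simp: abs_less_iff\<close>)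
  then have "smooth_on {-?e<..<?e} (\<lambda>s. f (c s))"
    by (rule smooth_on_cong[rotated 2]) (use W(4) c d in \<open>auto simp: abs_less_iff\<close>)
  then show ?thesis
    by (rule tangent_spaceI[rotated]) (use c d fM differential_curve[OF f c(1,3,4,5)] in auto)
qed

lemma differential_compose:
  assumes f: "smooth_map M f" and g: "smooth_map N g" and fM: "f ` M \<subseteq> N"
    and p: "p \<in> M" and v: "v \<in> tangent_space M p"
  shows "differential M (\<lambda>x. g (f x)) p v = differential N g (f p) (differential M f p v)"
proof -
  obtain e c where c: "e > 0" "\<And>s. \<bar>s\<bar> < e \<Longrightarrow> c s \<in> M" "c 0 = p"
    "(c has_vector_derivative v) (at (0::real))"
    using tangent_spaceE[OF v] by metis
  have "((\<lambda>s. g (f (c s))) has_vector_derivative differential M (\<lambda>x. g (f x)) p v) (at 0)"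
    by (rule differential_curve[OF smooth_map_compose[OF f g fM] c])
  moreover have "((\<lambda>s. g (f (c s))) has_vector_derivative
      differential N g (f p) (differential M f p v)) (at 0)"
    by (rule differential_curve[OF g c(1) _ _ differential_curve[OF f c]]) (use c fM in auto)
  ultimately show ?thesis using vector_derivative_unique_at by blast
qed

lemma differential_eq_id:
  assumes "\<And>x. x \<in> M \<Longrightarrow> f x = x" "p \<in> M" "v \<in> tangent_space M p"
  shows "differential M f p v = v"
proof -
  have "smooth_map M f"
    by (rule smooth_map_cong[OF smooth_map_of_smooth_on[of UNIV "\<lambda>x. x"]]) (use assms in auto)
  then have "differential M f p v = dir_deriv v (\<lambda>x. x) p"
    by (rule differential_extension[where W = UNIV]) (use assms in auto)
  then show ?thesis by (simp add: dir_deriv_def)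
qed

lemma diffeomorphismD:
  assumes "diffeomorphism M N f"
  shows "bij_betw f M N" "smooth_map M f" "smooth_map N (inv_into M f)" "f ` M = N" "inj_on f M"
    "inv_into M f ` N = M" "\<And>x. x \<in> M \<Longrightarrow> inv_into M f (f x) = x"
    "\<And>y. y \<in> N \<Longrightarrow> f (inv_into M f y) = y"
proof -
  show b: "bij_betw f M N" and "smooth_map M f" "smooth_map N (inv_into M f)"
    using assms unfolding diffeomorphism_def by auto
  show "f ` M = N" "inj_on f M" using b by (auto simp: bij_betw_def)
  show "inv_into M f ` N = M" using bij_betw_inv_into[OF b] by (simp add: bij_betw_def)
  show "inv_into M f (f x) = x" if "x \<in> M" for x using b that by (rule bij_betw_inv_into_left)
  show "f (inv_into M f y) = y" if "y \<in> N" for y using b that by (rule bij_betw_inv_into_right)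
qed

lemma diffeomorphism_inverse:
  assumes "diffeomorphism M N f" shows "diffeomorphism N M (inv_into M f)"
proof -
  note f = diffeomorphismD[OF assms]
  have i: "inj_on (inv_into M f) N" using bij_betw_inv_into[OF f(1)] by (simp add: bij_betw_def)
  have "inv_into N (inv_into M f) x = f x" if "x \<in> M" for x
    by (rule inv_into_f_eq[OF i imageI[OF that, of f, unfolded f(4)] f(7)[OF that]])
  then have "smooth_map M (inv_into N (inv_into M f))"
    by (intro smooth_map_cong[OF f(2)]) simp
  with f(3) bij_betw_inv_into[OF f(1)] show ?thesis by (simp add: diffeomorphism_def)
qed

lemma diffeomorphismI:
  assumes "smooth_map M f" "smooth_map N g" "\<And>x. x \<in> M \<Longrightarrow> f x \<in> N \<and> g (f x) = x"
    "\<And>y. y \<in> N \<Longrightarrow> g y \<in> M \<and> f (g y) = y"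
  shows "diffeomorphism M N f"
proof -
  have b: "bij_betw f M N" by (rule bij_betw_byWitness[where f' = g]) (use assms in auto)
  have "inv_into M f y = g y" if "y \<in> N" for y
    using b assms(4)[OF that] by (intro inv_into_f_eq) (simp_all add: bij_betw_def)
  then have "smooth_map N (inv_into M f)" by (intro smooth_map_cong[OF assms(2)]) simp
  then show ?thesis using b assms(1) by (simp add: diffeomorphism_def)
qed

lemma differential_inverse:
  assumes "diffeomorphism M N f" "p \<in> M" "v \<in> tangent_space M p"
  shows "differential N (inv_into M f) (f p) (differential M f p v) = v"
proof -
  note f = diffeomorphismD[OF assms(1)]
  have "differential N (inv_into M f) (f p) (differential M f p v)
     = differential M (\<lambda>x. inv_into M f (f x)) p v"
    by (rule differential_compose[symmetric, OF f(2,3) _ assms(2,3)]) (simp add: f(4))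
  also have "\<dots> = v" by (rule differential_eq_id[OF f(7) assms(2,3)])
  finally show ?thesis .
qed

lemma differential_inverse':
  assumes "diffeomorphism M N f" "q \<in> N" "w \<in> tangent_space N q"
  shows "differential M f (inv_into M f q) (differential N (inv_into M f) q w) = w"
proof -
  note f = diffeomorphismD[OF assms(1)]
  have "differential M f (inv_into M f q) (differential N (inv_into M f) q w)
     = differential N (\<lambda>x. f (inv_into M f x)) q w"
    by (rule differential_compose[symmetric, OF f(3,2) _ assms(2,3)]) (simp add: f(6))
  also have "\<dots> = w" by (rule differential_eq_id[OF f(8) assms(2,3)])
  finally show ?thesis .
qed

text \<open>
  Applied with \<open>\<mu> = 1\<close> to isometries and with positive \<open>\<mu>\<close> to conformal maps, this shows that the
  inverse is of the same kind.
\<close>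

lemma pullback_inverse:
  assumes "diffeomorphism M N f"
    and "\<And>p v w. p \<in> M \<Longrightarrow> v \<in> tangent_space M p \<Longrightarrow> w \<in> tangent_space M p \<Longrightarrow>
      pullback M f h p v w = \<mu> p * g p v w"
    and "q \<in> N" "v \<in> tangent_space N q" "w \<in> tangent_space N q"
  shows "h q v w = \<mu> (inv_into M f q) * pullback N (inv_into M f) g q v w"
proof -
  note f = diffeomorphismD[OF assms(1)]
  let ?p = "inv_into M f q" and ?D = "differential N (inv_into M f) q"
  have p: "?p \<in> M" using f(6) assms(3) by blast
  have T: "?D v \<in> tangent_space M ?p" "?D w \<in> tangent_space M ?p"
    by (rule differential_in_tangent_space[OF f(3) equalityD1[OF f(6)] assms(3)]; fact)+
  have "h q v w = pullback M f h ?p (?D v) (?D w)"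
    using f(8)[OF assms(3)] differential_inverse'[OF assms(1,3)] assms(4,5)
    by (simp add: pullback_def Let_def)
  also have "\<dots> = \<mu> ?p * g ?p (?D v) (?D w)" by (rule assms(2)[OF p T])
  finally show ?thesis by (simp add: pullback_def Let_def)
qed

lemma isometry_between_inverse:
  assumes "isometry_between M g N h f" shows "isometry_between N h M g (inv_into M f)"
proof -
  have d: "diffeomorphism M N f" using assms by (simp add: isometry_between_def)
  have i: "pullback M f h p v w = 1 * g p v w"
      if "p \<in> M" "v \<in> tangent_space M p" "w \<in> tangent_space M p" for p v w
    using assms that by (auto simp: isometry_between_def)
  show ?thesis
    using diffeomorphism_inverse[OF d] pullback_inverse[OF d i]
    by (simp add: isometry_between_def)
qed

section \<open>Tangent spaces of open subsets and of spheres\<close>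

lemma tangent_space_openin:
  assumes "openin (top_of_set S) U" "p \<in> U"
  shows "tangent_space U p = tangent_space S p"
proof
  show "tangent_space U p \<subseteq> tangent_space S p"
    using openin_imp_subset[OF assms(1)] unfolding tangent_space_def by blast
  show "tangent_space S p \<subseteq> tangent_space U p"
  proof
    fix v assume "v \<in> tangent_space S p"
    then obtain e c where c: "e > 0" "smooth_on {-e<..<e} c" "\<And>s. \<bar>s\<bar> < e \<Longrightarrow> c s \<in> S" "c 0 = p"
      "(c has_vector_derivative v) (at (0::real))"
      using tangent_spaceE by metis
    obtain W where W: "open W" "U = S \<inter> W" using assms(1) by (auto simp: openin_open)
    have "isCont c 0" using c(5) has_vector_derivative_continuous by blast
    then obtain d where d: "d > 0" "\<And>s. \<bar>s\<bar> < d \<Longrightarrow> c s \<in> W"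
      using curve_eventually_in_open[of c W] W assms(2) c(4) by auto
    let ?e = "min d e"
    have sub: "{-?e<..<?e} \<subseteq> {-e<..<e}" by auto
    show "v \<in> tangent_space U p"
      by (rule tangent_spaceI[OF _ smooth_on_subset[OF c(2) sub]]) (use c d W in auto)
  qed
qed

lemma smooth_on_norm:
  assumes "open W" "smooth_on W f" "\<And>x. x \<in> W \<Longrightarrow> f x \<noteq> 0" shows "smooth_on W (\<lambda>x. norm (f x))"
  unfolding norm_eq_sqrt_inner by (intro smooth_intros assms) (use assms(3) in auto)

text \<open>
  A tangent vector is orthogonal to \<open>x\<close> because \<open>c \<bullet> c\<close> is constant along a curve in the sphere.
  Conversely, the straight line in direction \<open>v\<close>, projected radially to the sphere, has velocity
  \<open>v\<close> when \<open>v\<close> is orthogonal to \<open>x\<close>.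
\<close>

lemma tangent_space_sphere:
  assumes x: "(x::'a::euclidean_space) \<in> sphere 0 1"
  shows "tangent_space (sphere 0 1) x = {v. x \<bullet> v = 0}"
proof (intro equalityI subsetI CollectI)
  fix v assume "v \<in> tangent_space (sphere 0 1) x"
  then obtain e c where c: "e > 0" "\<And>s. \<bar>s\<bar> < e \<Longrightarrow> c s \<in> sphere 0 1" "c 0 = x"
      "(c has_vector_derivative v) (at (0::real))"
      using tangent_spaceE by metis
  have "((\<lambda>s. c s \<bullet> c s) has_vector_derivative c 0 \<bullet> v + v \<bullet> c 0) (at 0)"
    using has_derivative_inner[OF c(4)[unfolded has_vector_derivative_def]
      c(4)[unfolded has_vector_derivative_def]]
    by (simp add: has_vector_derivative_def algebra_simps)
  moreover have "((\<lambda>s. c s \<bullet> c s) has_vector_derivative 0) (at 0)"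
    by (rule has_vector_derivative_transform_within[OF has_vector_derivative_const[of 1] c(1)])
       (use c(2) in \<open>auto simp: dist_norm norm_eq_1\<close>)
  ultimately have "c 0 \<bullet> v + v \<bullet> c 0 = 0" by (rule vector_derivative_unique_at)
  then show "x \<bullet> v = 0" using c(3) by (simp add: inner_commute)
next
  fix v assume "v \<in> {v. x \<bullet> v = 0}"
  then have v: "x \<bullet> v = 0" by simp
  have xx: "x \<bullet> x = 1" using x by (simp add: norm_eq_1)
  have nz: "x + s *\<^sub>R v \<noteq> 0" for s
  proof
    assume "x + s *\<^sub>R v = 0"
    then have "x \<bullet> (x + s *\<^sub>R v) = 0" by simp
    then show False using v xx by (simp add: inner_add_right)
  qed
  let ?c = "\<lambda>s. inverse (norm (x + s *\<^sub>R v)) *\<^sub>R (x + s *\<^sub>R v)"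
  have "smooth_on UNIV ?c"
    by (intro smooth_intros smooth_on_norm) (use nz in auto)
  then have "smooth_on {-1<..<1} ?c" by (rule smooth_on_subset) auto
  moreover have "(?c has_vector_derivative v) (at 0)"
  proof -
    have "((\<lambda>s. norm (x + s *\<^sub>R v)) has_derivative (\<lambda>h. h * 0)) (at 0)"
    proof -
      have "((\<lambda>s. norm (x + s *\<^sub>R v)) has_derivative (\<lambda>h. (h *\<^sub>R v) \<bullet> sgn (x + 0 *\<^sub>R v))) (at 0)"
        by (rule has_derivative_compose[where g = norm and f =
          "\<lambda>s. x + s *\<^sub>R v", OF _ has_derivative_norm[OF nz[of 0]]])
           (auto intro!: derivative_eq_intros)
      then show ?thesis using v by (simp add: sgn_div_norm inner_commute)
    qed
    then show ?thesis
      unfolding has_vector_derivative_def using nz xx v inner_commute[of v x]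
      by (auto intro!: derivative_eq_intros simp: norm_eq_sqrt_inner)
  qed
  ultimately show "v \<in> tangent_space (sphere 0 1) x"
    by (intro tangent_spaceI[of 1 ?c]) (use nz x in auto)
qed

section \<open>The lightcone and its null directions\<close>

lemma mink_commute: "mink v w = mink w v"
  by (simp add: mink_def inner_commute mult.commute)

lemma bounded_bilinear_mink: "bounded_bilinear (mink :: 'n::finite minkowski \<Rightarrow> _)"
  unfolding bilinear_conv_bounded_bilinear[symmetric] bilinear_def
  by (auto intro!: linearI simp: mink_def algebra_simps inner_add_left inner_add_right)

lemmas mink_add_left = bounded_bilinear.add_left[OF bounded_bilinear_mink]
  and mink_add_right = bounded_bilinear.add_right[OF bounded_bilinear_mink]
  and mink_diff_left = bounded_bilinear.diff_left[OF bounded_bilinear_mink]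
  and mink_diff_right = bounded_bilinear.diff_right[OF bounded_bilinear_mink]
  and mink_scaleR_left = bounded_bilinear.scaleR_left[OF bounded_bilinear_mink]
  and mink_scaleR_right = bounded_bilinear.scaleR_right[OF bounded_bilinear_mink]
  and mink_zero_left = bounded_bilinear.zero_left[OF bounded_bilinear_mink]
  and mink_zero_right = bounded_bilinear.zero_right[OF bounded_bilinear_mink]

lemmas mink_simps = mink_add_left mink_add_right mink_diff_left mink_diff_right
  mink_scaleR_left mink_scaleR_right mink_zero_left mink_zero_right

lemma smooth_on_mink:
  "open W \<Longrightarrow> smooth_on W f \<Longrightarrow> smooth_on W g \<Longrightarrow> smooth_on W (\<lambda>x. mink (f x) (g x))"
  by (rule smooth_on_bilinear[OF bounded_bilinear_mink])

lemma lightcone_iff: "p \<in> lightcone \<longleftrightarrow> fst p > 0 \<and> norm (snd p) = fst p"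
proof -
  have "mink p p = (norm (snd p))\<^sup>2 - (fst p)\<^sup>2"
    by (simp add: mink_def power2_norm_eq_inner) (simp add: power2_eq_square)
  moreover have "norm (snd p) = fst p" if "fst p > 0" "(norm (snd p))\<^sup>2 = (fst p)\<^sup>2"
    using that(2) norm_ge_zero less_imp_le[OF that(1)] by (rule power2_eq_imp_eq)
  ultimately show ?thesis unfolding lightcone_def by auto
qed

lemma lightconeD:
  assumes "p \<in> lightcone"
  shows "fst p > 0" "norm (snd p) = fst p" "mink p p = 0" "snd p \<noteq> 0" "snd p \<bullet> snd p = fst p * fst p"
proof -
  show *: "fst p > 0" "norm (snd p) = fst p" "mink p p = 0"
    using assms by (blast dest: iffD1[OF lightcone_iff], blast dest: iffD1[OF lightcone_iff],
      simp add: lightcone_def)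
  show "snd p \<noteq> 0" using *(1,2) norm_zero by (metis less_irrefl)
  show "snd p \<bullet> snd p = fst p * fst p" using *(3) by (simp add: mink_def)
qed

lemma lightcone_scaleR: "p \<in> lightcone \<Longrightarrow> t > 0 \<Longrightarrow> t *\<^sub>R p \<in> lightcone"
  by (simp add: lightcone_iff)

lemma lightcone_ray: "x \<in> sphere 0 1 \<Longrightarrow> t > 0 \<Longrightarrow> t *\<^sub>R (1, x) \<in> lightcone"
  by (simp add: lightcone_iff)

lemma null_direction_ray: "t \<noteq> 0 \<Longrightarrow> null_direction (t *\<^sub>R (1, x)) = x"
  by (simp add: null_direction_def)

lemma null_direction_sphere: "p \<in> lightcone \<Longrightarrow> null_direction p \<in> sphere 0 1"
  by (auto simp: lightcone_iff null_direction_def)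

lemma lightcone_ray_eq: "p \<in> lightcone \<Longrightarrow> p = fst p *\<^sub>R (1, null_direction p)"
  by (auto simp: lightcone_iff null_direction_def prod_eq_iff)

lemma open_in_coneD: "open_in_cone U \<Longrightarrow> p \<in> U \<Longrightarrow> p \<in> lightcone"
  unfolding open_in_cone_def using openin_imp_subset by blast

lemma open_fst_pos: "open {p :: real \<times> 'a::euclidean_space. fst p > 0}"
  by (intro open_Collect_less continuous_intros)

lemma smooth_on_null_direction: "smooth_on {p. fst p > 0} null_direction"
  unfolding null_direction_def by (intro smooth_intros open_fst_pos) auto

lemma null_direction_differentiable: "fst q > 0 \<Longrightarrow> null_direction differentiable (at q)"
  using smooth_onD(1)[OF smooth_on_null_direction] by simp

lemma dir_deriv_null_direction:
  assumes "fst q > 0"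
  shows "dir_deriv a null_direction q = (1 / fst q) *\<^sub>R snd a - (fst a / (fst q * fst q)) *\<^sub>R snd q"
  unfolding null_direction_def
  by (rule dir_deriv_eqI)
     (use assms in \<open>auto intro!: derivative_eq_intros simp: algebra_simps divide_inverse\<close>)

text \<open>
  The projection of the cone to the sphere of null directions scales the metric by \<open>1 / x\<^sub>0\<^sup>2\<close>.
  This is the description of the metric as \<open>0 \<oplus> e\<^sup>2\<^sup>t g\<close>, and it is the link between isometries of
  the cone and conformal maps of the sphere.
\<close>

lemma null_direction_conformal:
  assumes q: "q \<in> lightcone" and a: "mink q a = 0" and b: "mink q b = 0"
  shows "dir_deriv a null_direction q \<bullet> dir_deriv b null_direction q = mink a b / (fst q)\<^sup>2"
proof -
  note Q = lightconeD[OF q]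
  have ab: "snd q \<bullet> snd a = fst q * fst a" "snd q \<bullet> snd b = fst q * fst b"
    "snd a \<bullet> snd q = fst q * fst a" "snd b \<bullet> snd q = fst q * fst b"
    using a b by (simp_all add: mink_def inner_commute)
  show ?thesis using Q(1)
    by (simp add: dir_deriv_null_direction inner_diff_left inner_diff_right ab Q(5))
       (simp add: mink_def field_simps power2_eq_square)
qed

text \<open>
  The metric of the cone is positive semi-definite with the ray as its kernel: a tangent vector of
  length zero has vanishing projection to the sphere.
\<close>

lemma null_tangent_vector:
  assumes q: "q \<in> lightcone" and w: "mink q w = 0" "mink w w = 0"
  shows "w = (fst w / fst q) *\<^sub>R q"
proof -
  have "dir_deriv w null_direction q \<bullet> dir_deriv w null_direction q = 0"
    using null_direction_conformal[OF q w(1,1)] w(2) by simp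
  then have "(1 / fst q) *\<^sub>R snd w = (fst w / (fst q * fst q)) *\<^sub>R snd q"
    using dir_deriv_null_direction[of q w] lightconeD[OF q] by simp
  then have "fst q *\<^sub>R ((1 / fst q) *\<^sub>R snd w) = fst q *\<^sub>R ((fst w / (fst q * fst q)) *\<^sub>R snd q)" by simp
  then show ?thesis using lightconeD(1)[OF q] by (simp add: prod_eq_iff)
qed

text \<open>
  The inclusion from left to right differentiates \<open>mink c c = 0\<close>. For the converse, a straight line
  in the spatial variables is lifted to the cone by taking its norm as time coordinate.
\<close>

lemma tangent_space_lightcone:
  fixes p :: "'n::finite minkowski"
  assumes p: "p \<in> lightcone"
  shows "tangent_space lightcone p = {v. mink p v = 0}"
proof (intro equalityI subsetI CollectI)
  fix v assume "v \<in> tangent_space lightcone p"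
  then obtain e c where c: "e > 0" "\<And>s. \<bar>s\<bar> < e \<Longrightarrow> c s \<in> lightcone" "c 0 = p"
      "(c has_vector_derivative v) (at (0::real))"
      using tangent_spaceE by metis
  have "((\<lambda>s. mink (c s) (c s)) has_vector_derivative mink (c 0) v + mink v (c 0)) (at 0)"
    using bounded_bilinear.FDERIV[OF bounded_bilinear_mink c(4)[unfolded has_vector_derivative_def]
      c(4)[unfolded has_vector_derivative_def]]
    by (simp add: has_vector_derivative_def mink_simps algebra_simps)
  moreover have "((\<lambda>s. mink (c s) (c s)) has_vector_derivative 0) (at 0)"
    by (rule has_vector_derivative_transform_within[OF has_vector_derivative_const[of 0] c(1)])
       (use c(2) in \<open>auto simp: lightcone_def\<close>)
  ultimately have "mink (c 0) v + mink v (c 0) = 0" by (rule vector_derivative_unique_at)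
  then show "mink p v = 0" using c(3) by (simp add: mink_commute)
next
  fix v assume "v \<in> {v. mink p v = 0}"
  then have v: "snd p \<bullet> snd v = fst p * fst v" by (simp add: mink_def)
  note P = lightconeD[OF p]
  let ?l = "\<lambda>s::real. snd p + s *\<^sub>R snd v"
  have "isCont ?l 0" by (intro continuous_intros)
  then obtain e where e: "e > 0" "\<And>s. \<bar>s\<bar> < e \<Longrightarrow> ?l s \<noteq> 0"
    using curve_eventually_in_open[of ?l "- {0}"] P(4) by auto
  let ?c = "\<lambda>s. (norm (?l s), ?l s)"
  have "smooth_on {-e<..<e} ?c"
    by (intro smooth_intros smooth_on_norm) (use e(2) in \<open>auto simp: abs_less_iff\<close>)
  moreover have "((\<lambda>s. norm (?l s)) has_derivative (\<lambda>h. (h *\<^sub>R snd v) \<bullet> sgn (?l 0))) (at 0)"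
    by (rule has_derivative_compose[where g = norm and f = ?l, OF _ has_derivative_norm[OF e(2)]])
       (use e in \<open>auto intro!: derivative_eq_intros\<close>)
  then have "(?c has_vector_derivative v) (at 0)"
    unfolding has_vector_derivative_def
    by (auto intro!: derivative_eq_intros simp: prod_eq_iff)
       (use v P in \<open>auto simp: sgn_div_norm inner_commute fun_eq_iff prod_eq_iff\<close>)
  ultimately show "v \<in> tangent_space lightcone p"
    by (intro tangent_spaceI[of e ?c]) (use e P in \<open>auto simp: lightcone_iff prod_eq_iff\<close>)
qed

lemma tangent_space_open_in_cone: "open_in_cone U \<Longrightarrow> p \<in> U \<Longrightarrow> tangent_space U p = {v. mink p v = 0}"
  using tangent_space_openin tangent_space_lightcone open_in_coneD unfolding open_in_cone_def by metis

lemma tangent_space_open_in_sphere: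
  "openin (top_of_set (sphere 0 1)) \<Omega> \<Longrightarrow> x \<in> \<Omega> \<Longrightarrow> tangent_space \<Omega> x = {v. x \<bullet> v = 0}"
  using tangent_space_openin tangent_space_sphere openin_imp_subset by (metis subsetD)

section \<open>Isometries are homogeneous along null half-lines\<close>

text \<open>
  The differential of an isometry preserves the Minkowski product only on tangent vectors of the
  cone, that is on vectors orthogonal to the foot point; this form of the hypothesis is used
  throughout.
\<close>

lemma cone_isometryD:
  assumes "cone_isometry U V f" "open_in_cone U" "open_in_cone V"
  shows "diffeomorphism U V f" "smooth_map U f" "f ` U = V" "inj_on f U"
    "\<And>p. p \<in> U \<Longrightarrow> f p \<in> lightcone"
    "\<And>p a b. p \<in> U \<Longrightarrow> mink p a = 0 \<Longrightarrow> mink p b = 0 \<Longrightarrow>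
      mink (differential U f p a) (differential U f p b) = mink a b"
    "\<And>p a. p \<in> U \<Longrightarrow> mink p a = 0 \<Longrightarrow> mink (f p) (differential U f p a) = 0"
proof -
  show d: "diffeomorphism U V f" using assms(1) by (simp add: cone_isometry_def isometry_between_def)
  show s: "smooth_map U f" and fU: "f ` U = V" and "inj_on f U" using diffeomorphismD[OF d] by auto
  show "f p \<in> lightcone" if "p \<in> U" for p using that fU open_in_coneD[OF assms(3)] by blast
  show "mink (differential U f p a) (differential U f p b) = mink a b"
    if "p \<in> U" "mink p a = 0" "mink p b = 0" for p a b
  proof -
    have "a \<in> tangent_space U p" "b \<in> tangent_space U p"
      using that tangent_space_open_in_cone[OF assms(2) that(1)] by auto
    then show ?thesis using assms(1) that(1)
      unfolding cone_isometry_def isometry_between_def pullback_def Let_def by blast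
  qed
  show "mink (f p) (differential U f p a) = 0" if "p \<in> U" "mink p a = 0" for p a
    using differential_in_tangent_space[OF s eq_refl[OF fU] that(1), of a]
      tangent_space_open_in_cone[OF assms(2) that(1)] tangent_space_open_in_cone[OF assms(3)] that fU
    by blast
qed

lemma cone_isometry_inverse: "cone_isometry U V f \<Longrightarrow> cone_isometry V U (inv_into U f)"
  unfolding cone_isometry_def by (rule isometry_between_inverse)

text \<open>
  Along a null half-line the velocity of \<open>f\<close> is the image of a null vector, hence itself null and
  tangent to the cone, hence radial. So the null direction of \<open>f\<close> has velocity zero.
\<close>

lemma cone_isometry_null_curve:
  assumes f: "cone_isometry U V f" "open_in_cone U" "open_in_cone V" and s: "s *\<^sub>R q \<in> U"
    and q: "q \<in> lightcone" and s0: "s > 0"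
  shows "((\<lambda>s. null_direction (f (s *\<^sub>R q))) has_vector_derivative 0) (at s)"
proof -
  note D = cone_isometryD[OF f]
  obtain W where W: "open W" "U = lightcone \<inter> W" using f(2) by (auto simp: open_in_cone_def openin_open)
  have "isCont (\<lambda>r. (s + r) *\<^sub>R q) 0" by (intro continuous_intros)
  then obtain d where d: "d > 0" "\<And>r. \<bar>r\<bar> < d \<Longrightarrow> (s + r) *\<^sub>R q \<in> W"
    using curve_eventually_in_open[of "\<lambda>r. (s + r) *\<^sub>R q" W] s W by auto
  let ?e = "min d s"
  have m: "mink (s *\<^sub>R q) q = 0" "mink q q = 0" using lightconeD[OF q] by (simp_all add: mink_simps)
  let ?w = "differential U f (s *\<^sub>R q) q" and ?p = "f (s *\<^sub>R q)"
  have 1: "((\<lambda>r. f ((s + r) *\<^sub>R q)) has_vector_derivative ?w) (at 0)"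
  proof (rule differential_curve[OF D(2), of ?e])
    show "(s + r) *\<^sub>R q \<in> U" if "\<bar>r\<bar> < ?e" for r
      using d(2)[of r] that lightcone_scaleR[OF q, of "s + r"] by (auto simp: W(2))
  qed (use d s0 in \<open>auto intro!: derivative_eq_intros simp: has_vector_derivative_def\<close>)
  have fp: "fst ?p > 0" using lightconeD(1)[OF D(5)[OF s]] .
  have w: "?w = (fst ?w / fst ?p) *\<^sub>R ?p"
    by (rule null_tangent_vector[OF D(5)[OF s] D(7)[OF s m(1)]]) (simp add: D(6)[OF s m(1,1)] m)
  have "snd ?w = (fst ?w / fst ?p) *\<^sub>R snd ?p" by (subst w) simp
  then have "dir_deriv ?w null_direction ?p = 0" using fp by (simp add: dir_deriv_null_direction)
  moreover have "((\<lambda>r. null_direction (f ((s + r) *\<^sub>R q))) has_vector_derivative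
      dir_deriv ?w null_direction (f ((s + 0) *\<^sub>R q))) (at 0)"
    by (rule dir_deriv_curve[OF null_direction_differentiable 1]) (use fp in simp)
  ultimately have "((\<lambda>r. null_direction (f ((s + r) *\<^sub>R q))) has_derivative (\<lambda>x. 0)) (at (s + (- s)))"
    by (simp add: has_vector_derivative_def)
  then have b: "((\<lambda>r. null_direction (f ((s + r) *\<^sub>R q))) has_derivative (\<lambda>x. 0)) (at (s - s))" by simp
  have a: "((\<lambda>t. t - s) has_derivative (\<lambda>x. x)) (at s)" by (auto intro!: derivative_eq_intros)
  show ?thesis
    using has_derivative_compose[OF a b] by (simp add: has_vector_derivative_def)
qed

text \<open>
  The convex set \<open>B\<close> keeps the whole segment between \<open>q\<close> and \<open>t q\<close> inside \<open>U\<close>.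
\<close>

lemma cone_isometry_ray_direction:
  assumes f: "cone_isometry U V f" "open_in_cone U" "open_in_cone V"
    and B: "convex B" "B \<inter> lightcone \<subseteq> U" and q: "q \<in> lightcone" "q \<in> B" "t > 0" "t *\<^sub>R q \<in> B"
  shows "null_direction (f (t *\<^sub>R q)) = null_direction (f q)"
proof -
  define S where "S = {s. s > 0 \<and> s *\<^sub>R q \<in> B}"
  have "convex S" unfolding S_def convex_def
  proof (intro ballI allI impI, clarify)
    fix x y u v :: real assume *: "x > 0" "x *\<^sub>R q \<in> B" "y > 0" "y *\<^sub>R q \<in> B" "0 \<le> u" "0 \<le> v" "u + v = 1"
    have "u *\<^sub>R (x *\<^sub>R q) + v *\<^sub>R (y *\<^sub>R q) \<in> B" using B(1) * by (intro convexD)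
    moreover have "u * x + v * y > 0" using * by (smt (verit) mult_nonneg_nonneg mult_pos_pos)
    ultimately show "u *\<^sub>R x + v *\<^sub>R y > 0 \<and> (u *\<^sub>R x + v *\<^sub>R y) *\<^sub>R q \<in> B"
      by (simp add: algebra_simps)
  qed
  moreover have "((\<lambda>s. null_direction (f (s *\<^sub>R q))) has_vector_derivative 0) (at s within S)"
    if "s \<in> S" for s
    using that B(2) q(1) lightcone_scaleR[OF q(1)] unfolding S_def
    by (intro has_vector_derivative_at_within[OF cone_isometry_null_curve[OF f]]) auto
  ultimately obtain c where c: "\<And>s. s \<in> S \<Longrightarrow> null_direction (f (s *\<^sub>R q)) = c"
    using has_vector_derivative_zero_constant[of S "\<lambda>s. null_direction (f (s *\<^sub>R q))"] by blast
  have "1 \<in> S" "t \<in> S" using q by (auto simp: S_def)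
  then show ?thesis using c[of 1] c[of t] by simp
qed

text \<open>
  In dimension one the metric of the cone vanishes identically; this is where at least two spatial
  dimensions are needed.
\<close>

lemma ex_spacelike_tangent_vector:
  fixes q :: "'n::finite minkowski"
  assumes "2 \<le> CARD('n)"
  shows "\<exists>a. mink q a = 0 \<and> mink a a > 0"
proof -
  obtain y :: "real ^ 'n" where y: "y \<noteq> 0" "orthogonal (snd q) y"
    using orthogonal_to_vector_exists[of "snd q"] assms by auto
  show ?thesis by (rule exI[of _ "(0, y)"]) (use y in \<open>auto simp: mink_def orthogonal_def\<close>)
qed

text \<open>
  The null direction of \<open>f\<close> does not change when a point is moved along its half-line, so a
  spacelike tangent vector \<open>a\<close> at \<open>q\<close> and the vector \<open>t a\<close> at \<open>t q\<close> have the same image on the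
  sphere. The squared norm of this image is \<open>\<langle>a, a\<rangle> / f(q)\<^sub>0\<^sup>2\<close> from the first point and
  \<open>t\<^sup>2 \<langle>a, a\<rangle> / f(t q)\<^sub>0\<^sup>2\<close> from the second.
\<close>

lemma cone_isometry_homogeneous:
  fixes f :: "'n::finite minkowski \<Rightarrow> 'n minkowski"
  assumes n: "2 \<le> CARD('n)" and f: "cone_isometry U V f" "open_in_cone U" "open_in_cone V"
    and B: "open B" "convex B" "B \<inter> lightcone \<subseteq> U"
    and q: "q \<in> lightcone" "q \<in> B" "t > 0" "t *\<^sub>R q \<in> B"
  shows "f (t *\<^sub>R q) = t *\<^sub>R f q"
proof -
  note D = cone_isometryD[OF f]
  have qU: "q \<in> U" "t *\<^sub>R q \<in> U" using q B(3) lightcone_scaleR by blast+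
  \<comment> \<open>Differentiating at \<open>q\<close> requires that all points near \<open>q\<close> can be moved by the factor \<open>t\<close>.\<close>
  define U' where "U' = lightcone \<inter> {x \<in> B. t *\<^sub>R x \<in> B}"
  have "open {x \<in> B. t *\<^sub>R x \<in> B}"
    using open_Int[OF B(1) open_vimage[OF B(1), of "\<lambda>x. t *\<^sub>R x"]]
      continuous_on_scaleR[OF continuous_on_const continuous_on_id, of UNIV t]
    by (simp add: vimage_def Int_def)
  then have U': "open_in_cone U'" unfolding open_in_cone_def U'_def by (auto simp: openin_open)
  have qU': "q \<in> U'" using q by (auto simp: U'_def)
  have hom: "null_direction (f (t *\<^sub>R x)) = null_direction (f x)" if "x \<in> U'" for x
    using cone_isometry_ray_direction[OF f B(2,3)] that q(3) by (auto simp: U'_def)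
  obtain a where a: "mink q a = 0" "mink a a > 0" using ex_spacelike_tangent_vector[OF n] by metis
  then have "a \<in> tangent_space U' q" using tangent_space_open_in_cone[OF U' qU'] by simp
  then obtain e c where c: "e > 0" "\<And>s. \<bar>s\<bar> < e \<Longrightarrow> c s \<in> U'" "c 0 = q"
    "(c has_vector_derivative a) (at (0::real))"
    using tangent_spaceE by metis
  let ?v = "differential U f q a" and ?w = "differential U f (t *\<^sub>R q) (t *\<^sub>R a)"
  have ta: "mink (t *\<^sub>R q) (t *\<^sub>R a) = 0" using a by (simp add: mink_simps)
  have cU: "c s \<in> U" "t *\<^sub>R c s \<in> U" if "\<bar>s\<bar> < e" for s
    using c(2)[OF that] B(3) lightcone_scaleR[of "c s" t] q(3) by (auto simp: U'_def)
  have 1: "((\<lambda>s. f (c s)) has_vector_derivative ?v) (at 0)"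
    by (rule differential_curve[OF D(2) c(1) cU(1) c(3,4)])
  have 2: "((\<lambda>s. f (t *\<^sub>R c s)) has_vector_derivative ?w) (at 0)"
    by (rule differential_curve[OF D(2) c(1) cU(2)])
       (use c(3,4) in \<open>auto intro!: derivative_eq_intros simp: has_vector_derivative_def algebra_simps\<close>)
  note l = D(5)[OF qU(1)] D(5)[OF qU(2)]
  have "((\<lambda>s. null_direction (f (c s))) has_vector_derivative dir_deriv ?v null_direction (f (c 0))) (at 0)"
    by (rule dir_deriv_curve[OF null_direction_differentiable 1]) (use lightconeD(1)[OF l(1)] c(3) in simp)
  moreover have "((\<lambda>s. null_direction (f (t *\<^sub>R c s))) has_vector_derivative dir_deriv ?w null_direction
    (f (t *\<^sub>R c 0))) (at 0)"
    by (rule dir_deriv_curve[OF null_direction_differentiable 2]) (use lightconeD(1)[OF l(2)] c(3) in simp)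
  then have "((\<lambda>s. null_direction (f (c s))) has_vector_derivative dir_deriv ?w null_direction (f (t *\<^sub>R c
    0))) (at 0)"
    by (rule has_vector_derivative_transform_within[OF _ c(1)]) (use hom c(2) in auto)
  ultimately have eq: "dir_deriv ?v null_direction (f q) = dir_deriv ?w null_direction (f (t *\<^sub>R q))"
    using vector_derivative_unique_at c(3) by metis
  have "mink a a / (fst (f q))\<^sup>2 = mink ?v ?v / (fst (f q))\<^sup>2" using D(6)[OF qU(1) a(1,1)] by simp
  also have "\<dots> = mink ?w ?w / (fst (f (t *\<^sub>R q)))\<^sup>2"
    using null_direction_conformal[OF l(1) D(7)[OF qU(1) a(1)] D(7)[OF qU(1) a(1)]]
      null_direction_conformal[OF l(2) D(7)[OF qU(2) ta] D(7)[OF qU(2) ta]] eq by metis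
  also have "\<dots> = t\<^sup>2 * mink a a / (fst (f (t *\<^sub>R q)))\<^sup>2"
    using D(6)[OF qU(2) ta ta] by (simp add: mink_simps power2_eq_square)
  finally have "(fst (f (t *\<^sub>R q)))\<^sup>2 = (t * fst (f q))\<^sup>2"
    using a(2) lightconeD(1)[OF l(1)] lightconeD(1)[OF l(2)] by (simp add: field_simps power2_eq_square)
  then have fst: "fst (f (t *\<^sub>R q)) = t * fst (f q)"
    using q(3) lightconeD(1)[OF l(1)] lightconeD(1)[OF l(2)] by (subst (asm) power2_eq_iff_nonneg) auto
  have "f (t *\<^sub>R q) = fst (f (t *\<^sub>R q)) *\<^sub>R (1, null_direction (f (t *\<^sub>R q)))"
    by (rule lightcone_ray_eq[OF l(2)])
  also have "\<dots> = t *\<^sub>R (fst (f q) *\<^sub>R (1, null_direction (f q)))" using hom[OF qU'] fst by simp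
  also have "\<dots> = t *\<^sub>R f q" using lightcone_ray_eq[OF l(1)] by simp
  finally show ?thesis .
qed

section \<open>Flat lifts of conformal maps\<close>

lemma dir_deriv_cong:
  assumes "open W" "u \<in> W" "\<And>y. y \<in> W \<Longrightarrow> f y = g y" "f differentiable (at u)"
  shows "dir_deriv v g u = dir_deriv v f u"
  by (rule dir_deriv_transform(2)[OF assms(4,1,2,3)])

lemma dir_deriv_const [simp]: "dir_deriv v (\<lambda>x. c) u = 0"
  by (simp add: dir_deriv_def)

lemma dir_deriv_mink:
  assumes "G differentiable (at u)" "H differentiable (at u)"
  shows "dir_deriv v (\<lambda>u. mink (G u) (H u)) u = mink (dir_deriv v G u) (H u) + mink (G u) (dir_deriv v H u)"
  by (subst dir_deriv_eqI[OF bounded_bilinear.FDERIV[OF bounded_bilinear_mink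
        has_derivative_dir_deriv[OF assms(1)] has_derivative_dir_deriv[OF assms(2)]]]) simp

lemma mink_constant_deriv:
  assumes "open W" "u \<in> W" "smooth_on W G" "smooth_on W H" "\<And>y. y \<in> W \<Longrightarrow> mink (G y) (H y) = c"
  shows "mink (dir_deriv v G u) (H u) + mink (G u) (dir_deriv v H u) = 0"
proof -
  note d = smooth_onD(1)[OF assms(3,2)] smooth_onD(1)[OF assms(4,2)]
  have "(\<lambda>y. mink (G y) (H y)) differentiable (at u)"
    using smooth_onD(1)[OF smooth_on_mink[OF assms(1,3,4)] assms(2)] .
  from dir_deriv_cong[OF assms(1,2) assms(5) this, of v] show ?thesis using dir_deriv_mink[OF d] by simp
qed

text \<open>
  An isometry composed with a section of the cone on which the metric is flat yields a map \<open>F\<close> of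
  this kind; geometrically, \<open>F\<close> is the isotropic lift of a conformal map of a Euclidean space. The
  domain may have further dimensions: only derivatives in directions of \<open>E\<close> are constrained. The
  last hypothesis says that \<open>F u\<close> and its derivatives along \<open>E\<close> span the tangent space of the cone.
\<close>

locale flat_null_lift =
  fixes W :: "'a::euclidean_space set" and E :: "'a set" and F :: "'a \<Rightarrow> 'n::finite minkowski"
  assumes openW: "open W" and smoothF: "smooth_on W F" and subspaceE: "subspace E"
    and cone: "u \<in> W \<Longrightarrow> F u \<in> lightcone"
    and isometric: "u \<in> W \<Longrightarrow> v \<in> E \<Longrightarrow> w \<in> E \<Longrightarrow> mink (dir_deriv v F u) (dir_deriv w F u) = v \<bullet> w"
    and maximal: "u \<in> W \<Longrightarrow> mink (F u) y = 0 \<Longrightarrow> (\<And>v. v \<in> E \<Longrightarrow> mink (dir_deriv v F u) y = 0) \<Longrightarrow>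
      \<exists>c. y = c *\<^sub>R F u"
begin

lemmas smooth1 = smooth_onD(2)[OF smoothF]
lemmas smooth2 = smooth_onD(2)[OF smooth1]
lemmas commute = dir_deriv_commute[OF openW smoothF]
lemmas commute' = dir_deriv_commute[OF openW smooth1]

lemma commute_inner:
  assumes "u \<in> W" shows "dir_deriv z (dir_deriv w (dir_deriv v F)) u
    = dir_deriv z (dir_deriv v (dir_deriv w F)) u"
  by (rule dir_deriv_cong[OF openW assms _ smooth_onD(1)[OF smooth2 assms]]) (rule commute)

lemma null: "u \<in> W \<Longrightarrow> mink (F u) (F u) = 0"
  using cone lightconeD(3) by blast

lemma tangent: "u \<in> W \<Longrightarrow> mink (dir_deriv v F u) (F u) = 0"
  using mink_constant_deriv[OF openW _ smoothF smoothF null, of u v]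
    mink_commute[of "F u" "dir_deriv v F u"] by simp

lemma second_position: 
  assumes "u \<in> W" "v \<in> E" "w \<in> E" shows "mink (dir_deriv w (dir_deriv v F) u) (F u) = - (v \<bullet> w)"
  using mink_constant_deriv[OF openW assms(1) smooth1[of v] smoothF tangent, of w] isometric[OF assms] by simp

text \<open>
  As in the uniqueness of the Levi-Civita connection of a flat metric, the trilinear form
  \<open>\<langle>F\<^sub>v\<^sub>w, F\<^sub>z\<rangle>\<close> is symmetric in \<open>v\<close> and \<open>w\<close> and skew in \<open>v\<close> and \<open>z\<close>; these two properties force it
  to vanish.
\<close>

lemma second_tangent:
  assumes "u \<in> W" "v \<in> E" "w \<in> E" "z \<in> E"
  shows "mink (dir_deriv w (dir_deriv v F) u) (dir_deriv z F u) = 0"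
proof -
  define T where "T = (\<lambda>w v z. mink (dir_deriv w (dir_deriv v F) u) (dir_deriv z F u))"
  have sym: "T w v z = T v w z" for v w z unfolding T_def using commute[OF assms(1)] by simp
  have anti: "T w v z + T w z v = 0" if "v \<in> E" "z \<in> E" for v w z
    using mink_constant_deriv[OF openW assms(1) smooth1[of v] smooth1[of z] isometric[OF _ that], of w]
    by (simp add: T_def mink_commute)
  have "T w v z = 0"
    using anti[of v z w] anti[of w v z] anti[of w z v] sym[of w v z] sym[of w z v] sym[of v z w] assms
      by linarith
  then show ?thesis by (simp add: T_def)
qed

text \<open>
  Such a second derivative is orthogonal to \<open>F\<close> and to all first derivatives, and the radical of
  the tangent space of the cone is the line spanned by \<open>F\<close>.
\<close>

lemma second_orthogonal:
  assumes "u \<in> W" "v \<in> E" "w \<in> E" "v \<bullet> w = 0"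
  shows "\<exists>c. dir_deriv w (dir_deriv v F) u = c *\<^sub>R F u"
proof (rule maximal[OF assms(1)])
  show "mink (F u) (dir_deriv w (dir_deriv v F) u) = 0"
    using second_position[OF assms(1-3)] assms(4) mink_commute[of "F u"] by simp
  show "mink (dir_deriv z F u) (dir_deriv w (dir_deriv v F) u) = 0" if "z \<in> E" for z
    using second_tangent[OF assms(1-3) that] mink_commute[of "dir_deriv z F u"] by simp
qed

text \<open>
  This is the local form of the theorem of Liouville on conformal maps, valid as soon as there is a
  third direction \<open>k\<close> orthogonal to both \<open>i\<close> and \<open>j\<close>. With \<open>F\<^sub>i\<^sub>j = a F\<close>, differentiating
  \<open>\<langle>F\<^sub>i\<^sub>j, F\<^sub>k\<rangle> = 0\<close> along \<open>k\<close> gives \<open>\<langle>F\<^sub>i\<^sub>j\<^sub>k, F\<^sub>k\<rangle> = a |k|\<^sup>2\<close>, whereas differentiating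
  \<open>\<langle>F\<^sub>i\<^sub>k, F\<^sub>k\<rangle> = 0\<close> along \<open>j\<close> gives \<open>\<langle>F\<^sub>i\<^sub>k\<^sub>j, F\<^sub>k\<rangle> = 0\<close>.
\<close>

lemma second_orthogonal_vanishes:
  assumes u: "u \<in> W" and i: "i \<in> E" and j: "j \<in> E" and k: "k \<in> E" and k0: "k \<noteq> 0"
    and ij: "i \<bullet> j = 0" and ik: "i \<bullet> k = 0" and jk: "j \<bullet> k = 0"
  shows "dir_deriv j (dir_deriv i F) u = 0"
proof -
  obtain a where a: "dir_deriv j (dir_deriv i F) u = a *\<^sub>R F u" using second_orthogonal[OF u i j ij] by blast
  obtain b where b: "dir_deriv k (dir_deriv i F) u = b *\<^sub>R F u" using second_orthogonal[OF u i k ik] by blast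
  obtain c where c: "dir_deriv j (dir_deriv k F) u = c *\<^sub>R F u"
    using second_orthogonal[OF u k j] jk by (auto simp: inner_commute)
  have "mink (dir_deriv k (dir_deriv j (dir_deriv i F)) u) (dir_deriv k F u)
      + mink (dir_deriv j (dir_deriv i F) u) (dir_deriv k (dir_deriv k F) u) = 0"
    by (rule mink_constant_deriv[OF openW u smooth2 smooth1 second_tangent[OF _ i j k]])
  moreover have "mink (dir_deriv j (dir_deriv k (dir_deriv i F)) u) (dir_deriv k F u)
      + mink (dir_deriv k (dir_deriv i F) u) (dir_deriv j (dir_deriv k F) u) = 0"
    by (rule mink_constant_deriv[OF openW u smooth2 smooth1 second_tangent[OF _ i k k]])
  moreover have "mink (dir_deriv k (dir_deriv j (dir_deriv i F)) u) (dir_deriv k F u) =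
      mink (dir_deriv j (dir_deriv k (dir_deriv i F)) u) (dir_deriv k F u)"
    by (simp only: commute'[OF u, of k j i])
  moreover have "mink (dir_deriv k (dir_deriv i F) u) (dir_deriv j (dir_deriv k F) u) = 0"
    using null[OF u] by (simp add: b c mink_simps)
  moreover have "mink (dir_deriv j (dir_deriv i F) u) (dir_deriv k (dir_deriv k F) u) = - (a * (k \<bullet> k))"
    using second_position[OF u k k] by (simp add: a mink_simps mink_commute)
  ultimately have "a * (k \<bullet> k) = 0" by linarith
  then have "a = 0" using k0 by simp
  then show ?thesis using a by simp
qed

end

text \<open>
  When all mixed second derivatives in orthogonal directions vanish, \<open>F\<close> is a quadratic polynomial:
  all unit directions have the same second derivative \<open>N\<close>, and \<open>N\<close> is constant.
\<close>

locale rigid_null_lift = flat_null_lift +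
  fixes e l
  assumes frame: "e \<in> E" "l \<in> E" "e \<bullet> e = 1" "l \<bullet> l = 1" "e \<bullet> l = 0"
    and umbilic: "\<And>u v w. u \<in> W \<Longrightarrow> v \<in> E \<Longrightarrow> w \<in> E \<Longrightarrow> v \<bullet> w = 0 \<Longrightarrow> dir_deriv w (dir_deriv v F) u = 0"
begin

definition N where "N = dir_deriv e (dir_deriv e F)"

text \<open>
  For vectors \<open>v\<close> and \<open>w\<close> of equal length, \<open>v + w\<close> and \<open>v - w\<close> are orthogonal.
\<close>

lemma second_unit:
  assumes u: "u \<in> W" and v: "v \<in> E" "w \<in> E" "v \<bullet> v = w \<bullet> w"
  shows "dir_deriv v (dir_deriv v F) u = dir_deriv w (dir_deriv w F) u"
proof -
  have lin1: "linear (\<lambda>v. dir_deriv v F y)" if "y \<in> W" for y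
    by (rule dir_deriv_linear[OF smooth_onD(1)[OF smoothF that]])
  have lin2: "linear (\<lambda>w. dir_deriv w (dir_deriv v F) u)" for v
    by (rule dir_deriv_linear[OF smooth_onD(1)[OF smooth1 u]])
  note d = smooth_onD(1)[OF smooth1 u]
  have "0 = dir_deriv (v - w) (dir_deriv (v + w) F) u"
    by (rule umbilic[OF u, symmetric])
       (use v subspaceE in \<open>auto simp: subspace_add subspace_diff inner_diff_right inner_diff_left
          inner_add_left inner_add_right inner_commute\<close>)
  also have "\<dots> = dir_deriv (v - w) (\<lambda>y. dir_deriv v F y + dir_deriv w F y) u"
    by (rule dir_deriv_cong[OF openW u]) (auto simp: linear_add[OF lin1] intro: differentiable_add d)
  also have "\<dots> = dir_deriv (v - w) (dir_deriv v F) u + dir_deriv (v - w) (dir_deriv w F) u"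
    by (rule dir_deriv_eqI) (intro has_derivative_add has_derivative_dir_deriv d)
  also have "\<dots> = dir_deriv v (dir_deriv v F) u - dir_deriv w (dir_deriv w F) u"
    by (simp add: linear_diff[OF lin2] commute[OF u, of v w])
  finally show ?thesis by simp
qed

lemma second_diagonal:
  assumes u: "u \<in> W" and v: "v \<in> E" shows "dir_deriv v (dir_deriv v F) u = (v \<bullet> v) *\<^sub>R N u"
proof -
  have "dir_deriv v (dir_deriv v F) u = dir_deriv (norm v *\<^sub>R e) (dir_deriv (norm v *\<^sub>R e) F) u"
    by (rule second_unit[OF u v])
      (use frame subspaceE in \<open>auto simp: subspace_scale dot_square_norm power2_eq_square\<close>)
  also have "\<dots> = dir_deriv (norm v *\<^sub>R e) (\<lambda>y. norm v *\<^sub>R dir_deriv e F y) u"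
    by (rule dir_deriv_cong[OF openW u])
       (auto simp: linear_cmul[OF dir_deriv_linear[OF smooth_onD(1)[OF smoothF]]]
         intro: differentiable_scaleR smooth_onD(1)[OF smooth1 u])
  also have "\<dots> = norm v *\<^sub>R dir_deriv (norm v *\<^sub>R e) (dir_deriv e F) u"
    by (rule dir_deriv_eqI) (intro has_derivative_scaleR_right has_derivative_dir_deriv smooth_onD(1)[OF
      smooth1 u])
  also have "\<dots> = (v \<bullet> v) *\<^sub>R N u"
    by (simp add: linear_cmul[OF dir_deriv_linear[OF smooth_onD(1)[OF smooth1 u]]]
      N_def dot_square_norm power2_eq_square)
  finally show ?thesis .
qed

lemma N_eq: "u \<in> W \<Longrightarrow> N u = dir_deriv l (dir_deriv l F) u"
  unfolding N_def by (rule second_unit) (use frame in auto)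

lemma smoothN: "smooth_on W N" unfolding N_def by (rule smooth2)

lemma third_vanishes:
  assumes "u \<in> W" "v \<in> E" "w \<in> E" "v \<bullet> w = 0"
  shows "dir_deriv w (dir_deriv v (dir_deriv v F)) u = 0"
proof -
  have "dir_deriv w (dir_deriv v (dir_deriv v F)) u = dir_deriv v (dir_deriv w (dir_deriv v F)) u"
    by (rule commute'[OF assms(1)])
  also have "\<dots> = dir_deriv v (\<lambda>y. 0) u"
    by (rule dir_deriv_cong[OF openW assms(1), symmetric])
      (use umbilic[OF _ assms(2-4)] smooth_onD(1)[OF smooth2 assms(1)] in auto)
  finally show ?thesis by simp
qed

text \<open>
  The derivative of \<open>N = F\<^sub>e\<^sub>e\<close> in a direction orthogonal to \<open>e\<close> is a third derivative in which an
  orthogonal pair can be differentiated first. In the direction \<open>e\<close> itself the same argument works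
  with the expression \<open>N = F\<^sub>l\<^sub>l\<close>.
\<close>

lemma N_constant:
  assumes u: "u \<in> W" and w: "w \<in> E" shows "dir_deriv w N u = 0"
proof -
  note lin = dir_deriv_linear[OF smooth_onD(1)[OF smoothN u]]
  have e: "dir_deriv e N u = 0"
  proof -
    have "dir_deriv e N u = dir_deriv e (dir_deriv l (dir_deriv l F)) u"
      by (rule dir_deriv_cong[OF openW u, symmetric]) (use N_eq smooth_onD(1)[OF smoothN u] in \<open>auto\<close>)
    also have "\<dots> = 0" by (rule third_vanishes[OF u]) (use frame in \<open>auto simp: inner_commute\<close>)
    finally show ?thesis .
  qed
  have "w - (e \<bullet> w) *\<^sub>R e \<in> E" using w frame subspaceE by (auto intro: subspace_diff subspace_scale)
  then have "dir_deriv (w - (e \<bullet> w) *\<^sub>R e) N u = 0"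
    unfolding N_def by (intro third_vanishes[OF u]) (use frame in \<open>auto simp: inner_diff_right\<close>)
  then show ?thesis using e by (simp add: linear_diff[OF lin] linear_cmul[OF lin])
qed

text \<open>
  With these products, \<open>F 0\<close>, the vectors \<open>F\<^sub>v(0)\<close> and \<open>N 0\<close> have the same Gram matrix as a point
  of the cone, an orthonormal basis of \<open>E\<close> and the opposite null vector.
\<close>

lemma N_products:
  assumes u: "u \<in> W"
  shows "mink (N u) (N u) = 0" "mink (N u) (F u) = -1" "v \<in> E \<Longrightarrow> mink (N u) (dir_deriv v F u) = 0"
proof -
  have "mink (dir_deriv l (dir_deriv e (dir_deriv e F)) u) (dir_deriv l F u)
      + mink (dir_deriv e (dir_deriv e F) u) (dir_deriv l (dir_deriv l F) u) = 0"
    by (rule mink_constant_deriv[OF openW u smooth2 smooth1 second_tangent]) (use frame in auto)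
  moreover have "dir_deriv l (dir_deriv e (dir_deriv e F)) u = 0"
    by (rule third_vanishes[OF u]) (use frame in auto)
  ultimately show "mink (N u) (N u) = 0"
    using N_eq[OF u] by (simp add: mink_simps N_def)
  show "mink (N u) (F u) = -1" unfolding N_def using second_position[OF u frame(1,1)] frame by simp
  show "mink (N u) (dir_deriv v F u) = 0" if "v \<in> E"
    unfolding N_def by (rule second_tangent[OF u frame(1,1) that])
qed

lemma lift_quadratic:
  assumes W: "convex W" "0 \<in> W" and v: "v \<in> W" "v \<in> E"
  shows "F v = F 0 + dir_deriv v F 0 + ((v \<bullet> v) / 2) *\<^sub>R N 0"
proof -
  \<comment> \<open>On the segment from \<open>0\<close> to \<open>v\<close>, the Taylor remainder has derivative zero.\<close>
  define S where "S = {0..1::real}"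
  have SW: "s *\<^sub>R v \<in> W" if "s \<in> S" for s
  proof -
    have "(1 - s) *\<^sub>R 0 + s *\<^sub>R v \<in> W" using W v that unfolding S_def by (intro convexD) auto
    then show ?thesis by simp
  qed
  have line: "((\<lambda>s. G (s *\<^sub>R v)) has_vector_derivative dir_deriv v G (s *\<^sub>R v)) (at s within S)"
    if "smooth_on W G" "s \<in> S" for s and G :: "'a \<Rightarrow> 'b minkowski"
    by (rule has_vector_derivative_at_within, rule dir_deriv_curve[where c = "\<lambda>s. s *\<^sub>R v"])
       (auto intro!: derivative_eq_intros smooth_onD(1)[OF that(1) SW[OF that(2)]]
         simp: has_vector_derivative_def)
  have const: "G s = G 0" if "\<And>s. s \<in> S \<Longrightarrow> (G has_vector_derivative 0) (at s within S)" "s \<in> S"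
    for G :: "real \<Rightarrow> 'b minkowski" and s
    using has_vector_derivative_zero_constant[of S G] that unfolding S_def
    by (metis atLeastAtMost_iff convex_real_interval(5) order_refl zero_le_one)
  have N: "N (s *\<^sub>R v) = N 0" if "s \<in> S" for s
    using const[of "\<lambda>s. N (s *\<^sub>R v)" s] that line[OF smoothN] N_constant[OF SW v(2)] by simp
  have D: "dir_deriv v F (s *\<^sub>R v) = dir_deriv v F 0 + s *\<^sub>R ((v \<bullet> v) *\<^sub>R N 0)" if s: "s \<in> S" for s
  proof -
    have "dir_deriv v F (s *\<^sub>R v) - s *\<^sub>R ((v \<bullet> v) *\<^sub>R N 0)
      = dir_deriv v F (0 *\<^sub>R v) - 0 *\<^sub>R ((v \<bullet> v) *\<^sub>R N 0)"
    proof (rule const[OF _ s])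
      fix r assume r: "r \<in> S"
      have "((\<lambda>s. dir_deriv v F (s *\<^sub>R v) - s *\<^sub>R ((v \<bullet> v) *\<^sub>R N 0)) has_vector_derivative
          dir_deriv v (dir_deriv v F) (r *\<^sub>R v) - (v \<bullet> v) *\<^sub>R N 0) (at r within S)"
        by (intro has_vector_derivative_diff line[OF smooth1 r])
           (auto intro!: derivative_eq_intros simp: has_vector_derivative_def)
      then show "((\<lambda>s. dir_deriv v F (s *\<^sub>R v) - s *\<^sub>R ((v \<bullet> v) *\<^sub>R N 0)) has_vector_derivative 0) (at r
        within S)"
        using second_diagonal[OF SW[OF r] v(2)] N[OF r] by simp
    qed
    then show ?thesis by (simp add: algebra_simps)
  qed
  have "F (1 *\<^sub>R v) - 1 *\<^sub>R dir_deriv v F 0 - (1\<^sup>2 / 2) *\<^sub>R ((v \<bullet> v) *\<^sub>R N 0)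
      = F (0 *\<^sub>R v) - 0 *\<^sub>R dir_deriv v F 0 - (0\<^sup>2 / 2) *\<^sub>R ((v \<bullet> v) *\<^sub>R N 0)"
  proof (rule const)
    fix r assume r: "r \<in> S"
    have "((\<lambda>s. F (s *\<^sub>R v) - s *\<^sub>R dir_deriv v F 0 - (s\<^sup>2 / 2) *\<^sub>R ((v \<bullet> v) *\<^sub>R N 0)) has_vector_derivative
          dir_deriv v F (r *\<^sub>R v) - dir_deriv v F 0 - r *\<^sub>R ((v \<bullet> v) *\<^sub>R N 0)) (at r within S)"
      by (intro has_vector_derivative_diff line[OF smoothF r])
         (auto intro!: derivative_eq_intros simp: has_vector_derivative_def)
    then show "((\<lambda>s. F (s *\<^sub>R v) - s *\<^sub>R dir_deriv v F 0 - (s\<^sup>2 / 2) *\<^sub>R ((v \<bullet> v) *\<^sub>R N 0))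
      has_vector_derivative 0) (at r within S)"
      using D[OF r] by simp
  qed (simp add: S_def)
  then show ?thesis by (simp add: algebra_simps)
qed

end

context flat_null_lift
begin

text \<open>
  With only two directions \<open>e\<close> and \<open>l\<close> available, the two coefficients in \<open>F\<^sub>e\<^sub>l = a F\<close> and
  \<open>F\<^sub>e\<^sub>e - F\<^sub>l\<^sub>l = 2 b F\<close> need not vanish; they are the components of the Schwarzian derivative of
  the conformal map. The equations of Gauss and Codazzi turn into the Cauchy-Riemann equations for
  \<open>a + i b\<close>, which is therefore an entire function on every plane parallel to \<open>e\<close> and \<open>l\<close>. If the
  second derivatives are small compared to \<open>F\<close> at infinity, this function tends to zero and
  vanishes by the theorem of Liouville.
\<close>

lemma second_orthogonal_vanishes_entire:
  assumes W: "W = UNIV" and e: "e \<in> E" "l \<in> E" "e \<bullet> e = 1" "l \<bullet> l = 1" "e \<bullet> l = 0"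
    and lim: "((\<lambda>z. dir_deriv l (dir_deriv e F) (u + Re z *\<^sub>R e + Im z *\<^sub>R l) /\<^sub>R
        norm (F (u + Re z *\<^sub>R e + Im z *\<^sub>R l))) \<longlongrightarrow> 0) at_infinity"
    and lim': "((\<lambda>z. (dir_deriv e (dir_deriv e F) (u + Re z *\<^sub>R e + Im z *\<^sub>R l) -
          dir_deriv l (dir_deriv l F) (u + Re z *\<^sub>R e + Im z *\<^sub>R l)) /\<^sub>R
        norm (F (u + Re z *\<^sub>R e + Im z *\<^sub>R l))) \<longlongrightarrow> 0) at_infinity"
  shows "dir_deriv l (dir_deriv e F) u = 0"
proof -
  let ?A = "dir_deriv e (dir_deriv e F)" and ?B = "dir_deriv l (dir_deriv e F)" and ?C =
    "dir_deriv l (dir_deriv l F)"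
  \<comment> \<open>As \<open>F\<^sub>e\<^sub>e\<close> has product \<open>-1\<close> with \<open>F\<close>, products with it extract the coefficients of \<open>F\<close>.\<close>
  define a where "a = (\<lambda>u. - mink (?B u) (?A u))"
  define b where "b = (\<lambda>u. (-1/2) * mink (?A u) (?A u))"
  have U: "u \<in> W" for u using W by simp
  have AF: "mink (?A u) (F u) = -1" for u using second_position[OF U e(1,1)] e(3) by simp
  have B0: "\<exists>c. ?B u = c *\<^sub>R F u" for u using second_orthogonal[OF U e(1,2,5)] .
  \<comment> \<open>The Gauss equation of the flat metric.\<close>
  have AC: "mink (?A u) (?C u) = 0" for u
  proof -
    have "mink (dir_deriv l ?A u) (dir_deriv l F u) + mink (?A u) (?C u) = 0"
      by (rule mink_constant_deriv[OF openW U smooth2 smooth1 second_tangent]) (use e in auto)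
    moreover have "mink (dir_deriv e ?B u) (dir_deriv l F u) + mink (?B u) (dir_deriv e (dir_deriv l F) u)
      = 0"
      by (rule mink_constant_deriv[OF openW U smooth2 smooth1 second_tangent]) (use e in auto)
    moreover have "mink (dir_deriv l ?A u) (dir_deriv l F u) = mink (dir_deriv e ?B u) (dir_deriv l F u)"
      by (simp only: commute'[OF U, of l e e])
    moreover have "mink (?B u) (dir_deriv e (dir_deriv l F) u) = 0"
      using B0[of u] null[OF U, of u] commute[OF U, of e l u] by (auto simp: mink_simps)
    ultimately show ?thesis by linarith
  qed
  have B: "?B u = a u *\<^sub>R F u" for u
    using B0[of u] AF[of u] by (auto simp: a_def mink_simps mink_commute)
  have C: "?A u - ?C u = (2 * b u) *\<^sub>R F u" for u
  proof -
    have "\<exists>c. ?A u - ?C u = c *\<^sub>R F u"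
      by (rule maximal[OF U])
         (use second_position[OF U e(1,1)] second_position[OF U e(2,2)] second_tangent[OF U e(1,1)]
           second_tangent[OF U e(2,2)] e
          in \<open>simp_all add: mink_simps mink_commute\<close>)
    then obtain c where c: "?A u - ?C u = c *\<^sub>R F u" by blast
    have "mink (?A u) (?A u - ?C u) = - c" using AF[of u] by (simp add: c mink_scaleR_right)
    then have "2 * b u = c" using AC[of u] by (simp add: b_def mink_diff_right)
    then show ?thesis using c by simp
  qed
  have AF': "mink (F u) (dir_deriv v ?A u) = 0" if "v \<in> E" for u v
    using mink_constant_deriv[OF openW U[of u] smooth2 smoothF AF, of v] second_tangent[OF U e(1,1) that]
    by (simp add: mink_commute)
  have diff: "smooth_on W a" "smooth_on W b"
    unfolding a_def b_def by (intro smooth_intros smooth_on_mink openW smooth2; simp)+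
  note d2 = smooth_onD(1)[OF smooth2 U]
  have da: "dir_deriv v a u = - mink (dir_deriv v ?B u) (?A u) - a u * mink (F u) (dir_deriv v ?A u)" for v u
  proof -
    have "dir_deriv v a u = - dir_deriv v (\<lambda>u. mink (?B u) (?A u)) u"
      unfolding a_def
      by (rule dir_deriv_eqI) (intro has_derivative_minus has_derivative_dir_deriv
          smooth_onD(1)[OF smooth_on_mink[OF openW smooth2 smooth2] U])
    then show ?thesis by (simp add: dir_deriv_mink[OF d2 d2]) (simp add: B mink_simps)
  qed
  have db: "dir_deriv v b u = - mink (dir_deriv v ?A u) (?A u)" for v u
  proof -
    have "dir_deriv v b u = (-1/2) * dir_deriv v (\<lambda>u. mink (?A u) (?A u)) u"
      unfolding b_def
      by (rule dir_deriv_eqI) (intro has_derivative_mult_right has_derivative_dir_deriv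
          smooth_onD(1)[OF smooth_on_mink[OF openW smooth2 smooth2] U])
    then show ?thesis by (simp add: dir_deriv_mink[OF d2 d2] mink_commute)
  qed
  have CR1: "dir_deriv e a u = dir_deriv l b u" for u
    using da[of e u] db[of l u] AF'[OF e(1)] commute'[OF U, of e l e u] by simp
  have CR2: "dir_deriv l a u = - dir_deriv e b u" for u
  proof -
    have "dir_deriv l a u = - mink (dir_deriv l ?B u) (?A u)" using da[of l u] AF'[OF e(2)] by simp
    also have "dir_deriv l ?B u = dir_deriv e ?C u"
      using commute_inner[OF U, of l l e u] commute'[OF U, of l e l u] by simp
    also have "mink (dir_deriv e ?A u) (?C u) + mink (?A u) (dir_deriv e ?C u) = 0"
      by (rule mink_constant_deriv[OF openW U smooth2 smooth2 AC])
    then have "- mink (dir_deriv e ?C u) (?A u) = mink (dir_deriv e ?A u) (?C u)" by (simp add: mink_commute)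
    also have "mink (dir_deriv e ?A u) (?C u) = mink (dir_deriv e ?A u) (?A u)"
    proof -
      have "?C u = ?A u - (2 * b u) *\<^sub>R F u" using C[of u] by (simp add: algebra_simps)
      then show ?thesis using AF'[OF e(1), of u] by (simp add: mink_simps mink_commute)
    qed
    finally show ?thesis using db[of e u] by simp
  qed
  let ?p = "\<lambda>z. u + Re z *\<^sub>R e + Im z *\<^sub>R l"
  define h where "h = (\<lambda>z. Complex (a (?p z)) (b (?p z)))"
  have "(h has_field_derivative Complex (dir_deriv e a (?p z)) (dir_deriv e b (?p z))) (at z)" for z
  proof -
    have p: "(?p has_derivative (\<lambda>w. Re w *\<^sub>R e + Im w *\<^sub>R l)) (at z)"
      by (auto intro!: derivative_eq_intros)
    have "((\<lambda>z. g (?p z)) has_derivative (\<lambda>w. Re w * dir_deriv e g (?p z)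
      + Im w * dir_deriv l g (?p z))) (at z)"
      if "smooth_on W g" for g :: "'a \<Rightarrow> real"
    proof -
      have gd: "g differentiable (at (?p z))" by (rule smooth_onD(1)[OF that U])
      have "((\<lambda>z. g (?p z)) has_derivative (\<lambda>w. dir_deriv (Re w *\<^sub>R e + Im w *\<^sub>R l) g (?p z))) (at z)"
        by (rule has_derivative_compose[OF p has_derivative_dir_deriv[OF gd]])
      then show ?thesis by (simp add: linear_add[OF dir_deriv_linear[OF gd]]
        linear_cmul[OF dir_deriv_linear[OF gd]])
    qed
    note D = this[OF diff(1)] this[OF diff(2)]
    have "(h has_derivative (\<lambda>w. Complex (Re w * dir_deriv e a (?p z) + Im w * dir_deriv l a (?p z))
        (Re w * dir_deriv e b (?p z) + Im w * dir_deriv l b (?p z)))) (at z)"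
      unfolding h_def Complex_eq using D by (auto intro!: derivative_eq_intros)
    moreover have "(\<lambda>w. Complex (Re w * dir_deriv e a (?p z) + Im w * dir_deriv l a (?p z))
        (Re w * dir_deriv e b (?p z) + Im w * dir_deriv l b (?p z)))
       = (*) (Complex (dir_deriv e a (?p z)) (dir_deriv e b (?p z)))"
      by (auto simp: fun_eq_iff complex_eq_iff CR1 CR2 algebra_simps)
    ultimately show ?thesis by (simp add: has_field_derivative_def)
  qed
  then have hol: "h holomorphic_on UNIV" unfolding holomorphic_on_def field_differentiable_def by blast
  have nF: "norm (F u) > 0" for u using lightconeD(4)[OF cone[OF U[of u]]] by auto
  have eq: "norm (c *\<^sub>R F u /\<^sub>R norm (F u)) = \<bar>c\<bar>" for c u
    using nF[of u] by (simp add: abs_mult field_simps)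
  have "((\<lambda>z. norm (?B (?p z) /\<^sub>R norm (F (?p z)))) \<longlongrightarrow> 0) at_infinity"
    using lim by (rule tendsto_norm_zero)
  then have "((\<lambda>z. \<bar>a (?p z)\<bar>) \<longlongrightarrow> 0) at_infinity" by (simp only: B eq)
  then have 1: "((\<lambda>z. a (?p z)) \<longlongrightarrow> 0) at_infinity" by (simp add: tendsto_rabs_zero_iff)
  have "((\<lambda>z. norm ((?A (?p z) - ?C (?p z)) /\<^sub>R norm (F (?p z)))) \<longlongrightarrow> 0) at_infinity"
    using lim' by (rule tendsto_norm_zero)
  then have "((\<lambda>z. \<bar>2 * b (?p z)\<bar>) \<longlongrightarrow> 0) at_infinity" by (simp only: C eq)
  then have "((\<lambda>z. 2 * b (?p z)) \<longlongrightarrow> 0) at_infinity" by (simp only: tendsto_rabs_zero_iff)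
  then have 2: "((\<lambda>z. b (?p z)) \<longlongrightarrow> 0) at_infinity" using tendsto_mult_left_iff[of 2 "\<lambda>z. b (?p z)" 0] by simp
  have "(h \<longlongrightarrow> Complex 0 0) at_infinity" unfolding h_def by (intro tendsto_Complex 1 2)
  then have "(h \<longlongrightarrow> 0) at_infinity" by (simp add: Complex_eq)
  then have "h 0 = 0" by (rule Liouville_weak[OF hol])
  then have "a u = 0" by (simp add: h_def complex_eq_iff)
  then show ?thesis using B[of u] by simp
qed

end

section \<open>Lorentz transformations and the parabolic chart\<close>

lemma ex_orthogonal_unit_vector:
  fixes S :: "'a::euclidean_space set"
  assumes "finite S" "card S < DIM('a)"
  obtains e where "e \<bullet> e = 1" "\<And>s. s \<in> S \<Longrightarrow> s \<bullet> e = 0"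
proof -
  have "dim S < DIM('a)" using dim_le_card'[OF assms(1)] assms(2) by linarith
  then obtain x where x: "x \<noteq> 0" "\<And>y. y \<in> span S \<Longrightarrow> orthogonal x y"
    using orthogonal_to_subspace_exists by blast
  show ?thesis
  proof (rule that[of "x /\<^sub>R norm x"])
    show "(x /\<^sub>R norm x) \<bullet> (x /\<^sub>R norm x) = 1" using x(1) by (simp add: dot_square_norm power2_eq_square)
    show "s \<bullet> (x /\<^sub>R norm x) = 0" if "s \<in> S" for s
      using x(2)[OF span_base[OF that]] by (simp add: orthogonal_def inner_commute)
  qed
qed

lemma smooth_map_open: 
  assumes "open W" "smooth_map W F" shows "smooth_on W F"
proof (rule smooth_on_local)
  fix x assume "x \<in> W"
  then obtain V G where V: "open V" "x \<in> V" "smooth_on V G" "\<And>y. y \<in> W \<Longrightarrow> y \<in> V \<Longrightarrow> F y = G y"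
    using smooth_mapE[OF assms(2)] by metis
  have "smooth_on (W \<inter> V) F"
    by (rule smooth_on_cong[OF open_Int[OF assms(1) V(1)] _ smooth_on_subset[OF V(3)]]) (use V(4) in auto)
  then show "\<exists>V. open V \<and> x \<in> V \<and> smooth_on V F" using assms(1) V \<open>x \<in> W\<close> by blast
qed

lemma lightcone_mink_eq_0:
  assumes "p \<in> lightcone" "y \<in> lightcone" "mink p y = 0"
  shows "y = (fst y / fst p) *\<^sub>R p"
  using null_tangent_vector[OF assms(1,3)] lightconeD[OF assms(2)] by simp

lemma linear_mink_isometry:
  assumes "linear A" "\<And>x. mink (A x) (A x) = mink x x"
  shows "mink (A x) (A y) = mink x y"
proof -
  have "mink (A x + A y) (A x + A y) = mink (x + y) (x + y)"
    using assms(2)[of "x + y"] by (simp add: linear_add[OF assms(1)])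
  then show ?thesis using assms(2)[of x] assms(2)[of y] mink_commute[of "A x" "A y"] mink_commute[of x y]
    by (simp add: mink_simps)
qed

text \<open>
  Two points of the cone have non-positive product, and product zero only if they lie on the same
  half-line; a point of the past cone has non-negative product with every point of the cone. So one
  point that stays in the future cone determines the time orientation of \<open>A\<close>.
\<close>

lemma lorentz_maps_lightcone:
  fixes A :: "'n::finite minkowski \<Rightarrow> 'n minkowski"
  assumes A: "linear A" "\<And>x. mink (A x) (A x) = mink x x"
    and p: "p \<in> lightcone" "A p \<in> lightcone" and y: "y \<in> lightcone"
  shows "A y \<in> lightcone"
proof (cases "mink p y = 0")
  case True
  have "A y = (fst y / fst p) *\<^sub>R A p"
    by (subst lightcone_mink_eq_0[OF p(1) y True]) (simp add: linear_cmul[OF A(1)])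
  then show ?thesis using lightcone_scaleR[OF p(2)] lightconeD(1)[OF p(1)] lightconeD(1)[OF y] by simp
next
  case False
  have neg: "snd a \<bullet> snd b \<le> norm (snd a) * norm (snd b)" "- (norm (snd a) * norm (snd b)) \<le> snd a \<bullet> snd b"
    for a b :: "'n minkowski"
    using Cauchy_Schwarz_ineq2[of "snd a" "snd b"] by auto
  have "mink p y \<le> 0" using neg(1)[of p y] lightconeD[OF p(1)] lightconeD[OF y] by (simp add: mink_def)
  then have m: "mink (A p) (A y) < 0" using False linear_mink_isometry[OF A] by simp
  have null: "mink (A y) (A y) = 0" using A(2) lightconeD[OF y] by simp
  have n: "norm (snd (A y)) = \<bar>fst (A y)\<bar>"
  proof -
    have "(norm (snd (A y)))\<^sup>2 = (fst (A y))\<^sup>2"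
      using null by (simp add: mink_def power2_norm_eq_inner) (simp add: power2_eq_square)
    then show ?thesis by (metis abs_norm_cancel power2_eq_iff abs_eq_iff)
  qed
  have "fst (A y) > 0"
  proof (rule ccontr)
    assume "\<not> fst (A y) > 0"
    then have "mink (A p) (A y) \<ge> 0"
      using neg(2)[of "A p" "A y"] lightconeD(2)[OF p(2)] n by (simp add: mink_def)
    then show False using m by simp
  qed
  then show ?thesis using null by (simp add: lightcone_def)
qed

text \<open>
  An injective linear map of a finite-dimensional space is invertible, and its inverse satisfies
  the same hypotheses; so the image of the cone is the whole cone.
\<close>

lemma O_plusI:
  fixes A :: "'n::finite minkowski \<Rightarrow> 'n minkowski"
  assumes A: "linear A" "\<And>x. mink (A x) (A x) = mink x x" and p: "p \<in> lightcone" "A p \<in> lightcone"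
  shows "A \<in> O_plus"
proof -
  have "inj A"
    unfolding linear_injective_0[OF A(1)]
  proof (intro allI impI)
    fix x assume "A x = 0"
    then have "mink x y = 0" for y using linear_mink_isometry[OF A, of x y] by (simp add: mink_zero_left)
    from this[of "(- fst x, snd x)"] show "x = 0"
      by (simp add: mink_def prod_eq_iff add_nonneg_eq_0_iff)
  qed
  define B where "B = inv A"
  have AB: "A (B y) = y" and BA: "B (A y) = y" for y
    unfolding B_def using \<open>inj A\<close> linear_injective_imp_surjective[OF A(1)] by (auto simp: surj_f_inv_f)
  have "linear B"
  proof (rule linearI)
    show "B (x + y) = B x + B y" for x y
      using BA[of "B x + B y"] by (simp add: linear_add[OF A(1)] AB)
    show "B (c *\<^sub>R x) = c *\<^sub>R B x" for c x
      using BA[of "c *\<^sub>R B x"] by (simp add: linear_cmul[OF A(1)] AB)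
  qed
  moreover have "mink (B y) (B y) = mink y y" for y using A(2)[of "B y"] AB by simp
  ultimately have "B y \<in> lightcone" if "y \<in> lightcone" for y
    using lorentz_maps_lightcone[of B "A p" y] p BA that by simp
  then have "lightcone \<subseteq> A ` lightcone" using AB by (metis imageI subsetI)
  then have "A ` lightcone = lightcone" using lorentz_maps_lightcone[OF A p] by blast
  then show ?thesis using A by (simp add: O_plus_def O_lorentz_def)
qed

text \<open>
  The null vector in the plane of \<open>p\<close> and the time axis that is not on the line of \<open>p\<close>, normalised
  by \<open>\<langle>p, opposite_null p\<rangle> = -1\<close>.
\<close>

definition opposite_null :: "'n::finite minkowski \<Rightarrow> 'n minkowski" where
  "opposite_null p = (1 / (2 * fst p)) *\<^sub>R (1, - null_direction p)"

text \<open>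
  Euclidean projection onto the orthogonal complement of the direction of \<open>p\<close>.
\<close>

definition horizontal :: "'n::finite minkowski \<Rightarrow> real ^ 'n \<Rightarrow> real ^ 'n" where
  "horizontal p u = u - (null_direction p \<bullet> u) *\<^sub>R null_direction p"

text \<open>
  The intersection of the cone with the affine hyperplane \<open>\<langle>x, opposite_null p\<rangle> = -1\<close> is a
  paraboloid, on which the metric is Euclidean. Because the dimension of this paraboloid is smaller
  by one than that of the type, its parametrisation is precomposed with the projection
  \<open>horizontal p\<close>; thus it is defined on a Euclidean space given by a type.
\<close>

definition parabolic_chart :: "'n::finite minkowski \<Rightarrow> real ^ 'n \<Rightarrow> 'n minkowski" where
  "parabolic_chart p u = p + (0, horizontal p u)
    + ((horizontal p u \<bullet> horizontal p u) / 2) *\<^sub>R opposite_null p"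

lemma linear_horizontal: "linear (horizontal p)"
  by (auto intro!: linearI simp: horizontal_def algebra_simps inner_add_right)

lemmas bounded_linear_horizontal = linear_conv_bounded_linear[THEN iffD1, OF linear_horizontal]

lemma null_direction_inner: "p \<in> lightcone \<Longrightarrow> null_direction p \<bullet> null_direction p = 1"
  using null_direction_sphere[of p] by (simp add: norm_eq_1)

lemma null_direction_horizontal: "p \<in> lightcone \<Longrightarrow> null_direction p \<bullet> horizontal p u = 0"
  by (simp add: horizontal_def inner_diff_right null_direction_inner)

lemma horizontal_id: "null_direction p \<bullet> u = 0 \<Longrightarrow> horizontal p u = u"
  by (simp add: horizontal_def)

lemma mink_horizontal: "mink (0, v) (0, w) = v \<bullet> w"
  by (simp add: mink_def)

lemma mink_opposite_null:
  assumes "p \<in> lightcone"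
  shows "mink p (opposite_null p) = -1" "mink (opposite_null p) (opposite_null p) = 0"
    "null_direction p \<bullet> h = 0 \<Longrightarrow> mink p (0, h) = 0"
    "null_direction p \<bullet> h = 0 \<Longrightarrow> mink (opposite_null p) (0, h) = 0"
proof -
  note P = lightconeD[OF assms] null_direction_inner[OF assms]
  have sp: "snd p = fst p *\<^sub>R null_direction p" using P(1) by (simp add: null_direction_def)
  show "mink p (opposite_null p) = -1"
    using P(1,6) sp by (simp add: mink_def opposite_null_def field_simps)
  show "mink (opposite_null p) (opposite_null p) = 0"
    using P(6) by (simp add: mink_def opposite_null_def)
  show "mink p (0, h) = 0" if "null_direction p \<bullet> h = 0" using that sp by (simp add: mink_def)
  show "mink (opposite_null p) (0, h) = 0" if "null_direction p \<bullet> h = 0"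
    using that by (simp add: mink_def opposite_null_def)
qed

text \<open>
  The two null vectors and the horizontal vectors span Minkowski space; the coefficients come from
  the products with the null vectors.
\<close>

lemma null_decomposition:
  assumes p: "p \<in> lightcone"
  shows "y = (- mink y (opposite_null p)) *\<^sub>R p + (0, horizontal p (snd y))
    + (- mink y p) *\<^sub>R opposite_null p"
proof -
  note P = lightconeD(1)[OF p]
  have sp: "snd p = fst p *\<^sub>R null_direction p" using P by (simp add: null_direction_def)
  define x where "x = null_direction p"
  define r where "r = fst p"
  have o: "opposite_null p = (1 / (2 * r), - (1 / (2 * r)) *\<^sub>R x)"
    by (simp add: opposite_null_def x_def r_def)
  have m1: "- mink y (opposite_null p) = (fst y + snd y \<bullet> x) / (2 * r)"
    using P by (simp add: mink_def o r_def[symmetric] field_simps)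
  have m2: "- mink y p = r * (fst y - snd y \<bullet> x)"
    by (simp add: mink_def sp x_def[symmetric] r_def[symmetric] algebra_simps)
  have r: "r > 0" using P by (simp add: r_def)
  have f: "(fst y + snd y \<bullet> x) / (2 * r) * r + r * (fst y - snd y \<bullet> x) * (1 / (2 * r)) = fst y"
    using r by (simp add: field_simps)
  have g: "(fst y + snd y \<bullet> x) / (2 * r) * r - r * (fst y - snd y \<bullet> x) * (1 / (2 * r)) = snd y \<bullet> x"
    using r by (simp add: field_simps)
  have "((fst y + snd y \<bullet> x) / (2 * r)) *\<^sub>R (r *\<^sub>R x) + horizontal p (snd y)
    + (r * (fst y - snd y \<bullet> x)) *\<^sub>R (- (1 / (2 * r)) *\<^sub>R x)
    = snd y + ((fst y + snd y \<bullet> x) / (2 * r) * r - r * (fst y - snd y \<bullet> x) * (1 / (2 * r)) - snd y \<bullet> x) *\<^sub>R x"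
    by (simp add: horizontal_def x_def[symmetric] scaleR_diff_left scaleR_add_left inner_commute)
  then have "((fst y + snd y \<bullet> x) / (2 * r)) *\<^sub>R (r *\<^sub>R x) + horizontal p (snd y)
    + (r * (fst y - snd y \<bullet> x)) *\<^sub>R (- (1 / (2 * r)) *\<^sub>R x) = snd y"
    unfolding g by simp
  moreover have "fst p = r" "snd p = r *\<^sub>R x" using sp by (simp_all add: r_def x_def)
  ultimately show ?thesis unfolding m1 m2 using f r by (simp add: o prod_eq_iff)
qed

lemma parabolic_chart_in_lightcone: 
  assumes p: "p \<in> lightcone" shows "parabolic_chart p u \<in> lightcone"
proof -
  note m = mink_opposite_null[OF p] null_direction_horizontal[OF p]
  have "mink (parabolic_chart p u) (parabolic_chart p u) = 0"
    using lightconeD(3)[OF p] m(1,2) m(3,4)[OF m(5)] mink_commute[of "opposite_null p" p]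
      mink_commute[of "(0, horizontal p u)" p] mink_commute[of "(0, horizontal p u)" "opposite_null p"]
    by (simp add: parabolic_chart_def mink_simps mink_horizontal)
  moreover have "fst (parabolic_chart p u) > 0"
    using lightconeD(1)[OF p] by (simp add: parabolic_chart_def opposite_null_def add_pos_nonneg)
  ultimately show ?thesis by (simp add: lightcone_def)
qed

lemma parabolic_chart_0: "parabolic_chart p 0 = p"
  by (simp add: parabolic_chart_def linear_0[OF linear_horizontal] flip: zero_prod_def)

lemma smooth_on_parabolic_chart: "smooth_on UNIV (parabolic_chart p)"
  unfolding parabolic_chart_def[abs_def] divide_inverse
  by (intro smooth_intros smooth_on_bounded_linear bounded_linear_horizontal) auto

lemma has_derivative_parabolic_chart:
  "(parabolic_chart p has_derivative
    (\<lambda>v. (0, horizontal p v) + (horizontal p u \<bullet> horizontal p v) *\<^sub>R opposite_null p)) (at u)"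
proof -
  have H: "(horizontal p has_derivative horizontal p) (at u)"
    by (rule bounded_linear_imp_has_derivative[OF bounded_linear_horizontal])
  show ?thesis
    unfolding parabolic_chart_def[abs_def]
    by (auto intro!: derivative_eq_intros H simp: fun_eq_iff inner_commute)
qed

lemma dir_deriv_parabolic_chart:
  "dir_deriv v (parabolic_chart p) u = (0, horizontal p v)
    + (horizontal p u \<bullet> horizontal p v) *\<^sub>R opposite_null p"
  by (rule dir_deriv_eqI[OF has_derivative_parabolic_chart])

lemma mink_dir_deriv_parabolic_chart:
  assumes p: "p \<in> lightcone"
  shows "mink (parabolic_chart p u) (dir_deriv v (parabolic_chart p) u) = 0"
    "mink (dir_deriv v (parabolic_chart p) u) (dir_deriv w (parabolic_chart p) u)
      = horizontal p v \<bullet> horizontal p w"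
proof -
  note m = mink_opposite_null[OF p] null_direction_horizontal[OF p]
  note m' = m(1,2) m(3,4)[OF m(5)] mink_commute[of "opposite_null p" p]
      mink_commute[of "(0, horizontal p _)" p] mink_commute[of "(0, horizontal p _)" "opposite_null p"]
  show "mink (parabolic_chart p u) (dir_deriv v (parabolic_chart p) u) = 0"
    "mink (dir_deriv v (parabolic_chart p) u) (dir_deriv w (parabolic_chart p) u)
      = horizontal p v \<bullet> horizontal p w"
    by (simp_all add: parabolic_chart_def dir_deriv_parabolic_chart mink_simps mink_horizontal m')
qed

text \<open>
  The chart point and the tangent vectors of the paraboloid span the tangent space of the cone,
  whose radical is the line of the chart point.
\<close>

lemma parabolic_chart_tangent_complement:
  assumes p: "p \<in> lightcone" and w: "mink (parabolic_chart p u) w = 0"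
    and v: "\<And>v. null_direction p \<bullet> v = 0 \<Longrightarrow> mink (dir_deriv v (parabolic_chart p) u) w = 0"
  shows "\<exists>c. w = c *\<^sub>R parabolic_chart p u"
proof -
  note m = mink_opposite_null[OF p] null_direction_horizontal[OF p]
  define a b h k where "a = - mink w (opposite_null p)" and "b = - mink w p"
    and "h = horizontal p (snd w)" and "k = horizontal p u"
  have w': "w = a *\<^sub>R p + (0, h) + b *\<^sub>R opposite_null p"
    using null_decomposition[OF p, of w] by (simp add: a_def b_def h_def)
  have hk: "null_direction p \<bullet> h = 0" "null_direction p \<bullet> k = 0" by (simp_all add: h_def k_def m(5))
  note m' = m(1,2) mink_commute[of "opposite_null p" p] m(3,4)[OF hk(1)] m(3,4)[OF hk(2)]
     mink_commute[of "(0, _)" p] mink_commute[of "(0, _)" "opposite_null p"] lightconeD(3)[OF p] 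
  have hv: "v \<bullet> (h - a *\<^sub>R k) = 0" if "null_direction p \<bullet> v = 0" for v
    using v[OF that] m(3,4)[OF that] that
    by (simp add: w' dir_deriv_parabolic_chart horizontal_id[OF that] mink_simps mink_horizontal m' 
       k_def[symmetric] inner_diff_right inner_commute algebra_simps)
  have "null_direction p \<bullet> (h - a *\<^sub>R k) = 0" using hk by (simp add: inner_diff_right)
  then have "(h - a *\<^sub>R k) \<bullet> (h - a *\<^sub>R k) = 0" by (rule hv)
  then have h: "h = a *\<^sub>R k" by simp
  have "- b - (k \<bullet> k) / 2 * a + k \<bullet> h = 0"
    using w by (simp add: w' parabolic_chart_def k_def[symmetric] mink_simps mink_horizontal m' algebra_simps)
  then have "b = a * (k \<bullet> k) / 2" by (simp add: h)
  then have "w = a *\<^sub>R parabolic_chart p u"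
    by (subst w') (simp add: h parabolic_chart_def k_def[symmetric] scaleR_add_right)
  then show ?thesis ..
qed

text \<open>
  An open piece of the cone spans Minkowski space: the even and odd parts of a linear map along the
  paraboloid vanish separately, which determines the map on \<open>opposite_null p\<close> and on the horizontal
  vectors.
\<close>

lemma linear_eq_near_cone_point:
  fixes A A' :: "'n::finite minkowski \<Rightarrow> 'n minkowski"
  assumes n: "2 \<le> CARD('n)" and p: "p \<in> lightcone" and A: "linear A" "linear A'"
    and G: "open G" "p \<in> G" "\<And>y. y \<in> G \<Longrightarrow> y \<in> lightcone \<Longrightarrow> A y = A' y"
  shows "A = A'"
proof -
  define C where "C = (\<lambda>y. A y - A' y)"
  have C: "linear C" unfolding C_def using A by (rule linear_compose_sub)
  have "isCont (parabolic_chart p) 0"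
    using smooth_onD(3)[OF smooth_on_parabolic_chart[of p]] by (simp add: continuous_on_eq_continuous_at)
  then have "\<forall>\<^sub>F u in nhds 0. parabolic_chart p u \<in> G"
    using G(1,2) parabolic_chart_0[of p] unfolding isCont_def
    by (metis tendsto_at_iff_tendsto_nhds topological_tendstoD)
  then obtain d where d: "d > 0" "\<And>u. norm u < d \<Longrightarrow> parabolic_chart p u \<in> G"
    unfolding eventually_nhds_metric by auto
  have 0: "C (parabolic_chart p u) = 0" if "norm u < d" for u
    using G(3)[OF d(2)[OF that] parabolic_chart_in_lightcone[OF p]] by (simp add: C_def)
  have Cp: "C p = 0" using 0[of 0] d(1) by (simp add: parabolic_chart_0)
  have small: "C (0, u) = 0 \<and> (u \<bullet> u) *\<^sub>R C (opposite_null p) = 0" if u: "norm u < d"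
    "null_direction p \<bullet> u = 0" for u
  proof -
    have "C (parabolic_chart p w) = C (0, w) + ((w \<bullet> w) / 2) *\<^sub>R C (opposite_null p)"
      if "null_direction p \<bullet> w = 0" for w
      by (simp add: parabolic_chart_def horizontal_id[OF that] linear_add[OF C] linear_cmul[OF C] Cp)
    from this[of u] this[of "- u"]
    have "C (0, u) + ((u \<bullet> u) / 2) *\<^sub>R C (opposite_null p) = 0"
      "- C (0, u) + ((u \<bullet> u) / 2) *\<^sub>R C (opposite_null p) = 0"
      using 0[of u] 0[of "-u"] u linear_neg[OF C, of "(0, u)"] by auto
    then show ?thesis
      by (smt (verit) add.inverse_inverse add_eq_0_iff scaleR_half_double scaleR_eq_0_iff divide_eq_0_iff
        neg_equal_zero)
  qed
  obtain e where e: "e \<bullet> e = 1" "null_direction p \<bullet> e = 0"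
    using ex_orthogonal_unit_vector[of "{null_direction p}"] n by auto
  have Cn: "C (opposite_null p) = 0"
  proof -
    have "norm e = 1" using e(1) by (simp add: norm_eq_1)
    then have "norm ((d / 2) *\<^sub>R e) < d" using d(1) by simp
    then show ?thesis using small[of "(d / 2) *\<^sub>R e"] d(1) e by simp
  qed
  have Ch: "C (0, u) = 0" if "null_direction p \<bullet> u = 0" for u
  proof -
    \<comment> \<open>Scaling by \<open>t\<close> brings \<open>u\<close> into the ball of radius \<open>d\<close>.\<close>
    define t where "t = d / (2 * (norm u + 1))"
    have t: "t > 0" unfolding t_def using d(1) by (intro divide_pos_pos) (auto simp: add_nonneg_pos)
    have "norm (t *\<^sub>R u) = d / 2 * (norm u / (norm u + 1))" using d(1) by (simp add: t_def abs_mult)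
    also have "\<dots> \<le> d / 2 * 1" using d(1) by (intro mult_left_mono) (auto simp: divide_le_eq_1 add_nonneg_pos)
    also have "\<dots> < d" using d(1) by simp
    finally have "C (0, t *\<^sub>R u) = 0" using small[of "t *\<^sub>R u"] that by simp
    then have "t *\<^sub>R C (0, u) = 0" using linear_cmul[OF C, of t "(0, u)"] by simp
    then show ?thesis using t by simp
  qed
  have "C y = 0" for y
    by (subst null_decomposition[OF p, of y])
       (simp add: linear_add[OF C] linear_cmul[OF C] linear_diff[OF C] linear_neg[OF C]
         Cp Cn Ch[OF null_direction_horizontal[OF p]])
  then show ?thesis by (auto simp: C_def fun_eq_iff)
qed

lemma horizontal_snd:
  assumes "p \<in> lightcone" shows "horizontal p (snd p) = 0"
proof -
  have "horizontal p (null_direction p) = 0"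
    by (simp add: horizontal_def null_direction_inner[OF assms])
  then have "horizontal p (fst p *\<^sub>R null_direction p) = 0" by (simp add: linear_cmul[OF linear_horizontal])
  then show ?thesis using lightconeD(1)[OF assms] by (simp add: null_direction_def)
qed

section \<open>Local rigidity\<close>

lemma lifted_chart_has_derivative:
  assumes f: "smooth_map U f" and W: "open W" "parabolic_chart p ` W \<subseteq> U" "u \<in> W"
  shows "((\<lambda>u. f (parabolic_chart p u)) has_derivative
    (\<lambda>v. differential U f (parabolic_chart p u) (dir_deriv v (parabolic_chart p) u))) (at u)"
proof -
  have "(f has_derivative differential U f (parabolic_chart p u)) (at (parabolic_chart p u) within
    parabolic_chart p ` W)"
    using smooth_map_has_derivative[OF f] W by (blast intro: has_derivative_subset)
  from has_derivative_in_compose[OF has_derivative_at_withinI[OF has_derivative_parabolic_chart] this]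
  show ?thesis using at_within_open[OF W(3,1)] by (simp add: dir_deriv_parabolic_chart)
qed

text \<open>
  The condition that the derivatives of the lift span the tangent space of the cone holds because
  the differential of an isometry has an inverse, namely the differential of the inverse isometry.
\<close>

lemma cone_chart_lift:
  fixes f :: "'n::finite minkowski \<Rightarrow> 'n minkowski"
  assumes f: "cone_isometry U V f" "open_in_cone U" "open_in_cone V" and p: "p \<in> lightcone"
    and W: "open W" "parabolic_chart p ` W \<subseteq> U"
  shows "flat_null_lift W {v. null_direction p \<bullet> v = 0} (\<lambda>u. f (parabolic_chart p u))"
proof
  note D = cone_isometryD[OF f]
  let ?c = "parabolic_chart p"
  have cU: "?c u \<in> U" if "u \<in> W" for u using W(2) that by blast
  have dF: "dir_deriv v (\<lambda>u. f (?c u)) u = differential U f (?c u) (dir_deriv v ?c u)" if "u \<in> W" for u v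
    by (rule dir_deriv_eqI[OF lifted_chart_has_derivative[OF D(2) W that]])
  have tan: "mink (?c u) (dir_deriv v ?c u) = 0" for u v by (rule mink_dir_deriv_parabolic_chart(1)[OF p])
  show "open W" by fact
  have "smooth_map W ?c" by (rule smooth_map_of_smooth_on[OF open_UNIV smooth_on_parabolic_chart]) simp
  from smooth_map_compose[OF this D(2) W(2)] show "smooth_on W (\<lambda>u. f (?c u))"
    by (rule smooth_map_open[OF W(1)])
  show "subspace {v. null_direction p \<bullet> v = 0}"
    by (auto simp: subspace_def inner_add_right)
  show "f (?c u) \<in> lightcone" if "u \<in> W" for u using D(5) cU that by blast
  show "mink (dir_deriv v (\<lambda>u. f (?c u)) u) (dir_deriv w (\<lambda>u. f (?c u)) u) = v \<bullet> w"
    if "u \<in> W" "v \<in> {v. null_direction p \<bullet> v = 0}" "w \<in> {v. null_direction p \<bullet> v = 0}" for u v w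
    using that D(6)[OF cU[OF that(1)] tan tan] mink_dir_deriv_parabolic_chart(2)[OF p]
    by (simp add: dF horizontal_id)
  show "\<exists>c. y = c *\<^sub>R f (?c u)"
    if u: "u \<in> W" and y: "mink (f (?c u)) y = 0"
      and yv: "\<And>v. v \<in> {v. null_direction p \<bullet> v = 0} \<Longrightarrow> mink (dir_deriv v (\<lambda>u. f (?c u)) u) y = 0" for u y
  proof -
    let ?g = "inv_into U f" and ?q = "f (?c u)"
    note D' = cone_isometryD[OF cone_isometry_inverse[OF f(1)] f(3,2)]
    have q: "?q \<in> V" using D(3) cU[OF u] by blast
    have gq: "?g ?q = ?c u" using D(4) cU[OF u] by simp
    define w where "w = differential V ?g ?q y"
    have w: "mink (?c u) w = 0" using D'(7)[OF q y] by (simp add: w_def gq)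
    have yT: "y \<in> tangent_space V ?q" using y tangent_space_open_in_cone[OF f(3) q] by simp
    have yw: "y = differential U f (?c u) w"
      using differential_inverse'[OF D(1) q yT] by (simp add: w_def gq)
    have "\<exists>c. w = c *\<^sub>R ?c u"
    proof (rule parabolic_chart_tangent_complement[OF p w])
      fix v assume "null_direction p \<bullet> v = 0"
      then have "mink (differential U f (?c u) (dir_deriv v ?c u)) y = 0" using yv[of v] dF[OF u] by simp
      then show "mink (dir_deriv v ?c u) w = 0" using D(6)[OF cU[OF u] tan w] yw by simp
    qed
    then have "mink w w = 0" using lightconeD(3)[OF parabolic_chart_in_lightcone[OF p]]
      by (auto simp: mink_simps)
    then have "mink y y = 0" using D(6)[OF cU[OF u] w w] yw by simp
    then show ?thesis using null_tangent_vector[OF D(5)[OF cU[OF u]] y] by blast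
  qed
qed

text \<open>
  Along the paraboloid \<open>f\<close> agrees with the quadratic polynomial \<open>F 0 + F\<^sub>u(0) + |u|\<^sup>2 N / 2\<close>, which
  is the image of the chart under the linear map \<open>A\<close> sending \<open>p\<close> to \<open>F 0\<close>, a horizontal vector \<open>u\<close>
  to \<open>F\<^sub>u(0)\<close> and \<open>opposite_null p\<close> to \<open>N\<close>. Homogeneity extends the equality to a neighbourhood of
  \<open>p\<close> in the cone.
\<close>

lemma umbilic_lift_lorentz:
  fixes f :: "'n::finite minkowski \<Rightarrow> 'n minkowski"
  assumes n: "3 \<le> CARD('n)" and f: "cone_isometry U V f" "open_in_cone U" "open_in_cone V"
    and p: "p \<in> lightcone" "p \<in> B"
    and B: "open B" "convex B" "B \<inter> lightcone \<subseteq> U"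
    and W: "open W" "convex W" "0 \<in> W" "parabolic_chart p ` W \<subseteq> B"
    and umbilic: "\<And>u v w. u \<in> W \<Longrightarrow> null_direction p \<bullet> v = 0 \<Longrightarrow> null_direction p \<bullet> w = 0 \<Longrightarrow> v \<bullet> w = 0 \<Longrightarrow>
      dir_deriv w (dir_deriv v (\<lambda>u. f (parabolic_chart p u))) u = 0"
  shows "\<exists>A\<in>O_plus. \<exists>G. open G \<and> p \<in> G \<and> (\<forall>y\<in>G \<inter> lightcone. f y = A y)"
proof -
  let ?c = "parabolic_chart p" and ?F = "\<lambda>u. f (parabolic_chart p u)" and ?x = "null_direction p"
  let ?E = "{v. ?x \<bullet> v = 0}" and ?n = "opposite_null p" and ?H = "horizontal p"
  have cU: "?c ` W \<subseteq> U" using W(4) B(3) parabolic_chart_in_lightcone[OF p(1)] by blast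
  interpret flat_null_lift W ?E ?F by (rule cone_chart_lift[OF f p(1) W(1) cU])
  obtain e where e: "e \<bullet> e = 1" "?x \<bullet> e = 0"
    using ex_orthogonal_unit_vector[of "{?x}"] n by auto
  have "card {?x, e} < DIM(real ^ 'n)" using n card_insert_le_m1[of 2 "{e}" ?x] by (simp add: card_insert_if)
  then obtain l where l: "l \<bullet> l = 1" "?x \<bullet> l = 0" "e \<bullet> l = 0"
    using ex_orthogonal_unit_vector[of "{?x, e}"] by (metis finite.emptyI finite_insert insertCI)
  interpret rigid_null_lift W ?E ?F e l
    by unfold_locales (use e l umbilic in auto)
  define L where "L = (\<lambda>v. dir_deriv v ?F 0)"
  have L: "linear L" unfolding L_def by (rule dir_deriv_linear[OF smooth_onD(1)[OF smoothF W(3)]])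
  define A where "A = (\<lambda>y. (- mink y ?n) *\<^sub>R f p + L (?H (snd y)) + (- mink y p) *\<^sub>R N 0)"
  have linA: "linear A"
    by (rule linearI)
       (simp_all add: A_def mink_simps linear_add[OF L] linear_cmul[OF L] linear_add[OF linear_horizontal]
         linear_cmul[OF linear_horizontal] algebra_simps)
  note m = mink_opposite_null[OF p(1)] null_direction_horizontal[OF p(1)]
  have F0: "?F 0 = f p" by (simp add: parabolic_chart_0)
  have h: "?H v \<in> ?E" for v using m(5) by simp
  have Apres: "mink (A y) (A y) = mink y y" for y
  proof -
    define a b k where "a = - mink y ?n" and "b = - mink y p" and "k = ?H (snd y)"
    have L': "dir_deriv v ?F 0 = L v" for v by (simp add: L_def)
    have *: "mink (N 0) (N 0) = 0" "mink (N 0) (f p) = -1" "mink (N 0) (L k) = 0"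
      "mink (f p) (f p) = 0" "mink (L k) (f p) = 0" "mink (L k) (L k) = k \<bullet> k"
      using N_products(1,2)[OF W(3)] N_products(3)[OF W(3) h[of "snd y"]] null[OF W(3)]
        tangent[OF W(3), of k] isometric[OF W(3) h[of "snd y"] h[of "snd y"]]
      unfolding F0 L' k_def[symmetric] by simp_all
    note * = * mink_commute[of "f p" "N 0"] mink_commute[of "L k" "N 0"] mink_commute[of "f p" "L k"]
    have "mink (A y) (A y) = mink (a *\<^sub>R f p + L k + b *\<^sub>R N 0) (a *\<^sub>R f p + L k + b *\<^sub>R N 0)"
      by (simp add: A_def a_def b_def k_def)
    also have "\<dots> = k \<bullet> k - 2 * a * b" by (simp add: mink_simps * algebra_simps)
    also have "\<dots> = mink (a *\<^sub>R p + (0, k) + b *\<^sub>R ?n) (a *\<^sub>R p + (0, k) + b *\<^sub>R ?n)"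
      using m(1,2) m(3,4)[OF m(5)[of "snd y"]] mink_commute[of ?n p] mink_commute[of
        "(0, k)" p] mink_commute[of "(0, k)" ?n]
        lightconeD(3)[OF p(1)]
      by (simp add: mink_simps mink_horizontal k_def[symmetric] algebra_simps)
    also have "\<dots> = mink y y" using null_decomposition[OF p(1), of y] by (simp add: a_def b_def k_def)
    finally show ?thesis .
  qed
  have Ap: "A p = f p"
  proof -
    show ?thesis using m(1) lightconeD(3)[OF p(1)] by (simp add: A_def linear_0[OF L] horizontal_snd[OF p(1)])
  qed
  have AO: "A \<in> O_plus"
    by (rule O_plusI[OF linA Apres p(1)]) (use Ap cone[OF W(3)] F0 in simp)
  \<comment> \<open>Dividing a point of the cone by \<open>a\<close> moves it along its half-line to the paraboloid.\<close>
  define a where "a = (\<lambda>y. - mink y ?n)"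
  have ca: "continuous (at p) a" unfolding a_def
    by (intro continuous_intros bounded_bilinear.continuous[OF bounded_bilinear_mink])
  have ap: "a p = 1" using m(1) by (simp add: a_def)
  have cH: "continuous (at p) (\<lambda>y. (1 / a y) *\<^sub>R ?H (snd y))"
    using ap ca by (intro continuous_intros continuous_at_compose[OF _ linear_continuous_at[OF
      bounded_linear_horizontal], unfolded o_def]) auto
  have H0: "(1 / a p) *\<^sub>R ?H (snd p) = 0"
    by (simp add: horizontal_snd[OF p(1)])
  have ev1: "\<forall>\<^sub>F y in nhds p. a y > 0"
    using isCont_eventually_in_open[OF ca open_greaterThan[of 0]] ap by simp
  have ev2: "\<forall>\<^sub>F y in nhds p. (1 / a y) *\<^sub>R ?H (snd y) \<in> W"
    by (rule isCont_eventually_in_open[OF cH W(1)]) (simp only: H0 W(3))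
  have ev3: "\<forall>\<^sub>F y in nhds p. y \<in> B" using B(1) p(2) by (rule eventually_nhds_in_open)
  have "\<forall>\<^sub>F y in nhds p. y \<in> B \<and> a y > 0 \<and> (1 / a y) *\<^sub>R ?H (snd y) \<in> W"
    using ev1 ev2 ev3 by eventually_elim auto
  then obtain G where G: "open G" "p \<in> G" "\<And>y. y \<in> G \<Longrightarrow> y \<in> B \<and> a y > 0 \<and> (1 / a y) *\<^sub>R ?H (snd y) \<in> W"
    unfolding eventually_nhds by blast
  have "f y = A y" if yG: "y \<in> G" and y: "y \<in> lightcone" for y
  proof -
    define s b k where "s = a y" and "b = - mink y p" and "k = ?H (snd y)"
    have s: "s > 0" "(1 / s) *\<^sub>R k \<in> W" "y \<in> B" using G(3)[OF yG] by (simp_all add: s_def k_def)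
    have kE: "?x \<bullet> k = 0" using m(5) by (simp add: k_def)
    have dec: "y = s *\<^sub>R p + (0, k) + b *\<^sub>R ?n"
      using null_decomposition[OF p(1), of y] by (simp add: a_def b_def k_def s_def)
    have "mink (s *\<^sub>R p + (0, k) + b *\<^sub>R ?n) (s *\<^sub>R p + (0, k) + b *\<^sub>R ?n) = k \<bullet> k - 2 * s * b"
      using m(1,2) m(3,4)[OF kE] mink_commute[of ?n p] mink_commute[of "(0, k)" p] mink_commute[of
        "(0, k)" ?n]
        lightconeD(3)[OF p(1)]
      by (simp add: mink_simps mink_horizontal algebra_simps)
    then have "k \<bullet> k = 2 * s * b" using lightconeD(3)[OF y] dec by simp
    then have b: "b = s * (((1 / s) *\<^sub>R k \<bullet> (1 / s) *\<^sub>R k) / 2)" using s(1) by (simp add: field_simps)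
    have kE': "?x \<bullet> (1 / s) *\<^sub>R k = 0" using kE by simp
    have y': "y = s *\<^sub>R ?c ((1 / s) *\<^sub>R k)"
      using s(1) b unfolding parabolic_chart_def horizontal_id[OF kE']
      by (subst dec) (simp add: scaleR_add_right)
    have "f y = f (s *\<^sub>R ?c ((1 / s) *\<^sub>R k))" using y' by simp
    also have "\<dots> = s *\<^sub>R ?F ((1 / s) *\<^sub>R k)"
      by (rule cone_isometry_homogeneous[OF _ f B parabolic_chart_in_lightcone[OF p(1)]])
         (use n W(4) s y' in auto)
    also have "?F ((1 / s) *\<^sub>R k) = ?F 0 + L ((1 / s) *\<^sub>R k) + (((1 / s) *\<^sub>R k \<bullet> (1 / s) *\<^sub>R k) / 2) *\<^sub>R N 0"
      unfolding L_def by (rule lift_quadratic[OF W(2,3) s(2)]) (use kE' in simp)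
    also have "s *\<^sub>R \<dots> = s *\<^sub>R f p + L k + b *\<^sub>R N 0"
      using s(1) b by (simp add: F0 linear_cmul[OF L] scaleR_add_right)
    also have "\<dots> = A y" by (simp add: A_def s_def a_def b_def k_def)
    finally show ?thesis .
  qed
  then show ?thesis using AO G(1,2) by blast
qed

text \<open>
  Two orthogonal horizontal directions together with the direction of \<open>p\<close> span at most three
  dimensions, so in at least four there remains a third horizontal direction.
\<close>

lemma isometry_locally_lorentz:
  fixes f :: "'n::finite minkowski \<Rightarrow> 'n minkowski"
  assumes n: "4 \<le> CARD('n)" and f: "cone_isometry U V f" "open_in_cone U" "open_in_cone V" and p: "p \<in> U"
  shows "\<exists>A\<in>O_plus. \<exists>G. open G \<and> p \<in> G \<and> (\<forall>y\<in>G \<inter> lightcone. f y = A y)"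
proof -
  let ?c = "parabolic_chart p" and ?x = "null_direction p"
  note pl = open_in_coneD[OF f(2) p]
  obtain O' where O': "open O'" "U = lightcone \<inter> O'" using f(2) by (auto simp: open_in_cone_def openin_open)
  then obtain d where d: "d > 0" "ball p d \<subseteq> O'" using p openE by (metis IntD2)
  have "isCont ?c 0"
    using smooth_onD(3)[OF smooth_on_parabolic_chart[of p]] by (simp add: continuous_on_eq_continuous_at)
  then obtain d' where d': "d' > 0" "\<And>u. norm u < d' \<Longrightarrow> ?c u \<in> ball p d"
    using d(1) unfolding continuous_at_eps_delta by (auto simp: parabolic_chart_0 dist_commute)
  have cB: "?c ` ball 0 d' \<subseteq> ball p d" using d'(2) by auto
  have BU: "ball p d \<inter> lightcone \<subseteq> U" using d(2) O'(2) by auto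
  then have cU: "?c ` ball 0 d' \<subseteq> U" using cB parabolic_chart_in_lightcone[OF pl] by blast
  interpret flat_null_lift "ball 0 d'" "{v. ?x \<bullet> v = 0}" "\<lambda>u. f (?c u)"
    by (rule cone_chart_lift[OF f pl open_ball cU])
  show ?thesis
  proof (rule umbilic_lift_lorentz[OF _ f pl _ open_ball convex_ball BU open_ball convex_ball _ cB])
    fix u v w :: "real ^ 'n"
    assume *: "u \<in> ball 0 d'" "?x \<bullet> v = 0" "?x \<bullet> w = 0" "v \<bullet> w = 0"
    have "card {?x, v, w} \<le> 3" by (simp add: card_insert_if)
    then have "card {?x, v, w} < DIM(real ^ 'n)" using n by simp
    then obtain z where z: "z \<bullet> z = 1" "?x \<bullet> z = 0" "v \<bullet> z = 0" "w \<bullet> z = 0"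
      using ex_orthogonal_unit_vector[of "{?x, v, w}"] by (metis finite.emptyI finite_insert insertCI)
    show "dir_deriv w (dir_deriv v (\<lambda>u. f (?c u))) u = 0"
      by (rule second_orthogonal_vanishes[of _ _ _ z]) (use * z in auto)
  qed (use n d d' in auto)
qed

text \<open>
  The linear map that represents \<open>f\<close> near a point is unique, hence locally constant in the point,
  hence constant on a connected set.
\<close>

lemma lorentz_locally_imp_globally:
  fixes f :: "'n::finite minkowski \<Rightarrow> 'n minkowski"
  assumes n: "2 \<le> CARD('n)" and U: "open_in_cone U" "connected U"
    and loc: "\<And>p. p \<in> U \<Longrightarrow> \<exists>A\<in>O_plus. \<exists>G. open G \<and> p \<in> G \<and> (\<forall>y\<in>G \<inter> lightcone. f y = A y)"
  shows "\<exists>A\<in>O_plus. \<forall>p\<in>U. f p = A p"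
proof (cases "U = {}")
  case True
  have "id \<in> (O_plus :: ('n minkowski \<Rightarrow> 'n minkowski) set)" by (auto simp: O_plus_def O_lorentz_def linear_id)
  then show ?thesis using True by auto
next
  case False
  then obtain p0 where p0: "p0 \<in> U" by blast
  obtain A where A: "\<And>p. p \<in> U \<Longrightarrow> A p \<in> O_plus \<and> (\<exists>G. open G \<and> p \<in> G \<and> (\<forall>y\<in>G \<inter> lightcone. f y = A p y))"
    using loc by metis
  have const: "A p0 = A p" if "p \<in> U" for p
  proof (rule connected_local_const[OF U(2) p0 that], intro ballI)
    fix q assume q: "q \<in> U"
    obtain G where G: "open G" "q \<in> G" "\<And>y. y \<in> G \<Longrightarrow> y \<in> lightcone \<Longrightarrow> f y = A q y" using A[OF q] by blast
    have "A q = A r" if r: "r \<in> G" "r \<in> U" for r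
    proof -
      obtain G' where G': "open G'" "r \<in> G'" "\<And>y. y \<in> G' \<Longrightarrow> y \<in> lightcone \<Longrightarrow> f y = A r y" using A[OF r(2)]
        by blast
      show ?thesis
      proof (rule linear_eq_near_cone_point[OF n open_in_coneD[OF U(1) r(2)], of _ _ "G \<inter> G'"])
        show "linear (A q)" "linear (A r)"
          using A[OF q] A[OF r(2)] by (simp_all add: O_plus_def O_lorentz_def)
        show "A q y = A r y" if "y \<in> G \<inter> G'" "y \<in> lightcone" for y
          using G(3)[of y] G'(3)[of y] that by simp
      qed (use G G' r in auto)
    qed
    then show "\<forall>\<^sub>F r in at q within U. A q = A r"
      unfolding eventually_at_topological using G(1,2) by blast
  qed
  show ?thesis
  proof (intro bexI ballI)
    show "A p0 \<in> O_plus" using A[OF p0] by blast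
    fix p assume p: "p \<in> U"
    show "f p = A p0 p" using A[OF p] open_in_coneD[OF U(1) p] const[OF p] by auto
  qed
qed

theorem local_rigidity:
  fixes f :: "'n::finite minkowski \<Rightarrow> 'n minkowski"
  assumes n: "4 \<le> CARD('n)" and f: "cone_isometry U V f" "open_in_cone U" "open_in_cone V" and U:
    "connected U"
  shows "\<exists>A\<in>O_plus. \<forall>p\<in>U. f p = A p"
  by (rule lorentz_locally_imp_globally[OF _ f(2) U isometry_locally_lorentz[OF n f]]) (use n in simp_all)

section \<open>Global rigidity\<close>

lemma opposite_null_in_lightcone:
  assumes "p \<in> lightcone" shows "opposite_null p \<in> lightcone"
  using lightconeD(1)[OF assms] mink_opposite_null(2)[OF assms]
  by (simp add: lightcone_def opposite_null_def)

lemma norm_dir_deriv_le: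
  assumes "G differentiable (at y)"
  shows "norm (dir_deriv v G y) \<le> norm v * (\<Sum>b\<in>Basis. norm (dir_deriv b G y))"
proof -
  have "norm (dir_deriv v G y) \<le> (\<Sum>b\<in>Basis. norm ((v \<bullet> b) *\<^sub>R dir_deriv b G y))"
    unfolding dir_deriv_expand[OF assms, of v] by (rule norm_sum)
  also have "\<dots> \<le> (\<Sum>b\<in>Basis. norm v * norm (dir_deriv b G y))"
    by (intro sum_mono) (auto intro!: mult_right_mono Basis_le_norm)
  finally show ?thesis by (simp add: sum_distrib_left)
qed

text \<open>
  The second bound is stated for the sum that arises when a composition is differentiated twice.
\<close>

lemma smooth_on_derivative_bounds:
  fixes G :: "'a::euclidean_space \<Rightarrow> 'b::euclidean_space"
  assumes "open O'" "smooth_on O' G" "y \<in> O'"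
  obtains d K where "d > 0" "cball y d \<subseteq> O'" "K \<ge> 0"
    "\<And>x v. x \<in> cball y d \<Longrightarrow> norm (dir_deriv v G x) \<le> K * norm v"
    "\<And>x v w. x \<in> cball y d
      \<Longrightarrow> (\<Sum>b\<in>Basis. norm (v \<bullet> b) * norm (dir_deriv w (dir_deriv b G) x)) \<le> K * norm v * norm w"
proof -
  obtain d where d: "d > 0" "cball y d \<subseteq> O'" using assms(1,3) open_contains_cball by blast
  define S where "S = (\<lambda>x. (\<Sum>b\<in>Basis. norm (dir_deriv b G x))
    + (\<Sum>b\<in>Basis. \<Sum>c\<in>Basis. norm (dir_deriv c (dir_deriv b G) x)))"
  have "continuous_on (cball y d) S" unfolding S_def
    by (intro continuous_intros continuous_on_subset[OF smooth_onD(3)[OF smooth_onD(2)[OF assms(2)]] d(2)]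
      continuous_on_subset[OF smooth_onD(3)[OF smooth_onD(2)[OF smooth_onD(2)[OF assms(2)]]] d(2)])
  then have "bounded (S ` cball y d)" using compact_cball compact_continuous_image compact_imp_bounded
    by blast
  then obtain K where K: "\<And>x. x \<in> cball y d \<Longrightarrow> S x \<le> K"
    unfolding bounded_iff by (metis abs_le_D1 imageI real_norm_def)
  have S0: "0 \<le> (\<Sum>b\<in>Basis. norm (dir_deriv b G x))"
    "0 \<le> (\<Sum>b\<in>Basis. \<Sum>c\<in>Basis. norm (dir_deriv c (dir_deriv b G) x))" for x
    by (intro sum_nonneg norm_ge_zero)+
  have "y \<in> cball y d" using d(1) by simp
  from K[OF this] S0[of y] have "K \<ge> 0" unfolding S_def by linarith
  show ?thesis
  proof (rule that[OF d \<open>K \<ge> 0\<close>])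
    fix x v assume x: "x \<in> cball y d"
    have "norm (dir_deriv v G x) \<le> norm v * (\<Sum>b\<in>Basis. norm (dir_deriv b G x))"
      by (rule norm_dir_deriv_le[OF smooth_onD(1)[OF assms(2)]]) (use x d in auto)
    also have "\<dots> \<le> norm v * K"
      using K[OF x] S0[of x] unfolding S_def by (intro mult_left_mono) auto
    finally show "norm (dir_deriv v G x) \<le> K * norm v" by (simp add: mult.commute)
  next
    fix x v w assume x: "x \<in> cball y d"
    have "norm (v \<bullet> b) * norm (dir_deriv w (dir_deriv b G) x)
        \<le> norm v * (norm w * (\<Sum>c\<in>Basis. norm (dir_deriv c (dir_deriv b G) x)))" if "b \<in> Basis" for b
      by (intro mult_mono norm_dir_deriv_le[OF smooth_onD(1)[OF smooth_onD(2)[OF assms(2)]]])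
         (use x d that in \<open>auto intro: Basis_le_norm\<close>)
    then have "(\<Sum>b\<in>Basis. norm (v \<bullet> b) * norm (dir_deriv w (dir_deriv b G) x))
      \<le> (\<Sum>b\<in>Basis. norm v * (norm w * (\<Sum>c\<in>Basis. norm (dir_deriv c (dir_deriv b G) x))))"
      by (rule sum_mono)
    also have "\<dots> = (norm v * norm w) * (\<Sum>b\<in>Basis. \<Sum>c\<in>Basis. norm (dir_deriv c (dir_deriv b G) x))"
      by (simp add: sum_distrib_left mult.assoc)
    also have "\<dots> \<le> (norm v * norm w) * K"
      using K[OF x] S0[of x] unfolding S_def by (intro mult_left_mono) auto
    finally show "(\<Sum>b\<in>Basis. norm (v \<bullet> b) * norm (dir_deriv w (dir_deriv b G) x)) \<le> K * norm v * norm w"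
      by (simp add: algebra_simps)
  qed
qed

lemma open_in_cone_lightcone: "open_in_cone lightcone"
  by (simp add: open_in_cone_def)

text \<open>
  The factor \<open>1 / s\<close> in front of the second derivatives of \<open>G\<close> reflects the homogeneity of the
  lift: second derivatives of a function of degree one have degree minus one.
\<close>

lemma second_derivative_rescaled:
  fixes G :: "'n::finite minkowski \<Rightarrow> 'n minkowski"
  assumes O': "open O'" "smooth_on O' G" and s: "s > 0"
    and F: "\<And>u. (1 / s) *\<^sub>R parabolic_chart p u \<in> O' \<Longrightarrow> F u = s *\<^sub>R G ((1 / s) *\<^sub>R parabolic_chart p u)"
    and u: "(1 / s) *\<^sub>R parabolic_chart p u \<in> O'"
  shows "dir_deriv w (dir_deriv v F) u =
     (\<Sum>b\<in>Basis. ((1 / s) * (dir_deriv v (parabolic_chart p) u \<bullet> b)) *\<^sub>R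
         dir_deriv (dir_deriv w (parabolic_chart p) u) (dir_deriv b G) ((1 / s) *\<^sub>R parabolic_chart p u)) +
     (horizontal p w \<bullet> horizontal p v) *\<^sub>R dir_deriv (opposite_null p) G ((1 / s) *\<^sub>R parabolic_chart p u)"
proof -
  let ?c = "parabolic_chart p" and ?q = "\<lambda>u. (1 / s) *\<^sub>R parabolic_chart p u"
  define X where "X = ?q -` O'"
  have oX: "open X" unfolding X_def
    using smooth_onD(3)[OF smooth_on_parabolic_chart[of p]] by (intro open_vimage O' continuous_intros) 
  have c: "(?c has_derivative (\<lambda>v. dir_deriv v ?c u)) (at u)" for u
    using has_derivative_parabolic_chart[of p u] by (simp add: dir_deriv_parabolic_chart)
  have q: "(?q has_derivative (\<lambda>v. (1 / s) *\<^sub>R dir_deriv v ?c u)) (at u)" for u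
    by (intro has_derivative_scaleR_right c)
  have dG: "G differentiable (at (?q u))" "dir_deriv b G differentiable (at (?q u))" if "u \<in> X" for u b
    using that smooth_onD(1)[OF O'(2)] smooth_onD(1)[OF smooth_onD(2)[OF O'(2)]] by (auto simp: X_def)
  have F1: "F differentiable (at y)"
    "dir_deriv v F y = (\<Sum>b\<in>Basis. (dir_deriv v ?c y \<bullet> b) *\<^sub>R dir_deriv b G (?q y))"
    if y: "y \<in> X" for y v
  proof -
    have D: "((\<lambda>u. s *\<^sub>R G (?q u)) has_derivative (\<lambda>v. s *\<^sub>R dir_deriv ((1 / s) *\<^sub>R dir_deriv v ?c y) G
      (?q y))) (at y)"
      by (intro has_derivative_scaleR_right has_derivative_compose[OF q has_derivative_dir_deriv[OF
        dG(1)[OF y]]])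
    have D': "(F has_derivative (\<lambda>v. s *\<^sub>R dir_deriv ((1 / s) *\<^sub>R dir_deriv v ?c y) G (?q y))) (at y)"
      by (rule has_derivative_transform_within_open[OF D oX y]) (simp add: F X_def)
    then show "F differentiable (at y)" by (rule differentiableI)
    show "dir_deriv v F y = (\<Sum>b\<in>Basis. (dir_deriv v ?c y \<bullet> b) *\<^sub>R dir_deriv b G (?q y))"
      unfolding dir_deriv_eqI[OF D'] dir_deriv_expand[OF dG(1)[OF y], symmetric]
      using s by (simp add: linear_cmul[OF dir_deriv_linear[OF dG(1)[OF y]]])
  qed
  have uX: "u \<in> X" using u by (simp add: X_def)
  have cv: "((\<lambda>y. dir_deriv v ?c y \<bullet> b) has_derivative (\<lambda>w. (horizontal p w \<bullet> horizontal p v) *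
    (opposite_null p \<bullet> b))) (at u)" for b
  proof -
    have H: "(horizontal p has_derivative horizontal p) (at u)"
      by (rule bounded_linear_imp_has_derivative[OF bounded_linear_horizontal])
    have "((\<lambda>y. dir_deriv v ?c y) has_derivative (\<lambda>w. (horizontal p w \<bullet> horizontal p v) *\<^sub>R opposite_null
      p)) (at u)"
      unfolding dir_deriv_parabolic_chart by (auto intro!: derivative_eq_intros H)
    from has_derivative_inner_left[OF this, of b] show ?thesis by simp
  qed
  have "((\<lambda>y. \<Sum>b\<in>Basis. (dir_deriv v ?c y \<bullet> b) *\<^sub>R dir_deriv b G (?q y)) has_derivative
     (\<lambda>w. \<Sum>b\<in>Basis. (dir_deriv v ?c u \<bullet> b) *\<^sub>R dir_deriv ((1 / s) *\<^sub>R dir_deriv w ?c u) (dir_deriv b G) (?q u)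
       + ((horizontal p w \<bullet> horizontal p v) * (opposite_null p \<bullet> b)) *\<^sub>R dir_deriv b G (?q u))) (at u)"
    by (intro has_derivative_sum has_derivative_scaleR cv has_derivative_compose[OF q
      has_derivative_dir_deriv[OF dG(2)[OF uX]]])
  then have "(dir_deriv v F has_derivative
     (\<lambda>w. \<Sum>b\<in>Basis. (dir_deriv v ?c u \<bullet> b) *\<^sub>R dir_deriv ((1 / s) *\<^sub>R dir_deriv w ?c u) (dir_deriv b G) (?q u)
       + ((horizontal p w \<bullet> horizontal p v) * (opposite_null p \<bullet> b)) *\<^sub>R dir_deriv b G (?q u))) (at u)"
    by (rule has_derivative_transform_within_open[OF _ oX uX]) (simp add: F1(2))
  from dir_deriv_eqI[OF this, of w] show ?thesis
    unfolding dir_deriv_expand[OF dG(1)[OF uX], of "opposite_null p"]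
      linear_cmul[OF dir_deriv_linear[OF dG(2)[OF uX]]] scaleR_sum_right scaleR_scaleR sum.distrib
    by (simp only: mult.commute)
qed

text \<open>
  Far out on the paraboloid, the point divided by \<open>s = |u|\<^sup>2 / 2\<close> approaches \<open>opposite_null p\<close>.
  Homogeneity replaces \<open>f\<close> by \<open>s G(x / s)\<close> with one fixed smooth extension \<open>G\<close> near that point. The
  first derivatives of the chart grow like \<open>|u|\<close>, so their product is of the order of \<open>s\<close> and is
  compensated by the factor \<open>1 / s\<close>.
\<close>

lemma second_derivative_bounded:
  fixes f :: "'n::finite minkowski \<Rightarrow> 'n minkowski"
  assumes n: "2 \<le> CARD('n)" and f: "cone_isometry lightcone lightcone f" and p: "p \<in> lightcone"
    and v: "null_direction p \<bullet> v = 0" and w: "null_direction p \<bullet> w = 0"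
  shows "\<exists>C R. \<forall>u. R \<le> norm (horizontal p u) \<longrightarrow>
    norm (dir_deriv w (dir_deriv v (\<lambda>u. f (parabolic_chart p u))) u) \<le> C"
proof -
  let ?c = "parabolic_chart p" and ?n = "opposite_null p"
  note D = cone_isometryD[OF f open_in_cone_lightcone open_in_cone_lightcone]
  note nl = opposite_null_in_lightcone[OF p]
  obtain O' G where G: "open O'" "?n \<in> O'" "smooth_on O' G" "\<And>x. x \<in> lightcone \<Longrightarrow> x \<in> O' \<Longrightarrow> f x = G x"
    using smooth_mapE[OF D(2) nl] by metis
  obtain d K where d: "d > 0" "cball ?n d \<subseteq> O'" "K \<ge> 0"
    "\<And>x v. x \<in> cball ?n d \<Longrightarrow> norm (dir_deriv v G x) \<le> K * norm v"
    "\<And>x v w. x \<in> cball ?n d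
      \<Longrightarrow> (\<Sum>b\<in>Basis. norm (v \<bullet> b) * norm (dir_deriv w (dir_deriv b G) x)) \<le> K * norm v * norm w"
    by (rule smooth_on_derivative_bounds[OF G(1,3,2)], rule that)
  \<comment> \<open>The second term makes the rescaled chart point lie within distance \<open>d\<close> of \<open>opposite_null p\<close>.\<close>
  define R where "R = max 1 ((2 * norm p + 2) / d)"
  define m where "m = norm ?n"
  define C where "C = 2 * (K * (norm v * (1 + m)) * (norm w * (1 + m))) + norm w * norm v * (K * m)"
  have "norm (dir_deriv w (dir_deriv v (\<lambda>u. f (?c u))) u) \<le> C" if R: "R \<le> norm (horizontal p u)" for u
  proof -
    \<comment> \<open>With this scale the coefficient of \<open>opposite_null p\<close> in the rescaled chart point is one.\<close>
    define k s where "k = norm (horizontal p u)" and "s = k\<^sup>2 / 2"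
    have k: "k \<ge> 1" "k \<ge> (2 * norm p + 2) / d" using R by (auto simp: k_def R_def)
    have s: "s > 0" using k(1) by (simp add: s_def)
    let ?q = "(1 / s) *\<^sub>R ?c u"
    have hc: "?q - ?n = (1 / s) *\<^sub>R p + (1 / s) *\<^sub>R (0, horizontal p u)"
    proof -
      have "horizontal p u \<bullet> horizontal p u / 2 = s" by (simp add: s_def k_def dot_square_norm)
      then show ?thesis using s by (simp add: parabolic_chart_def scaleR_add_right)
    qed
    have "norm (?q - ?n) \<le> (1 / s) * norm p + (1 / s) * k"
      unfolding hc by (rule order_trans[OF norm_triangle_ineq]) (use s in \<open>simp add: k_def norm_Pair\<close>)
    also have "\<dots> = (2 * norm p / k + 2) / k" using k(1) by (simp add: s_def field_simps power2_eq_square)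
    also have "\<dots> \<le> (2 * norm p + 2) / k"
      using k(1) by (intro divide_right_mono add_right_mono) (auto simp: divide_le_eq mult_le_cancel_left1)
    also have "\<dots> \<le> d" using k d(1) by (simp add: field_simps)
    finally have q: "?q \<in> cball ?n d" by (simp add: dist_norm norm_minus_commute)
    have F: "f (?c y) = s *\<^sub>R G ((1 / s) *\<^sub>R ?c y)" if "(1 / s) *\<^sub>R ?c y \<in> O'" for y
    proof -
      note cy = parabolic_chart_in_lightcone[OF p, of y]
      have "f ((1 / s) *\<^sub>R ?c y) = (1 / s) *\<^sub>R f (?c y)"
        by (rule cone_isometry_homogeneous[OF n f open_in_cone_lightcone open_in_cone_lightcone open_UNIV
          convex_UNIV _ cy])
           (use s in auto)
      then show ?thesis using G(4)[OF lightcone_scaleR[OF cy] that] s by simp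
    qed
    have hv: "horizontal p v = v" "horizontal p w = w" by (simp_all add: horizontal_id v w)
    have P: "norm (dir_deriv z ?c u) \<le> k * (norm z * (1 + m))" if z: "null_direction p \<bullet> z = 0" for z
    proof -
      have "norm (dir_deriv z ?c u) \<le> norm z + \<bar>horizontal p u \<bullet> z\<bar> * m"
        unfolding dir_deriv_parabolic_chart horizontal_id[OF z]
        by (rule order_trans[OF norm_triangle_ineq]) (simp add: norm_Pair m_def)
      also have "\<dots> \<le> k * norm z + (k * norm z) * m"
        using k(1) Cauchy_Schwarz_ineq2[of "horizontal p u" z]
        by (intro add_mono mult_right_mono) (auto simp: k_def m_def mult_le_cancel_right1)
      finally show ?thesis by (simp add: algebra_simps)
    qed
    let ?S = "\<Sum>b\<in>Basis. ((1 / s) * (dir_deriv v ?c u \<bullet> b)) *\<^sub>R dir_deriv (dir_deriv w ?c u) (dir_deriv b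
      G) ?q"
    have "norm ?S \<le> (\<Sum>b\<in>Basis. (1 / s) * (norm (dir_deriv v ?c u \<bullet> b) * norm (dir_deriv (dir_deriv w ?c u)
      (dir_deriv b G) ?q)))"
      by (rule order_trans[OF norm_sum]) (use s in \<open>simp add: abs_mult mult.assoc\<close>)
    also have "\<dots> = (1 / s) * (\<Sum>b\<in>Basis. norm (dir_deriv v ?c u \<bullet> b) * norm (dir_deriv (dir_deriv w ?c u)
      (dir_deriv b G) ?q))"
      by (simp add: sum_distrib_left)
    also have "\<dots> \<le> (1 / s) * (K * norm (dir_deriv v ?c u) * norm (dir_deriv w ?c u))"
      using d(5)[OF q] s by (intro mult_left_mono) auto
    also have "\<dots> \<le> (1 / s) * (K * (k * (norm v * (1 + m))) * (k * (norm w * (1 + m))))"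
      using P[OF v] P[OF w] d(3) s k(1) by (intro mult_left_mono mult_mono) (auto simp: m_def)
    also have "\<dots> = 2 * (K * (norm v * (1 + m)) * (norm w * (1 + m)))"
      using k(1) by (simp add: s_def power2_eq_square field_simps)
    finally have 1: "norm ?S \<le> 2 * (K * (norm v * (1 + m)) * (norm w * (1 + m)))" .
    have 2: "norm ((w \<bullet> v) *\<^sub>R dir_deriv ?n G ?q) \<le> norm w * norm v * (K * m)"
      using d(4)[OF q, of ?n] Cauchy_Schwarz_ineq2[of w v]
      by (simp add: m_def) (intro mult_mono; simp)
    have qO: "?q \<in> O'" using q d(2) by blast
    have eq: "dir_deriv w (dir_deriv v (\<lambda>u. f (?c u))) u = ?S + (w \<bullet> v) *\<^sub>R dir_deriv ?n G ?q"
      using second_derivative_rescaled[OF G(1,3) s F qO, of w v] by (simp only: hv)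
    show ?thesis
      unfolding eq C_def
      by (rule order_trans[OF norm_triangle_ineq]) (rule add_mono[OF 1 2])
  qed
  then show ?thesis by blast
qed

text \<open>
  By homogeneity the size of \<open>f\<close> is controlled by its minimum on the compact section of the cone at
  time one, and the time coordinate of the chart grows quadratically.
\<close>

lemma lift_norm_lower_bound:
  fixes f :: "'n::finite minkowski \<Rightarrow> 'n minkowski"
  assumes n: "2 \<le> CARD('n)" and f: "cone_isometry lightcone lightcone f" and p: "p \<in> lightcone"
  shows "\<exists>c>0. \<forall>u. c * (norm (horizontal p u))\<^sup>2 \<le> norm (f (parabolic_chart p u))"
proof -
  note D = cone_isometryD[OF f open_in_cone_lightcone open_in_cone_lightcone]
  let ?S = "sphere (0::real ^ 'n) 1"
  have S: "(1, x) \<in> lightcone" if "x \<in> ?S" for x using lightcone_ray[OF that, of 1] by simp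
  have "continuous_on ?S (\<lambda>x. norm (f (1, x)))"
    by (intro continuous_intros continuous_on_compose2[OF smooth_map_continuous_on[OF D(2)]]) (use S in auto)
  moreover have "?S \<noteq> {}" by simp
  ultimately obtain x0 where x0: "x0 \<in> ?S" "\<And>x. x \<in> ?S \<Longrightarrow> norm (f (1, x0)) \<le> norm (f (1, x))"
    using continuous_attains_inf[of ?S "\<lambda>x. norm (f (1, x))"] by auto
  define c where "c = norm (f (1, x0))"
  have c: "c > 0" using lightconeD(4)[OF D(5)[OF S[OF x0(1)]]] by (auto simp: c_def)
  have r: "fst p > 0" by (rule lightconeD(1)[OF p])
  have "c / (4 * fst p) * (norm (horizontal p u))\<^sup>2 \<le> norm (f (parabolic_chart p u))" for u
  proof -
    let ?y = "parabolic_chart p u"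
    note y = parabolic_chart_in_lightcone[OF p, of u]
    note y' = lightconeD(1)[OF y] null_direction_sphere[OF y]
    have "f ?y = f (fst ?y *\<^sub>R (1, null_direction ?y))" using lightcone_ray_eq[OF y] by simp
    also have "\<dots> = fst ?y *\<^sub>R f (1, null_direction ?y)"
      by (rule cone_isometry_homogeneous[OF n f open_in_cone_lightcone open_in_cone_lightcone open_UNIV
        convex_UNIV])
         (use y' S in auto)
    finally have "norm (f ?y) = fst ?y * norm (f (1, null_direction ?y))" using y'(1) by simp
    also have "\<dots> \<ge> fst ?y * c" using x0(2)[OF y'(2)] y'(1) by (simp add: c_def)
    also have "fst ?y \<ge> (norm (horizontal p u))\<^sup>2 / (4 * fst p)"
      using r by (simp add: parabolic_chart_def opposite_null_def dot_square_norm field_simps)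
    then have "fst ?y * c \<ge> (norm (horizontal p u))\<^sup>2 / (4 * fst p) * c"
      by (rule mult_right_mono) (use c in simp)
    finally show ?thesis by (simp add: mult.commute)
  qed
  then show ?thesis using c r by (intro exI[of _ "c / (4 * fst p)"]) auto
qed

text \<open>
  A bounded numerator over a quadratically growing denominator.
\<close>

lemma second_derivative_negligible:
  fixes f :: "'n::finite minkowski \<Rightarrow> 'n minkowski"
  assumes n: "2 \<le> CARD('n)" and f: "cone_isometry lightcone lightcone f" and p: "p \<in> lightcone"
    and e: "null_direction p \<bullet> e = 0" "null_direction p \<bullet> l = 0" "e \<bullet> e = 1" "l \<bullet> l = 1" "e \<bullet> l = 0"
    and v: "null_direction p \<bullet> v = 0" and w: "null_direction p \<bullet> w = 0"
  shows "((\<lambda>z. dir_deriv w (dir_deriv v (\<lambda>u. f (parabolic_chart p u))) (u + Re z *\<^sub>R e + Im z *\<^sub>R l) /\<^sub>R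
        norm (f (parabolic_chart p (u + Re z *\<^sub>R e + Im z *\<^sub>R l)))) \<longlongrightarrow> 0) at_infinity"
    (is "((\<lambda>z. ?D (?p z) /\<^sub>R norm (?F (?p z))) \<longlongrightarrow> 0) at_infinity")
proof -
  obtain C R where C: "\<And>u. R \<le> norm (horizontal p u) \<Longrightarrow> norm (?D u) \<le> C"
    using second_derivative_bounded[OF n f p v w] by blast
  obtain c where c: "c > 0" "\<And>u. c * (norm (horizontal p u))\<^sup>2 \<le> norm (?F u)"
    using lift_norm_lower_bound[OF n f p] by blast
  define k where "k = norm (horizontal p u)"
  have hz: "norm (horizontal p (?p z)) \<ge> norm z - k" for z
  proof -
    have "horizontal p (?p z) = horizontal p u + (Re z *\<^sub>R e + Im z *\<^sub>R l)"
      by (simp add: linear_add[OF linear_horizontal] linear_cmul[OF linear_horizontal]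
        horizontal_id e add.assoc)
    moreover have "norm (Re z *\<^sub>R e + Im z *\<^sub>R l) = norm z"
      unfolding norm_eq_sqrt_inner[of "Re z *\<^sub>R e + Im z *\<^sub>R l"] cmod_def using e inner_commute[of l e]
      by (simp add: inner_add_left inner_add_right power2_eq_square)
    ultimately show ?thesis
      using norm_triangle_ineq2[of "Re z *\<^sub>R e + Im z *\<^sub>R l" "- horizontal p u"]
      by (simp add: k_def add.commute)
  qed
  have "eventually (\<lambda>z::complex. norm z \<ge> max (R + k) (k + 1)) at_infinity"
    unfolding eventually_at_infinity by blast
  then have ev: "eventually (\<lambda>z::complex. norm (?D (?p z) /\<^sub>R norm (?F (?p z))) \<le> C / (c * (norm z - k)))
    at_infinity"
  proof eventually_elim
    case (elim z)
    define h where "h = norm (horizontal p (?p z))"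
    have h: "h \<ge> norm z - k" "h \<ge> 1" "h \<ge> R" using hz[of z] elim by (auto simp: h_def)
    have D: "norm (?D (?p z)) \<le> C" using C h(3) by (simp add: h_def)
    then have C0: "C \<ge> 0" using norm_ge_zero order_trans by blast
    have "c * (norm z - k) \<le> c * h" using h c by simp
    also have "\<dots> \<le> c * h\<^sup>2" using h c by (simp add: power2_eq_square)
    also have "\<dots> \<le> norm (?F (?p z))" using c(2) by (simp add: h_def)
    finally have F: "c * (norm z - k) \<le> norm (?F (?p z))" .
    have pos: "c * (norm z - k) > 0" using elim c by simp
    have "norm (?D (?p z) /\<^sub>R norm (?F (?p z))) = norm (?D (?p z)) / norm (?F (?p z))"
      by (simp add: divide_inverse mult.commute)
    also have "\<dots> \<le> C / (c * (norm z - k))" by (rule frac_le[OF C0 D pos F])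
    finally show ?case .
  qed
  have "((\<lambda>z::complex. C / (c * (norm z - k))) \<longlongrightarrow> 0) at_infinity"
  proof (rule tendsto_divide_0[OF tendsto_const filterlim_at_top_imp_at_infinity])
    show "filterlim (\<lambda>z::complex. c * (norm z - k)) at_top at_infinity"
      by (rule filterlim_tendsto_pos_mult_at_top[OF tendsto_const c(1)])
         (use filterlim_tendsto_add_at_top[OF tendsto_const[of "- k"] filterlim_norm_at_top] in simp)
  qed
  then show ?thesis by (rule Lim_null_comparison[OF ev])
qed

text \<open>
  An isometry of the whole cone is defined on the whole paraboloid of every chart, so that the
  argument with entire functions applies to each orthonormal pair of horizontal directions, in
  every dimension from three on.
\<close>

theorem global_rigidity:
  fixes f :: "'n::finite minkowski \<Rightarrow> 'n minkowski"
  assumes n: "3 \<le> CARD('n)" and f: "cone_isometry lightcone lightcone f"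
  shows "\<exists>A\<in>O_plus. \<forall>p\<in>lightcone. f p = A p"
proof (rule lorentz_locally_imp_globally[OF _ open_in_cone_lightcone])
  note o = open_in_cone_lightcone
  have n2: "2 \<le> CARD('n)" using n by simp
  show "2 \<le> CARD('n)" by fact
  have "(lightcone :: 'n minkowski set) = (\<lambda>(t, x). t *\<^sub>R (1, x)) ` ({0<..} \<times> sphere 0 1)"
  proof (intro equalityI subsetI)
    fix p :: "'n minkowski" assume p: "p \<in> lightcone"
    show "p \<in> (\<lambda>(t, x). t *\<^sub>R (1, x)) ` ({0<..} \<times> sphere 0 1)"
      using lightconeD(1)[OF p] null_direction_sphere[OF p] lightcone_ray_eq[OF p]
      by (intro image_eqI[of _ _ "(fst p, null_direction p)"]) auto
  next
    fix p :: "'n minkowski" assume "p \<in> (\<lambda>(t, x). t *\<^sub>R (1, x)) ` ({0<..} \<times> sphere 0 1)"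
    then obtain t x where tx: "x \<in> sphere 0 1" "t > 0" "p = t *\<^sub>R (1, x)"
      by (elim imageE SigmaE) (simp only: split_conv greaterThan_iff)
    show "p \<in> lightcone" unfolding tx(3) by (rule lightcone_ray[OF tx(1,2)])
  qed
  moreover have "connected ((\<lambda>(t, x). t *\<^sub>R (1::real, x)) ` ({0<..} \<times> sphere (0::real ^ 'n) 1))"
    by (intro connected_continuous_image connected_Times connected_sphere)
       (use n in \<open>auto intro!: continuous_intros simp: case_prod_unfold\<close>)
  ultimately show "connected (lightcone :: 'n minkowski set)" by simp
  fix p :: "'n minkowski" assume p: "p \<in> lightcone"
  have cU: "parabolic_chart p ` UNIV \<subseteq> lightcone" using parabolic_chart_in_lightcone[OF p] by blast
  let ?F = "\<lambda>u. f (parabolic_chart p u)" and ?x = "null_direction p"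
  interpret flat_null_lift UNIV "{v. ?x \<bullet> v = 0}" ?F
    by (rule cone_chart_lift[OF f o o p open_UNIV cU])
  have unit: "dir_deriv l (dir_deriv e ?F) u = 0"
    if e: "?x \<bullet> e = 0" "?x \<bullet> l = 0" "e \<bullet> e = 1" "l \<bullet> l = 1" "e \<bullet> l = 0" for e l u
  proof (rule second_orthogonal_vanishes_entire)
    note neg = second_derivative_negligible[OF n2 f p e]
    show "((\<lambda>z. dir_deriv l (dir_deriv e ?F) (u + Re z *\<^sub>R e + Im z *\<^sub>R l) /\<^sub>R norm (?F (u + Re z *\<^sub>R e
      + Im z *\<^sub>R l))) \<longlongrightarrow> 0) at_infinity"
      by (rule neg[OF e(1,2)])
    show "((\<lambda>z. (dir_deriv e (dir_deriv e ?F) (u + Re z *\<^sub>R e + Im z *\<^sub>R l) -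
          dir_deriv l (dir_deriv l ?F) (u + Re z *\<^sub>R e + Im z *\<^sub>R l)) /\<^sub>R
        norm (?F (u + Re z *\<^sub>R e + Im z *\<^sub>R l))) \<longlongrightarrow> 0) at_infinity"
      using tendsto_diff[OF neg[OF e(1,1)] neg[OF e(2,2)]] by (simp add: scaleR_diff_right)
  qed (use e in auto)
  show "\<exists>A\<in>O_plus. \<exists>G. open G \<and> p \<in> G \<and> (\<forall>y\<in>G \<inter> lightcone. f y = A y)"
  proof (rule umbilic_lift_lorentz[OF n f o o p UNIV_I open_UNIV convex_UNIV _ open_UNIV convex_UNIV])
    fix u v w :: "real ^ 'n" assume *: "?x \<bullet> v = 0" "?x \<bullet> w = 0" "v \<bullet> w = 0"
    show "dir_deriv w (dir_deriv v ?F) u = 0"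
    proof (cases "v = 0 \<or> w = 0")
      case True
      have "dir_deriv 0 G y = 0" if "G differentiable (at y)" for G :: "real ^ 'n \<Rightarrow> 'n minkowski" and y
        by (rule linear_0[OF dir_deriv_linear[OF that]])
      then have "dir_deriv 0 ?F = (\<lambda>y. 0)" "\<And>v. dir_deriv 0 (dir_deriv v ?F) u = 0"
        using smooth_onD(1)[OF smoothF] smooth_onD(1)[OF smooth1] by (auto simp: fun_eq_iff)
      then show ?thesis using True by auto
    next
      case False
      define e l where "e = v /\<^sub>R norm v" and "l = w /\<^sub>R norm w"
      have vw: "v = norm v *\<^sub>R e" "w = norm w *\<^sub>R l" using False by (simp_all add: e_def l_def)
      have "dir_deriv l (dir_deriv e ?F) u = 0"
        by (rule unit) (use * False in \<open>simp_all add: e_def l_def dot_square_norm power2_eq_square\<close>)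
      moreover have "dir_deriv v ?F = (\<lambda>y. norm v *\<^sub>R dir_deriv e ?F y)"
      proof
        fix y
        show "dir_deriv v ?F y = norm v *\<^sub>R dir_deriv e ?F y"
          by (subst vw(1)) (rule linear_cmul[OF dir_deriv_linear[OF smooth_onD(1)[OF smoothF]]], simp)
      qed
      moreover have "dir_deriv w (\<lambda>y. norm v *\<^sub>R dir_deriv e ?F y) u
        = norm v *\<^sub>R dir_deriv w (dir_deriv e ?F) u"
        by (rule dir_deriv_eqI) (intro has_derivative_scaleR_right has_derivative_dir_deriv
          smooth_onD(1)[OF smooth1] UNIV_I)
      moreover have "dir_deriv w (dir_deriv e ?F) u = norm w *\<^sub>R dir_deriv l (dir_deriv e ?F) u"
        by (subst vw(2)) (rule linear_cmul[OF dir_deriv_linear[OF smooth_onD(1)[OF smooth1]]], simp)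
      ultimately show ?thesis by simp
    qed
  qed (use cU in auto)
qed

section \<open>The conformal map induced by an isometry\<close>

lemma smooth_map_local:
  assumes "\<And>x. x \<in> M \<Longrightarrow> \<exists>W. open W \<and> x \<in> W \<and> smooth_map (M \<inter> W) f"
  shows "smooth_map M f"
proof (rule smooth_mapI)
  fix p assume p: "p \<in> M"
  obtain W where W: "open W" "p \<in> W" "smooth_map (M \<inter> W) f" using assms[OF p] by blast
  have "p \<in> M \<inter> W" using p W(2) by simp
  then obtain V F where V: "open V" "p \<in> V" "smooth_on V F" "\<And>x. x \<in> M \<inter> W \<Longrightarrow> x \<in> V \<Longrightarrow> f x = F x"
    using smooth_mapE[OF W(3)] by metis
  show "\<exists>W F. open W \<and> p \<in> W \<and> smooth_on W F \<and> (\<forall>x\<in>M \<inter> W. f x = F x)"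
    by (rule exI[of _ "V \<inter> W"], rule exI[of _ F])
       (use V W in \<open>auto intro: smooth_on_subset[OF V(3)]\<close>)
qed

lemma smooth_map_Pair:
  assumes "smooth_map M f" "smooth_map M g" shows "smooth_map M (\<lambda>x. (f x, g x))"
proof (rule smooth_mapI)
  fix p assume p: "p \<in> M"
  obtain V F where V: "open V" "p \<in> V" "smooth_on V F" "\<And>x. x \<in> M \<Longrightarrow> x \<in> V \<Longrightarrow> f x = F x"
    using smooth_mapE[OF assms(1) p] by metis
  obtain W G where W: "open W" "p \<in> W" "smooth_on W G" "\<And>x. x \<in> M \<Longrightarrow> x \<in> W \<Longrightarrow> g x = G x"
    using smooth_mapE[OF assms(2) p] by metis
  show "\<exists>W F. open W \<and> p \<in> W \<and> smooth_on W F \<and> (\<forall>x\<in>M \<inter> W. (f x, g x) = F x)"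
    by (rule exI[of _ "V \<inter> W"], rule exI[of _ "\<lambda>x. (F x, G x)"])
       (use V W in \<open>auto intro!: smooth_on_Pair smooth_on_subset[OF V(3)] smooth_on_subset[OF W(3)]\<close>)
qed

lemma differential_restrict:
  assumes f: "smooth_map M f" and N: "N \<subseteq> M" "\<And>x. x \<in> N \<Longrightarrow> g x = f x" and p: "p \<in> N" and v:
    "v \<in> tangent_space N p"
  shows "differential N g p v = differential M f p v"
proof -
  obtain e c where c: "e > 0" "\<And>s. \<bar>s\<bar> < e \<Longrightarrow> c s \<in> N" "c 0 = p"
    "(c has_vector_derivative v) (at (0::real))"
    using tangent_spaceE[OF v] by metis
  have g: "smooth_map N g" by (rule smooth_map_restrict[OF f N(1)]) (simp add: N(2))
  have 1: "((\<lambda>s. g (c s)) has_vector_derivative differential N g p v) (at 0)"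
    by (rule differential_curve[OF g c])
  have "((\<lambda>s. f (c s)) has_vector_derivative differential M f p v) (at 0)"
    by (rule differential_curve[OF f c(1) _ c(3,4)]) (use c(2) N(1) in blast)
  then have "((\<lambda>s. g (c s)) has_vector_derivative differential M f p v) (at 0)"
    by (rule has_vector_derivative_transform_within[OF _ c(1)]) (use N(2) c(2) in auto)
  with 1 show ?thesis by (rule vector_derivative_unique_at)
qed

lemma smooth_map_null_direction: "U \<subseteq> lightcone \<Longrightarrow> smooth_map U null_direction"
  by (rule smooth_map_of_smooth_on[OF open_fst_pos smooth_on_null_direction]) (use lightconeD(1) in auto)

lemma continuous_on_null_direction: "U \<subseteq> lightcone \<Longrightarrow> continuous_on U null_direction"
  by (rule smooth_map_continuous_on[OF smooth_map_null_direction])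

lemma null_direction_derivative_tangent:
  assumes "p \<in> lightcone" "mink p a = 0"
  shows "null_direction p \<bullet> dir_deriv a null_direction p = 0"
proof -
  note P = lightconeD[OF assms(1)]
  have "snd p \<bullet> snd a = fst p * fst a" using assms(2) by (simp add: mink_def)
  then show ?thesis using P(1)
    by (simp add: dir_deriv_null_direction[OF P(1)] null_direction_def inner_diff_right P(5) divide_inverse)
qed

text \<open>
  If a map of the cone covers a map \<open>\<phi>\<close> of the directions, then differentiating
  \<open>null_direction \<circ> F = \<phi> \<circ> null_direction\<close> along a curve and measuring on the sphere compares the
  metric pulled back by \<open>F\<close> with the one pulled back by \<open>\<phi>\<close>. Read in one direction, this computes
  the conformal factor of \<open>\<phi>\<close> when \<open>F\<close> is an isometry; in the other, it shows that \<open>F\<close> is an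
  isometry when its time coordinate is chosen accordingly.
\<close>

lemma semiconjugacy_conformal:
  assumes F: "smooth_map U F" "F ` U \<subseteq> V" and U: "open_in_cone U" "open_in_cone V"
    and \<phi>: "smooth_map (null_direction ` U) \<phi>" "induces U F \<phi>"
    and p: "p \<in> U" and a: "mink p a = 0" and b: "mink p b = 0"
  shows "mink (differential U F p a) (differential U F p b) / (fst (F p))\<^sup>2 =
    differential (null_direction ` U) \<phi> (null_direction p) (dir_deriv a null_direction p) \<bullet>
    differential (null_direction ` U) \<phi> (null_direction p) (dir_deriv b null_direction p)"
proof -
  have Fp: "F p \<in> V" "F p \<in> lightcone" using F(2) p open_in_coneD[OF U(2)] by blast+
  have pl: "p \<in> lightcone" by (rule open_in_coneD[OF U(1) p])
  let ?\<Omega> = "null_direction ` U"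
  have chain: "dir_deriv (differential U F p a) null_direction (F p)
      = differential ?\<Omega> \<phi> (null_direction p) (dir_deriv a null_direction p)"
    and tan: "mink (F p) (differential U F p a) = 0" if a: "mink p a = 0" for a
  proof -
    have aT: "a \<in> tangent_space U p" using a tangent_space_open_in_cone[OF U(1) p] by simp
    then obtain e c where c: "e > 0" "\<And>s. \<bar>s\<bar> < e \<Longrightarrow> c s \<in> U" "c 0 = p"
        "(c has_vector_derivative a) (at (0::real))"
      using tangent_spaceE by metis
    have 1: "((\<lambda>s. F (c s)) has_vector_derivative differential U F p a) (at 0)"
      by (rule differential_curve[OF F(1) c])
    have 2: "((\<lambda>s. null_direction (F (c s))) has_vector_derivative
        dir_deriv (differential U F p a) null_direction (F (c 0))) (at 0)"
      by (rule dir_deriv_curve[OF null_direction_differentiable 1]) (use lightconeD(1)[OF Fp(2)] c(3) in simp)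
    have 3: "((\<lambda>s. null_direction (c s)) has_vector_derivative dir_deriv a null_direction (c 0)) (at 0)"
      by (rule dir_deriv_curve[OF null_direction_differentiable c(4)]) (use lightconeD(1)[OF pl] c(3) in simp)
    have "((\<lambda>s. \<phi> (null_direction (c s))) has_vector_derivative
        differential ?\<Omega> \<phi> (null_direction p) (dir_deriv a null_direction (c 0))) (at 0)"
      by (rule differential_curve[OF \<phi>(1) c(1) _ _ 3]) (use c in auto)
    then have "((\<lambda>s. null_direction (F (c s))) has_vector_derivative
        differential ?\<Omega> \<phi> (null_direction p) (dir_deriv a null_direction (c 0))) (at 0)"
      by (rule has_vector_derivative_transform_within[OF _ c(1)]) (use \<phi>(2) c(2) in \<open>auto simp: induces_def\<close>)
    with 2 show "dir_deriv (differential U F p a) null_direction (F p)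
      = differential ?\<Omega> \<phi> (null_direction p) (dir_deriv a null_direction p)"
      unfolding c(3) by (rule vector_derivative_unique_at)
    show "mink (F p) (differential U F p a) = 0"
      using differential_in_tangent_space[OF F p aT] tangent_space_open_in_cone[OF U(2) Fp(1)] by simp
  qed
  show ?thesis
    using null_direction_conformal[OF Fp(2) tan[OF a] tan[OF b]] chain[OF a] chain[OF b] by simp
qed

lemma openin_null_direction_image:
  fixes U :: "'n::finite minkowski set"
  assumes "open_in_cone U" shows "openin (top_of_set (sphere 0 1)) (null_direction ` U)"
proof -
  obtain O' where O': "open O'" "U = lightcone \<inter> O'" using assms by (auto simp: open_in_cone_def openin_open)
  have "null_direction ` U = sphere 0 1 \<inter> (\<Union>t\<in>{0<..}. (\<lambda>x. t *\<^sub>R (1, x)) -` O')"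
  proof (intro equalityI subsetI)
    fix x assume "x \<in> null_direction ` U"
    then obtain p where p: "p \<in> U" "x = null_direction p" by blast
    then have pl: "p \<in> lightcone" and "p \<in> O'" using O'(2) by auto
    then have "fst p *\<^sub>R (1, x) \<in> O'" using lightcone_ray_eq[OF pl] p(2) by simp
    then show "x \<in> sphere 0 1 \<inter> (\<Union>t\<in>{0<..}. (\<lambda>x. t *\<^sub>R (1, x)) -` O')"
      using lightconeD(1)[OF pl] null_direction_sphere[OF pl] p(2) by (simp del: scaleR_Pair) blast
  next
    fix x assume "x \<in> sphere 0 1 \<inter> (\<Union>t\<in>{0<..}. (\<lambda>x. t *\<^sub>R (1::real, x)) -` O')"
    then obtain t where t: "t > 0" "x \<in> sphere 0 1" "t *\<^sub>R (1, x) \<in> O'" by blast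
    then have "t *\<^sub>R (1, x) \<in> U" using lightcone_ray[OF t(2,1)] O'(2) by simp
    moreover have "null_direction (t *\<^sub>R (1, x)) = x" using t(1) by (intro null_direction_ray) simp
    ultimately show "x \<in> null_direction ` U" by (metis imageI)
  qed
  moreover have "open (\<Union>t\<in>{0<..}. (\<lambda>x::real ^ 'n. t *\<^sub>R (1::real, x)) -` O')"
    by (intro open_UN ballI open_vimage O' continuous_intros)
  ultimately show ?thesis by (auto simp: openin_open)
qed

text \<open>
  The tangent vector \<open>v\<close> of the sphere is the projection of the horizontal vector \<open>p\<^sub>0 v\<close> at \<open>p\<close>,
  whose squared norm is \<open>p\<^sub>0\<^sup>2 |v|\<^sup>2\<close>.
\<close>

lemma isometry_direction_factor:
  assumes f: "cone_isometry U V f" "open_in_cone U" "open_in_cone V"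
    and \<phi>: "smooth_map (null_direction ` U) \<phi>" "induces U f \<phi>"
    and p: "p \<in> U" and v: "null_direction p \<bullet> v = 0" and w: "null_direction p \<bullet> w = 0"
  shows "differential (null_direction ` U) \<phi> (null_direction p) v \<bullet>
    differential (null_direction ` U) \<phi> (null_direction p) w = (fst p / fst (f p))\<^sup>2 * (v \<bullet> w)"
proof -
  note D = cone_isometryD[OF f]
  note P = lightconeD(1)[OF open_in_coneD[OF f(2) p]]
  have d: "dir_deriv (0, fst p *\<^sub>R v) null_direction p = v" for v
    using P by (simp add: dir_deriv_null_direction)
  have t: "mink p (0, fst p *\<^sub>R v) = 0" if "null_direction p \<bullet> v = 0" for v
    using that P by (simp add: mink_def null_direction_def)
  show ?thesis
    using semiconjugacy_conformal[OF D(2) equalityD1[OF D(3)] f(2,3) \<phi> p t[OF v] t[OF w]]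
      D(6)[OF p t[OF v] t[OF w]]
    by (simp add: d mink_horizontal power2_eq_square)
qed

lemma isometry_direction_locally_constant:
  assumes f: "cone_isometry U V f" "open_in_cone U" "open_in_cone V"
    and B: "convex B" "B \<inter> lightcone \<subseteq> U"
    and q: "q \<in> lightcone" "q \<in> B" "r \<in> lightcone" "r \<in> B" "null_direction q = null_direction r"
  shows "null_direction (f q) = null_direction (f r)"
proof -
  have "snd r = fst r *\<^sub>R null_direction r" "snd q = fst q *\<^sub>R null_direction q"
    using lightconeD(1)[OF q(1)] lightconeD(1)[OF q(3)] by (simp_all add: null_direction_def)
  then have r: "r = (fst r / fst q) *\<^sub>R q"
    using lightconeD(1)[OF q(1)] q(5) by (simp add: prod_eq_iff)
  have "null_direction (f ((fst r / fst q) *\<^sub>R q)) = null_direction (f q)"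
    by (rule cone_isometry_ray_direction[OF f B q(1,2)])
       (use r q(4) lightconeD(1)[OF q(1)] lightconeD(1)[OF q(3)] in auto)
  then show ?thesis using r by simp
qed

lemma open_in_cone_ball:
  assumes "open_in_cone U" "p \<in> U"
  obtains d where "d > 0" "ball p d \<inter> lightcone \<subseteq> U"
proof -
  obtain O' where O': "open O'" "U = lightcone \<inter> O'" using assms(1)
    by (auto simp: open_in_cone_def openin_open)
  then obtain d where "d > 0" "ball p d \<subseteq> O'" using assms(2) openE by (metis IntD2)
  then show ?thesis using that O'(2) by blast
qed

text \<open>
  The direction of \<open>f\<close> is locally constant along a half-line, and the part of the half-line inside
  \<open>U\<close> is connected.
\<close>

lemma isometry_direction_fiber:
  assumes f: "cone_isometry U V f" "open_in_cone U" "open_in_cone V" and U: "null_connected U"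
    and p: "p \<in> U" "q \<in> U" "null_direction p = null_direction q"
  shows "null_direction (f p) = null_direction (f q)"
proof (rule connected_local_const[where f = "\<lambda>p. null_direction (f p)" and A =
  "{r \<in> U. null_direction r = null_direction q}"])
  show "connected {r \<in> U. null_direction r = null_direction q}" using U by (simp add: null_connected_def)
  show "\<forall>a\<in>{r \<in> U. null_direction r = null_direction q}.
      \<forall>\<^sub>F b in at a within {r \<in> U. null_direction r = null_direction q}. null_direction (f a)
        = null_direction (f b)"
  proof
    fix a assume a: "a \<in> {r \<in> U. null_direction r = null_direction q}"
    then obtain d where d: "d > 0" "ball a d \<inter> lightcone \<subseteq> U" using open_in_cone_ball[OF f(2)] by blast
    have "null_direction (f a) = null_direction (f b)"
      if "b \<in> ball a d" "b \<in> U" "null_direction b = null_direction q" for b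
      by (rule isometry_direction_locally_constant[OF f convex_ball d(2)])
         (use a that d(1) open_in_coneD[OF f(2)] in auto)
    then show "\<forall>\<^sub>F b in at a within {r \<in> U. null_direction r = null_direction q}. null_direction (f a)
      = null_direction (f b)"
      unfolding eventually_at_topological using d(1) by (intro exI[of _ "ball a d"]) auto
  qed
qed (use p in auto)

definition induced_map :: "'n::finite minkowski set \<Rightarrow> ('n minkowski \<Rightarrow> 'n minkowski) \<Rightarrow> real ^ 'n \<Rightarrow> real ^
  'n" where
  "induced_map U f = (\<lambda>x\<in>null_direction ` U. null_direction (f (inv_into U null_direction x)))"

lemma induces_induced_map:
  assumes f: "cone_isometry U V f" "open_in_cone U" "open_in_cone V" and U: "null_connected U"
  shows "induces U f (induced_map U f)"
  unfolding induces_def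
proof
  fix p assume p: "p \<in> U"
  note inv = inv_into_into[OF imageI[OF p]] f_inv_into_f[OF imageI[OF p]]
  show "induced_map U f (null_direction p) = null_direction (f p)"
    unfolding induced_map_def restrict_apply'[OF imageI[OF p]]
    by (rule isometry_direction_fiber[OF assms inv(1) p inv(2)])
qed

text \<open>
  Near a direction, the induced map is the composition of \<open>f\<close> with a section of the cone at
  constant time.
\<close>

lemma smooth_map_induced:
  assumes f: "cone_isometry U V f" "open_in_cone U" "open_in_cone V" and \<phi>: "induces U f \<phi>"
  shows "smooth_map (null_direction ` U) \<phi>"
proof (rule smooth_map_local)
  note D = cone_isometryD[OF f]
  fix x assume "x \<in> null_direction ` U"
  then obtain p where p: "p \<in> U" "x = null_direction p" by blast
  obtain O' where O': "open O'" "U = lightcone \<inter> O'" using f(2) by (auto simp: open_in_cone_def openin_open)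
  note pl = open_in_coneD[OF f(2) p(1)]
  define t where "t = fst p"
  have t: "t > 0" using lightconeD(1)[OF pl] by (simp add: t_def)
  let ?r = "\<lambda>x. t *\<^sub>R (1::real, x)"
  define W where "W = ?r -` O'"
  have W: "open W" unfolding W_def by (intro open_vimage O' continuous_intros)
  have xW: "x \<in> W" using lightcone_ray_eq[OF pl] p O'(2) by (simp add: W_def t_def)
  have \<Omega>: "null_direction ` U \<subseteq> sphere 0 1" using openin_imp_subset[OF openin_null_direction_image[OF f(2)]] .
  let ?M = "null_direction ` U \<inter> W"
  have rU: "?r y \<in> U" if "y \<in> ?M" for y
    using that lightcone_ray[of y t] \<Omega> t O'(2) by (auto simp: W_def simp del: scaleR_Pair)
  have "smooth_map ?M ?r"
    by (rule smooth_map_of_smooth_on[OF open_UNIV]) (auto intro!: smooth_intros simp del: scaleR_Pair)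
  then have "smooth_map ?M (\<lambda>y. f (?r y))" by (rule smooth_map_compose[OF _ D(2)]) (use rU in blast)
  then have "smooth_map ?M (\<lambda>y. null_direction (f (?r y)))"
    by (rule smooth_map_compose[OF _ smooth_map_null_direction[OF order_refl]]) (use rU D(5) in blast)
  then have "smooth_map ?M \<phi>"
  proof (rule smooth_map_cong)
    fix y assume y: "y \<in> ?M"
    have "null_direction (?r y) = y" using t by (intro null_direction_ray) simp
    then show "null_direction (f (?r y)) = \<phi> y" using \<phi> rU[OF y] unfolding induces_def by metis
  qed
  then show "\<exists>W. open W \<and> x \<in> W \<and> smooth_map (null_direction ` U \<inter> W) \<phi>" using W xW by blast
qed

text \<open>
  The inverse isometry induces the inverse map; this is where the target has to be null-connected.
\<close>

lemma sphere_conformal_induced_map: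
  fixes f :: "'n::finite minkowski \<Rightarrow> 'n minkowski"
  assumes f: "cone_isometry U V f" "open_in_cone U" "open_in_cone V" and U: "null_connected U"
    "null_connected V"
  shows "sphere_conformal (null_direction ` U) (null_direction ` V) (induced_map U f)"
proof -
  note D = cone_isometryD[OF f]
  note i = induces_induced_map[OF f U(1)]
  note g = cone_isometry_inverse[OF f(1)] f(3,2)
  note j = induces_induced_map[OF g U(2)]
  let ?\<phi> = "induced_map U f" and ?\<psi> = "induced_map V (inv_into U f)" and ?\<Omega> = "null_direction ` U"
  note s = smooth_map_induced[OF f i]
  have 1: "?\<phi> (null_direction p) \<in> null_direction ` V \<and> ?\<psi> (?\<phi> (null_direction p)) = null_direction p"
    if "p \<in> U" for p
  proof -
    have fp: "f p \<in> V" using D(3) that by blast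
    moreover have "?\<phi> (null_direction p) = null_direction (f p)" using i that by (simp add: induces_def)
    moreover have "?\<psi> (null_direction (f p)) = null_direction p"
      using j fp diffeomorphismD(7)[OF D(1) that] by (simp add: induces_def)
    ultimately show ?thesis by simp
  qed
  have 2: "?\<psi> (null_direction q) \<in> ?\<Omega> \<and> ?\<phi> (?\<psi> (null_direction q)) = null_direction q" if "q \<in> V" for q
  proof -
    have gq: "inv_into U f q \<in> U" using diffeomorphismD(6)[OF D(1)] that by blast
    moreover have "?\<psi> (null_direction q) = null_direction (inv_into U f q)" using j that
      by (simp add: induces_def)
    moreover have "?\<phi> (null_direction (inv_into U f q)) = null_direction q"
      using i gq diffeomorphismD(8)[OF D(1) that] by (simp add: induces_def)
    ultimately show ?thesis by simp
  qed
  have d: "diffeomorphism ?\<Omega> (null_direction ` V) ?\<phi>"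
    by (rule diffeomorphismI[OF s smooth_map_induced[OF g j]]) (use 1 2 in auto)
  define \<mu> where "\<mu> = (\<lambda>x. (fst (inv_into U null_direction x) / fst (f (inv_into U null_direction x)))\<^sup>2)"
  have "\<forall>x\<in>?\<Omega>. 0 < \<mu> x \<and> (\<forall>v\<in>tangent_space ?\<Omega> x. \<forall>w\<in>tangent_space ?\<Omega> x.
      pullback ?\<Omega> ?\<phi> (\<lambda>_. inner) x v w = \<mu> x * (v \<bullet> w))"
  proof
    fix x assume x: "x \<in> ?\<Omega>"
    define p where "p = inv_into U null_direction x"
    have p: "p \<in> U" "null_direction p = x" using x unfolding p_def by (auto intro: inv_into_into f_inv_into_f)
    have pos: "0 < \<mu> x"
      using lightconeD(1)[OF open_in_coneD[OF f(2) p(1)]] lightconeD(1)[OF D(5)[OF p(1)]]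
        by (simp add: \<mu>_def p_def)
    have T: "tangent_space ?\<Omega> x = {v. x \<bullet> v = 0}"
      by (rule tangent_space_open_in_sphere[OF openin_null_direction_image[OF f(2)] x])
    show "0 < \<mu> x \<and> (\<forall>v\<in>tangent_space ?\<Omega> x. \<forall>w\<in>tangent_space ?\<Omega> x.
      pullback ?\<Omega> ?\<phi> (\<lambda>_. inner) x v w = \<mu> x * (v \<bullet> w))"
      using pos isometry_direction_factor[OF f s i p(1)] p(2)
      by (auto simp: T pullback_def Let_def \<mu>_def p_def)
  qed
  then show ?thesis using d unfolding sphere_conformal_def conformal_between_def by blast
qed

section \<open>The isometry lifting a conformal map\<close>

lemma sphere_conformalE:
  assumes "sphere_conformal \<Omega> \<Omega>' \<phi>" "openin (top_of_set (sphere 0 1)) \<Omega>"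
  obtains \<mu> where "diffeomorphism \<Omega> \<Omega>' \<phi>" "\<And>x. x \<in> \<Omega> \<Longrightarrow> \<mu> x > 0"
    "\<And>x v w. x \<in> \<Omega> \<Longrightarrow> x \<bullet> v = 0 \<Longrightarrow> x \<bullet> w = 0 \<Longrightarrow>
      differential \<Omega> \<phi> x v \<bullet> differential \<Omega> \<phi> x w = \<mu> x * (v \<bullet> w)"
proof -
  obtain \<mu> where \<mu>: "\<forall>p\<in>\<Omega>. 0 < \<mu> p \<and> (\<forall>v\<in>tangent_space \<Omega> p. \<forall>w\<in>tangent_space \<Omega> p.
      pullback \<Omega> \<phi> (\<lambda>_. inner) p v w = \<mu> p * (v \<bullet> w))" and d: "diffeomorphism \<Omega> \<Omega>' \<phi>"
    using assms(1) unfolding sphere_conformal_def conformal_between_def by blast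
  show ?thesis
  proof (rule that[OF d])
    show "\<mu> x > 0" if "x \<in> \<Omega>" for x using \<mu> that by blast
    show "differential \<Omega> \<phi> x v \<bullet> differential \<Omega> \<phi> x w = \<mu> x * (v \<bullet> w)"
      if x: "x \<in> \<Omega>" and "x \<bullet> v = 0" "x \<bullet> w = 0" for x v w
    proof -
      have "v \<in> tangent_space \<Omega> x" "w \<in> tangent_space \<Omega> x"
        using that tangent_space_open_in_sphere[OF assms(2) x] by auto
      then have "pullback \<Omega> \<phi> (\<lambda>_. inner) x v w = \<mu> x * (v \<bullet> w)" using \<mu> x by blast
      then show ?thesis by (simp add: pullback_def Let_def)
    qed
  qed
qed

text \<open>
  The factor is the ratio of the squared norms of \<open>d\<phi>(X)\<close> and \<open>X\<close> for any tangent vector field \<open>X\<close>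
  without zeros. Near \<open>x\<^sub>0\<close> such a field is the tangential part of a constant vector \<open>e\<close> orthogonal
  to \<open>x\<^sub>0\<close>.
\<close>

lemma conformal_factor_smooth:
  fixes \<phi> :: "real ^ 'n::finite \<Rightarrow> real ^ 'n"
  assumes n: "2 \<le> CARD('n)" and \<Omega>: "openin (top_of_set (sphere 0 1)) \<Omega>" and \<phi>: "smooth_map \<Omega> \<phi>"
    and \<mu>: "\<And>x. x \<in> \<Omega> \<Longrightarrow> \<mu> x > 0"
      "\<And>x v w. x \<in> \<Omega> \<Longrightarrow> x \<bullet> v = 0 \<Longrightarrow> x \<bullet> w = 0 \<Longrightarrow>
        differential \<Omega> \<phi> x v \<bullet> differential \<Omega> \<phi> x w = \<mu> x * (v \<bullet> w)"
  shows "smooth_map \<Omega> (\<lambda>x. sqrt (\<mu> x))"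
proof (rule smooth_mapI)
  fix x0 assume x0: "x0 \<in> \<Omega>"
  have unit: "x \<bullet> x = 1" if "x \<in> \<Omega>" for x
    using openin_imp_subset[OF \<Omega>] that by (auto simp: norm_eq_1)
  obtain W F where W: "open W" "x0 \<in> W" "smooth_on W F" "\<And>x. x \<in> \<Omega> \<Longrightarrow> x \<in> W \<Longrightarrow> \<phi> x = F x"
    using smooth_mapE[OF \<phi> x0] by metis
  obtain e where e: "e \<bullet> e = 1" "x0 \<bullet> e = 0" using ex_orthogonal_unit_vector[of "{x0}"] n by auto
  define X where "X = (\<lambda>x. e - (e \<bullet> x) *\<^sub>R x)"
  have X: "smooth_on A X" if "open A" for A unfolding X_def by (intro smooth_intros that)
  have XT: "x \<bullet> X x = 0" if "x \<in> \<Omega>" for x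
    using unit[OF that] by (simp add: X_def inner_diff_right inner_commute)
  have dX: "smooth_on W (\<lambda>x. dir_deriv (X x) F x)" by (rule smooth_on_dir_deriv_along[OF W(1,3) X[OF W(1)]])
  have dF: "\<mu> x * (X x \<bullet> X x) = dir_deriv (X x) F x \<bullet> dir_deriv (X x) F x" if x: "x \<in> \<Omega>" "x \<in> W" for x
  proof -
    have "X x \<in> tangent_space \<Omega> x" using XT[OF x(1)] tangent_space_open_in_sphere[OF \<Omega> x(1)] by simp
    then have "differential \<Omega> \<phi> x (X x) = dir_deriv (X x) F x"
      by (rule differential_extension[OF \<phi> x(1) _ W(1) x(2) smooth_onD(1)[OF W(3) x(2)] W(4)])
    then show ?thesis using \<mu>(2)[OF x(1) XT[OF x(1)] XT[OF x(1)]] by simp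
  qed
  define a where "a = (\<lambda>x. X x \<bullet> X x)"
  define b where "b = (\<lambda>x. dir_deriv (X x) F x \<bullet> dir_deriv (X x) F x)"
  define V where "V = {x \<in> W. a x > 0 \<and> b x > 0}"
  have sa: "smooth_on W a" and sb: "smooth_on W b"
    unfolding a_def b_def by (intro smooth_intros X dX W(1))+
  have "open V"
  proof -
    have "open (a -` {0<..} \<inter> W)" "open (b -` {0<..} \<inter> W)"
      using sa[THEN smooth_onD(3)] sb[THEN smooth_onD(3)] W(1) by (auto simp: continuous_on_open_vimage)
    then have "open ((a -` {0<..} \<inter> W) \<inter> (b -` {0<..} \<inter> W))" by (rule open_Int)
    also have "(a -` {0<..} \<inter> W) \<inter> (b -` {0<..} \<inter> W) = V" by (auto simp: V_def)
    finally show ?thesis .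
  qed
  have "X x0 = e" using e by (simp add: X_def inner_commute)
  then have "a x0 > 0" using e by (simp add: a_def)
  moreover have "b x0 = \<mu> x0 * a x0" using dF[OF x0 W(2)] by (simp add: a_def b_def)
  ultimately have "x0 \<in> V" using W(2) \<mu>(1)[OF x0] by (simp add: V_def)
  have sV: "smooth_on V (\<lambda>x. sqrt (b x / a x))"
    by (intro smooth_intros \<open>open V\<close> smooth_on_subset[OF sa] smooth_on_subset[OF sb]) (auto simp: V_def)
  have "sqrt (\<mu> x) = sqrt (b x / a x)" if "x \<in> \<Omega> \<inter> V" for x
  proof -
    have "\<mu> x * a x = b x" "a x > 0" using dF[of x] that by (auto simp: V_def a_def b_def)
    then show ?thesis by (simp add: field_simps)
  qed
  then show "\<exists>W F. open W \<and> x0 \<in> W \<and> smooth_on W F \<and> (\<forall>x\<in>\<Omega> \<inter> W. sqrt (\<mu> x) = F x)"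
    using \<open>open V\<close> \<open>x0 \<in> V\<close> sV by blast
qed

text \<open>
  The time coordinate is chosen such that the squared ratio of the times of \<open>p\<close> and its image is
  the conformal factor \<open>\<mu>\<close>, as it is for an isometry.
\<close>

definition cone_lift :: "(real ^ 'n \<Rightarrow> real) \<Rightarrow> (real ^ 'n::finite \<Rightarrow> real ^ 'n) \<Rightarrow> 'n minkowski \<Rightarrow> 'n
  minkowski" where
  "cone_lift \<mu> \<phi> p = (fst p / sqrt (\<mu> (null_direction p))) *\<^sub>R (1, \<phi> (null_direction p))"

definition cone_over :: "(real ^ 'n::finite) set \<Rightarrow> 'n minkowski set" where
  "cone_over \<Omega> = {p \<in> lightcone. null_direction p \<in> \<Omega>}"

lemma cone_overD: "p \<in> cone_over \<Omega> \<Longrightarrow> p \<in> lightcone" "p \<in> cone_over \<Omega> \<Longrightarrow> null_direction p \<in> \<Omega>"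
  by (auto simp: cone_over_def)

lemma cone_lift_smooth:
  assumes \<phi>: "smooth_map \<Omega> \<phi>" and \<mu>: "smooth_map \<Omega> (\<lambda>x. sqrt (\<mu> x))" "\<And>x. x \<in> \<Omega> \<Longrightarrow> \<mu> x > 0"
  shows "smooth_map (cone_over \<Omega>) (cone_lift \<mu> \<phi>)"
proof -
  let ?C = "cone_over \<Omega>"
  let ?N = "{z :: real \<times> real \<times> (real ^ 'a). fst (snd z) > 0}"
  have nd: "smooth_map ?C null_direction" "null_direction ` ?C \<subseteq> \<Omega>"
    by (auto intro!: smooth_map_null_direction simp: cone_over_def)
  have "open ?N" by (intro open_Collect_less continuous_intros)
  have 1: "smooth_map ?C (\<lambda>p. (fst p, sqrt (\<mu> (null_direction p)), \<phi> (null_direction p)))"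
    by (intro smooth_map_Pair smooth_map_compose[OF nd(1) \<mu>(1) nd(2)] smooth_map_compose[OF nd(1) \<phi> nd(2)]
        smooth_map_of_smooth_on[OF open_UNIV]) (auto intro!: smooth_intros)
  have "smooth_on ?N (\<lambda>z. (fst z / fst (snd z)) *\<^sub>R (1, snd (snd z)))"
    by (intro smooth_intros \<open>open ?N\<close>) auto
  then have 2: "smooth_map ?N (\<lambda>z. (fst z / fst (snd z)) *\<^sub>R (1, snd (snd z)))"
    by (rule smooth_map_of_smooth_on[OF \<open>open ?N\<close>]) simp
  have "smooth_map ?C (\<lambda>p. (fst (fst p, sqrt (\<mu> (null_direction p)), \<phi> (null_direction p)) /
     fst (snd (fst p, sqrt (\<mu> (null_direction p)), \<phi> (null_direction p)))) *\<^sub>R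
     (1, snd (snd (fst p, sqrt (\<mu> (null_direction p)), \<phi> (null_direction p)))))"
    by (rule smooth_map_compose[OF 1 2]) (use \<mu>(2) in \<open>auto simp: cone_over_def\<close>)
  then show ?thesis unfolding cone_lift_def[abs_def] fst_conv snd_conv .
qed

lemma cone_lift_in_cone:
  assumes "p \<in> cone_over \<Omega>" "\<And>x. x \<in> \<Omega> \<Longrightarrow> \<mu> x > 0" "\<phi> ` \<Omega> \<subseteq> \<Omega>'" "\<Omega>' \<subseteq> sphere 0 1"
  shows "cone_lift \<mu> \<phi> p \<in> cone_over \<Omega>'" "null_direction (cone_lift \<mu> \<phi> p) = \<phi> (null_direction p)"
    "fst (cone_lift \<mu> \<phi> p) = fst p / sqrt (\<mu> (null_direction p))"
proof -
  note p = cone_overD[OF assms(1)]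
  have t: "fst p / sqrt (\<mu> (null_direction p)) > 0"
    using lightconeD(1)[OF p(1)] assms(2)[OF p(2)] by simp
  have \<phi>: "\<phi> (null_direction p) \<in> \<Omega>'" "\<phi> (null_direction p) \<in> sphere 0 1" using p(2) assms(3,4) by blast+
  show 1: "null_direction (cone_lift \<mu> \<phi> p) = \<phi> (null_direction p)"
    unfolding cone_lift_def by (rule null_direction_ray[OF less_imp_neq[OF t, symmetric]])
  have "cone_lift \<mu> \<phi> p \<in> lightcone" unfolding cone_lift_def by (rule lightcone_ray[OF \<phi>(2) t])
  then show "cone_lift \<mu> \<phi> p \<in> cone_over \<Omega>'" using 1 \<phi>(1) by (simp add: cone_over_def)
  show "fst (cone_lift \<mu> \<phi> p) = fst p / sqrt (\<mu> (null_direction p))" by (simp add: cone_lift_def)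
qed

lemma cone_lift_inverse:
  assumes p: "p \<in> cone_over \<Omega>" and \<mu>: "\<And>x. x \<in> \<Omega> \<Longrightarrow> \<mu> x > 0" and \<phi>: "\<phi> ` \<Omega> \<subseteq> \<Omega>'" "\<Omega>' \<subseteq> sphere 0 1"
    and \<psi>: "\<And>x. x \<in> \<Omega> \<Longrightarrow> \<psi> (\<phi> x) = x" "\<And>x. x \<in> \<Omega> \<Longrightarrow> \<nu> (\<phi> x) = 1 / \<mu> x"
  shows "cone_lift \<nu> \<psi> (cone_lift \<mu> \<phi> p) = p"
proof -
  note c = cone_lift_in_cone[OF p \<mu> \<phi>]
  note x = cone_overD(2)[OF p]
  have "cone_lift \<nu> \<psi> (cone_lift \<mu> \<phi> p) = fst p *\<^sub>R (1, null_direction p)"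
    unfolding cone_lift_def[of \<nu>] using c(2,3) \<psi>[OF x] \<mu>[OF x] by (simp add: real_sqrt_divide)
  then show ?thesis using lightcone_ray_eq[OF cone_overD(1)[OF p]] by simp
qed

lemma open_in_cone_over:
  assumes "openin (top_of_set (sphere 0 1)) \<Omega>" shows "open_in_cone (cone_over \<Omega>)"
proof -
  have "openin (top_of_set lightcone) (lightcone \<inter> null_direction -` \<Omega>)"
    by (rule continuous_openin_preimage[OF continuous_on_null_direction[OF order_refl] _ assms])
       (use null_direction_sphere in blast)
  moreover have "lightcone \<inter> null_direction -` \<Omega> = cone_over \<Omega>" by (auto simp: cone_over_def)
  ultimately show ?thesis by (simp add: open_in_cone_def)
qed

text \<open>
  The last clause records the target for a map of the full sphere, where the lift is a global
  isometry.
\<close>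

lemma conformal_map_lifts:
  fixes \<phi> :: "real ^ 'n::finite \<Rightarrow> real ^ 'n"
  assumes n: "2 \<le> CARD('n)" and U: "open_in_cone U" "null_connected U"
    and \<Omega>': "openin (top_of_set (sphere 0 1)) \<Omega>'" and \<phi>: "sphere_conformal (null_direction ` U) \<Omega>' \<phi>"
  obtains V f where "open_in_cone V" "null_connected V" "cone_isometry U V f" "induces U f \<phi>"
    "f \<in> extensional U" "U = lightcone \<Longrightarrow> V = cone_over \<Omega>'"
proof -
  let ?\<Omega> = "null_direction ` U"
  have \<Omega>: "openin (top_of_set (sphere 0 1)) ?\<Omega>" by (rule openin_null_direction_image[OF U(1)])
  obtain \<mu> where d: "diffeomorphism ?\<Omega> \<Omega>' \<phi>" and \<mu>: "\<And>x. x \<in> ?\<Omega> \<Longrightarrow> \<mu> x > 0"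
    "\<And>x v w. x \<in> ?\<Omega> \<Longrightarrow> x \<bullet> v = 0 \<Longrightarrow> x \<bullet> w = 0 \<Longrightarrow>
      differential ?\<Omega> \<phi> x v \<bullet> differential ?\<Omega> \<phi> x w = \<mu> x * (v \<bullet> w)"
    by (rule sphere_conformalE[OF \<phi> \<Omega>], rule that)
  define \<psi> where "\<psi> = inv_into ?\<Omega> \<phi>"
  \<comment> \<open>The conformal factor of the inverse of \<open>\<phi>\<close>.\<close>
  define \<nu> where "\<nu> = (\<lambda>y. 1 / \<mu> (\<psi> y))"
  note d' = diffeomorphismD[OF d, folded \<psi>_def]
  have \<psi>\<Omega>: "\<psi> y \<in> ?\<Omega>" if "y \<in> \<Omega>'" for y using d'(6) that by blast
  have \<nu>: "\<nu> y > 0" if "y \<in> \<Omega>'" for y using \<mu>(1)[OF \<psi>\<Omega>[OF that]] by (simp add: \<nu>_def)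
  have \<nu>2: "differential \<Omega>' \<psi> y v \<bullet> differential \<Omega>' \<psi> y w = \<nu> y * (v \<bullet> w)"
    if y: "y \<in> \<Omega>'" "y \<bullet> v = 0" "y \<bullet> w = 0" for y v w
  proof -
    have "v \<in> tangent_space \<Omega>' y" "w \<in> tangent_space \<Omega>' y"
      using y tangent_space_open_in_sphere[OF \<Omega>' y(1)] by auto
    moreover have "pullback ?\<Omega> \<phi> (\<lambda>_. inner) x v w = \<mu> x * (v \<bullet> w)"
      if "x \<in> ?\<Omega>" "v \<in> tangent_space ?\<Omega> x" "w \<in> tangent_space ?\<Omega> x" for x v w
      using \<mu>(2)[OF that(1)] that tangent_space_open_in_sphere[OF \<Omega> that(1)]
        by (simp add: pullback_def Let_def)
    ultimately have "v \<bullet> w = \<mu> (\<psi> y) * pullback \<Omega>' \<psi> (\<lambda>_. inner) y v w"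
      unfolding \<psi>_def by (intro pullback_inverse[OF d _ y(1)])
    then show ?thesis using \<mu>(1)[OF \<psi>\<Omega>[OF y(1)]] by (simp add: \<nu>_def pullback_def Let_def field_simps)
  qed
  have sub: "?\<Omega> \<subseteq> sphere 0 1" "\<Omega>' \<subseteq> sphere 0 1" using openin_imp_subset \<Omega> \<Omega>' by blast+
  let ?F = "cone_lift \<mu> \<phi>" and ?G = "cone_lift \<nu> \<psi>"
  have UC: "U \<subseteq> cone_over ?\<Omega>" using open_in_coneD[OF U(1)] by (auto simp: cone_over_def)
  have sF: "smooth_map (cone_over ?\<Omega>) ?F"
    by (rule cone_lift_smooth[OF d'(2) conformal_factor_smooth[OF n \<Omega> d'(2) \<mu>] \<mu>(1)])
  have sG: "smooth_map (cone_over \<Omega>') ?G"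
    by (rule cone_lift_smooth[OF d'(3) conformal_factor_smooth[OF n \<Omega>' d'(3) \<nu> \<nu>2] \<nu>])
  note F = cone_lift_in_cone[where \<Omega> = ?\<Omega> and \<mu> = \<mu>, OF _ \<mu>(1) equalityD1[OF d'(4)] sub(2)]
  note G = cone_lift_in_cone[where \<Omega> = \<Omega>' and \<mu> = \<nu>, OF _ \<nu> equalityD1[OF d'(6)] sub(1)]
  have GF: "?G (?F p) = p" if "p \<in> cone_over ?\<Omega>" for p
    by (rule cone_lift_inverse[OF that \<mu>(1) equalityD1[OF d'(4)] sub(2) d'(7)]) (simp_all add: \<nu>_def d'(7))
  have FG: "?F (?G q) = q" if "q \<in> cone_over \<Omega>'" for q
    by (rule cone_lift_inverse[OF that \<nu> equalityD1[OF d'(6)] sub(1) d'(8)]) (simp_all add: \<nu>_def)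
  define V where "V = cone_over \<Omega>' \<inter> ?G -` U"
  define f where "f = restrict ?F U"
  have fU: "f p = ?F p" if "p \<in> U" for p using that by (simp add: f_def)
  have V: "open_in_cone V"
  proof -
    have "openin (top_of_set (cone_over ?\<Omega>)) U"
      using U(1) UC open_in_cone_over[OF \<Omega>] unfolding open_in_cone_def
      by (meson openin_subset_trans openin_imp_subset)
    then have "openin (top_of_set (cone_over \<Omega>')) V" unfolding V_def
      by (rule continuous_openin_preimage[OF smooth_map_continuous_on[OF sG], rotated]) (auto intro: G(1))
    then show ?thesis using open_in_cone_over[OF \<Omega>'] unfolding open_in_cone_def by (rule openin_trans)
  qed
  have FV: "?F p \<in> V" if "p \<in> U" for p
    using F(1)[OF subsetD[OF UC that]] GF[OF subsetD[OF UC that]] that by (simp add: V_def)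
  have sf: "smooth_map U f" by (rule smooth_map_restrict[OF sF UC]) (simp add: fU)
  have df: "diffeomorphism U V f"
  proof (rule diffeomorphismI[OF sf])
    show "smooth_map V ?G" by (rule smooth_map_restrict[OF sG]) (auto simp: V_def)
    show "f x \<in> V \<and> ?G (f x) = x" if "x \<in> U" for x
      using FV[OF that] GF[OF subsetD[OF UC that]] fU[OF that] by simp
    show "?G y \<in> U \<and> f (?G y) = y" if "y \<in> V" for y using that FG fU by (auto simp: V_def)
  qed
  have i: "induces U f \<phi>" unfolding induces_def using F(2)[OF subsetD[OF UC]] fU by simp
  have "mink (differential U f p a) (differential U f p b) = mink a b"
    if p: "p \<in> U" and a: "mink p a = 0" and b: "mink p b = 0" for p a b
  proof -
    note pl = open_in_coneD[OF U(1) p]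
    have x: "null_direction p \<in> ?\<Omega>" using p by blast
    have "mink (differential U f p a) (differential U f p b) / (fst (f p))\<^sup>2
      = \<mu> (null_direction p) * (dir_deriv a null_direction p \<bullet> dir_deriv b null_direction p)"
      using semiconjugacy_conformal[OF sf equalityD1[OF diffeomorphismD(4)[OF df]] U(1) V d'(2) i p a b]
        \<mu>(2)[OF x null_direction_derivative_tangent[OF pl a] null_direction_derivative_tangent[OF pl b]]
          by simp
    also have "\<dots> = \<mu> (null_direction p) * (mink a b / (fst p)\<^sup>2)"
      using null_direction_conformal[OF pl a b] by simp
    also have "(fst (f p))\<^sup>2 = (fst p)\<^sup>2 / \<mu> (null_direction p)"
      using F(3)[OF subsetD[OF UC p]] fU[OF p] \<mu>(1)[OF x] by (simp add: power_divide)
    finally show ?thesis using \<mu>(1)[OF x] lightconeD(1)[OF pl] by (simp add: field_simps)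
  qed
  then have iso: "cone_isometry U V f"
    unfolding cone_isometry_def isometry_between_def using df
    by (auto simp: pullback_def Let_def tangent_space_open_in_cone[OF U(1)])
  have nc: "null_connected V"
    unfolding null_connected_def
  proof
    fix y
    have fiber: "{q \<in> V. null_direction q = y} = f ` {p \<in> U. null_direction p = \<psi> y}" if y: "y \<in> \<Omega>'"
    proof (intro equalityI subsetI)
      fix q assume q: "q \<in> {q \<in> V. null_direction q = y}"
      then have "q = f (?G q)" "?G q \<in> U" "null_direction (?G q) = \<psi> y"
        using FG G(2) fU by (auto simp: V_def)
      then show "q \<in> f ` {p \<in> U. null_direction p = \<psi> y}" by blast
    next
      fix q assume "q \<in> f ` {p \<in> U. null_direction p = \<psi> y}"
      then obtain p where "p \<in> U" "null_direction p = \<psi> y" "q = f p" by blast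
      then show "q \<in> {q \<in> V. null_direction q = y}"
        using FV fU i d'(8)[OF y] by (auto simp: induces_def)
    qed
    have conn: "connected (f ` {p \<in> U. null_direction p = \<psi> y})"
      by (rule connected_continuous_image[OF continuous_on_subset[OF smooth_map_continuous_on[OF sf]]])
         (use U(2) in \<open>auto simp: null_connected_def\<close>)
    have empty: "{q \<in> V. null_direction q = y} = {}" if "y \<notin> \<Omega>'"
      using that by (auto simp: V_def cone_over_def)
    show "connected {q \<in> V. null_direction q = y}"
    proof (cases "y \<in> \<Omega>'")
      case True
      show ?thesis unfolding fiber[OF True] by (rule conn)
    next
      case False
      show ?thesis unfolding empty[OF False] by (rule connected_empty)
    qed
  qed
  show ?thesis
  proof (rule that[OF V nc iso i])
    show "f \<in> extensional U" by (simp add: f_def)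
    show "V = cone_over \<Omega>'" if "U = lightcone"
      using cone_overD(1)[OF G(1)] unfolding V_def that by blast
  qed
qed

section \<open>The correspondence between isometries and conformal maps\<close>

text \<open>
  The time coordinate of \<open>f p\<close> is recovered from the conformal factor of the induced map.
\<close>

lemma isometry_determined_by_directions:
  fixes f f' :: "'n::finite minkowski \<Rightarrow> 'n minkowski"
  assumes n: "2 \<le> CARD('n)" and U: "open_in_cone U"
    and f: "cone_isometry U V f" "open_in_cone V" and f': "cone_isometry U V' f'" "open_in_cone V'"
    and \<phi>: "induces U f \<phi>" "induces U f' \<phi>" and p: "p \<in> U"
  shows "f p = f' p"
proof -
  note D = cone_isometryD[OF f(1) U f(2)] and D' = cone_isometryD[OF f'(1) U f'(2)]
  note s = smooth_map_induced[OF f(1) U f(2) \<phi>(1)]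
  note pos = lightconeD(1)[OF open_in_coneD[OF U p]] lightconeD(1)[OF D(5)[OF p]]
    lightconeD(1)[OF D'(5)[OF p]]
  obtain e where e: "e \<bullet> e = 1" "null_direction p \<bullet> e = 0"
    using ex_orthogonal_unit_vector[of "{null_direction p}"] n by auto
  have "(fst p / fst (f p))\<^sup>2 = (fst p / fst (f' p))\<^sup>2"
    using isometry_direction_factor[OF f(1) U f(2) s \<phi>(1) p e(2,2)]
      isometry_direction_factor[OF f'(1) U f'(2) s \<phi>(2) p e(2,2)] e(1) by simp
  then have "fst p / fst (f p) = fst p / fst (f' p)" using pos by (subst (asm) power2_eq_iff_nonneg) auto
  then have "fst (f p) = fst (f' p)" using pos by (simp add: field_simps)
  moreover have "null_direction (f p) = null_direction (f' p)" using \<phi> p unfolding induces_def by metis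
  ultimately show ?thesis using lightcone_ray_eq[OF D(5)[OF p]] lightcone_ray_eq[OF D'(5)[OF p]] by simp
qed

theorem isometry_conformal_correspondence:
  fixes U :: "'n::finite minkowski set"
  assumes n: "2 \<le> CARD('n)" and U: "open_in_cone U" "null_connected U"
  shows "f \<in> local_isometries U \<Longrightarrow> \<exists>!\<phi>. \<phi> \<in> local_conformal_maps (null_direction ` U) \<and> induces U f \<phi>"
    and "\<phi> \<in> local_conformal_maps (null_direction ` U) \<Longrightarrow> \<exists>!f. f \<in> local_isometries U \<and> induces U f \<phi>"
proof -
  assume "f \<in> local_isometries U"
  then obtain V where V: "open_in_cone V" "null_connected V" "cone_isometry U V f"
    unfolding local_isometries_def by blast
  have i: "induces U f (induced_map U f)" by (rule induces_induced_map[OF V(3) U(1) V(1) U(2)])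
  have "induced_map U f \<in> local_conformal_maps (null_direction ` U)"
    unfolding local_conformal_maps_def
    using sphere_conformal_induced_map[OF V(3) U(1) V(1) U(2) V(2)] openin_null_direction_image[OF V(1)]
    by (auto simp: induced_map_def)
  moreover have "\<phi> = induced_map U f" if "\<phi> \<in> local_conformal_maps (null_direction ` U)" "induces U f \<phi>" for \<phi>
  proof (rule extensionalityI)
    show "\<phi> \<in> extensional (null_direction ` U)" using that(1) by (simp add: local_conformal_maps_def)
    show "induced_map U f \<in> extensional (null_direction ` U)" by (simp add: induced_map_def)
    show "\<phi> x = induced_map U f x" if "x \<in> null_direction ` U" for x
      using that \<open>induces U f \<phi>\<close> i unfolding induces_def by auto
  qed
  ultimately show "\<exists>!\<phi>. \<phi> \<in> local_conformal_maps (null_direction ` U) \<and> induces U f \<phi>" using i by blast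
next
  assume "\<phi> \<in> local_conformal_maps (null_direction ` U)"
  then obtain \<Omega>' where \<Omega>': "openin (top_of_set (sphere 0 1)) \<Omega>'" "sphere_conformal (null_direction ` U) \<Omega>' \<phi>"
    unfolding local_conformal_maps_def by blast
  obtain V f where f: "open_in_cone V" "null_connected V" "cone_isometry U V f" "induces U f \<phi>"
    "f \<in> extensional U"
    using conformal_map_lifts[OF n U \<Omega>'] by metis
  have "f \<in> local_isometries U" unfolding local_isometries_def using f by blast
  moreover have "f' = f" if f': "f' \<in> local_isometries U" "induces U f' \<phi>" for f'
  proof -
    obtain V' where V': "open_in_cone V'" "cone_isometry U V' f'" "f' \<in> extensional U"
      using f'(1) unfolding local_isometries_def by blast
    show ?thesis
      by (rule extensionalityI[OF V'(3) f(5)])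
         (rule isometry_determined_by_directions[OF n U(1) V'(2,1) f(3,1) f'(2) f(4)])
  qed
  ultimately show "\<exists>!f. f \<in> local_isometries U \<and> induces U f \<phi>" using f(4) by blast
qed

text \<open>
  A half-line meets a convex set in a convex set. In particular, small balls around points of the
  cone give null-connected neighbourhoods.
\<close>

lemma null_connected_convex:
  fixes B :: "'n::finite minkowski set"
  assumes "convex B" shows "null_connected (lightcone \<inter> B)"
  unfolding null_connected_def
proof
  fix x
  have "convex {p \<in> lightcone \<inter> B. null_direction p = x}"
    unfolding convex_def
  proof (intro ballI allI impI)
    fix p q :: "'n minkowski" and u v :: real
    assume p: "p \<in> {p \<in> lightcone \<inter> B. null_direction p = x}" and q:
      "q \<in> {p \<in> lightcone \<inter> B. null_direction p = x}"
      and uv: "0 \<le> u" "0 \<le> v" "u + v = 1"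
    define t where "t = u * fst p + v * fst q"
    have pos: "fst p > 0" "fst q > 0" using p q lightconeD(1)[of p] lightconeD(1)[of q] by simp_all
    then have t: "t > 0" unfolding t_def using uv by (smt (verit) mult_nonneg_nonneg mult_pos_pos)
    have xs: "x \<in> sphere 0 1" using p null_direction_sphere by blast
    have "snd p = fst p *\<^sub>R null_direction p" "snd q = fst q *\<^sub>R null_direction q"
      using pos by (simp_all add: null_direction_def)
    then have "snd p = fst p *\<^sub>R x" "snd q = fst q *\<^sub>R x" using p q by simp_all
    then have e: "u *\<^sub>R p + v *\<^sub>R q = t *\<^sub>R (1, x)"
      by (simp add: prod_eq_iff t_def scaleR_add_left)
    have "u *\<^sub>R p + v *\<^sub>R q \<in> B" using assms p q uv by (intro convexD) auto
    moreover have "null_direction (t *\<^sub>R (1, x)) = x" using t by (intro null_direction_ray) simp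
    ultimately show "u *\<^sub>R p + v *\<^sub>R q \<in> {p \<in> lightcone \<inter> B. null_direction p = x}"
      using lightcone_ray[OF xs t] unfolding e by simp
  qed
  then show "connected {p \<in> lightcone \<inter> B. null_direction p = x}" by (rule convex_connected)
qed

text \<open>
  On a small ball the domain is null-connected by convexity. For the image, the inverse isometry is
  used on a ball around \<open>f p\<close> that contains it: two image points on one half-line come from points
  on one half-line, so the fibres of the image are the images of the fibres.
\<close>

theorem isometry_locally_null_connected:
  fixes f :: "'n::finite minkowski \<Rightarrow> 'n minkowski"
  assumes f: "cone_isometry U V f" "open_in_cone U" "open_in_cone V" and p: "p \<in> U"
  shows "\<exists>W. p \<in> W \<and> W \<subseteq> U \<and> open_in_cone W \<and> null_connected W \<and> restrict f W \<in> local_isometries W"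
proof -
  note D = cone_isometryD[OF f]
  let ?g = "inv_into U f"
  note g = cone_isometry_inverse[OF f(1)] f(3,2)
  note D' = diffeomorphismD[OF D(1)]
  have fp: "f p \<in> V" using D(3) p by blast
  obtain d' where d': "d' > 0" "ball (f p) d' \<inter> lightcone \<subseteq> V" using open_in_cone_ball[OF f(3) fp] by blast
  have "openin (top_of_set U) (U \<inter> f -` (V \<inter> ball (f p) d'))"
    by (rule continuous_openin_preimage[OF smooth_map_continuous_on[OF D(2)], of V])
       (use D(3) openin_open_Int[OF open_ball] in blast)+
  then have "open_in_cone (U \<inter> f -` (V \<inter> ball (f p) d'))"
    using f(2) unfolding open_in_cone_def by (rule openin_trans)
  moreover have "p \<in> U \<inter> f -` (V \<inter> ball (f p) d')" using p fp d'(1) by simp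
  ultimately obtain d where d: "d > 0" "ball p d \<inter> lightcone \<subseteq> U \<inter> f -` (V \<inter> ball (f p) d')"
    using open_in_cone_ball by blast
  define W where "W = lightcone \<inter> ball p d"
  have WU: "W \<subseteq> U" and fW: "\<And>w. w \<in> W \<Longrightarrow> f w \<in> V \<and> f w \<in> ball (f p) d'" using d(2) by (auto simp: W_def)
  have W: "open_in_cone W" unfolding W_def open_in_cone_def by (rule openin_open_Int) simp
  have ncW: "null_connected W" unfolding W_def by (rule null_connected_convex[OF convex_ball])
  have bU: "ball p d \<inter> lightcone \<subseteq> U" using d(2) by blast
  have V'eq: "f ` W = V \<inter> ?g -` W"
  proof (intro equalityI subsetI)
    fix q assume "q \<in> f ` W"
    then show "q \<in> V \<inter> ?g -` W" using fW D'(7) WU by (auto simp: subset_iff)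
  next
    fix q assume "q \<in> V \<inter> ?g -` W"
    then show "q \<in> f ` W" using D'(8)[of q] by (metis IntD1 IntD2 imageI vimageE)
  qed
  have "openin (top_of_set U) W" using W f(2) WU unfolding open_in_cone_def
    by (meson openin_subset_trans openin_imp_subset)
  then have "openin (top_of_set V) (V \<inter> ?g -` W)"
    by (rule continuous_openin_preimage[OF smooth_map_continuous_on[OF D'(3)], rotated]) (use D'(6) in blast)
  then have V': "open_in_cone (f ` W)" unfolding V'eq using f(3) unfolding open_in_cone_def
    by (rule openin_trans)
  have ncV': "null_connected (f ` W)"
    unfolding null_connected_def
  proof
    fix y
    show "connected {q \<in> f ` W. null_direction q = y}"
    proof (cases "{q \<in> f ` W. null_direction q = y} = {}")
      case False
      then obtain w0 where w0: "w0 \<in> W" "null_direction (f w0) = y" by blast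
      have same: "null_direction w = null_direction w0 \<longleftrightarrow> null_direction (f w) = y" if w: "w \<in> W" for w
      proof
        assume "null_direction w = null_direction w0"
        then have "null_direction (f w) = null_direction (f w0)"
          by (intro isometry_direction_locally_constant[OF f convex_ball bU]) (use w w0 in \<open>auto simp: W_def\<close>)
        then show "null_direction (f w) = y" using w0 by simp
      next
        assume "null_direction (f w) = y"
        then have "null_direction (?g (f w)) = null_direction (?g (f w0))"
          by (intro isometry_direction_locally_constant[OF g convex_ball d'(2)])
             (use fW[OF w] fW[OF w0(1)] w0(2) open_in_coneD[OF f(3)] in auto)
        then show "null_direction w = null_direction w0" using D'(7) w w0(1) WU by (metis subsetD)
      qed
      have "{q \<in> f ` W. null_direction q = y} = f ` {w \<in> W. null_direction w = null_direction w0}"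
        using same by blast
      moreover have "connected (f ` {w \<in> W. null_direction w = null_direction w0})"
        by (rule connected_continuous_image[OF continuous_on_subset[OF smooth_map_continuous_on[OF D(2)]]])
           (use WU ncW in \<open>auto simp: null_connected_def\<close>)
      ultimately show ?thesis by simp
    qed (simp only: connected_empty)
  qed
  let ?h = "restrict f W"
  have "cone_isometry W (f ` W) ?h"
    unfolding cone_isometry_def isometry_between_def
  proof (intro conjI ballI)
    show "diffeomorphism W (f ` W) ?h"
    proof (rule diffeomorphismI)
      show "smooth_map W ?h" by (rule smooth_map_restrict[OF D(2) WU]) simp
      show "smooth_map (f ` W) ?g" by (rule smooth_map_restrict[OF D'(3)]) (use fW in auto)
      show "?h x \<in> f ` W \<and> ?g (?h x) = x" if "x \<in> W" for x
        using that D'(7)[OF subsetD[OF WU that]] by simp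
      show "?g y \<in> W \<and> ?h (?g y) = y" if "y \<in> f ` W" for y using that D'(8) V'eq by auto
    qed
    fix q a b assume q: "q \<in> W" and ab: "a \<in> tangent_space W q" "b \<in> tangent_space W q"
    have "differential W ?h q a = differential U f q a" "differential W ?h q b = differential U f q b"
      by (rule differential_restrict[OF D(2) WU _ q]; use ab in simp)+
    moreover have "mink q a = 0" "mink q b = 0" using ab tangent_space_open_in_cone[OF W q] by auto
    ultimately show "pullback W ?h (\<lambda>_. mink) q a b = mink a b"
      using D(6)[of q a b] q WU by (auto simp: pullback_def Let_def)
  qed
  then have "?h \<in> local_isometries W" unfolding local_isometries_def using V' ncV' by auto
  moreover have "p \<in> W" using d(1) open_in_coneD[OF f(2) p] by (simp add: W_def)
  ultimately show ?thesis using WU W ncW by blast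
qed

section \<open>Diffeomorphisms of the circle\<close>

text \<open>
  The tangent spaces of the circle are lines, on which any two scalar products are proportional.
\<close>

lemma circle_diffeomorphism_conformal:
  fixes \<phi> :: "real ^ 2 \<Rightarrow> real ^ 2"
  assumes "diffeomorphism (sphere 0 1) (sphere 0 1) \<phi>"
  shows "sphere_conformal (sphere 0 1) (sphere 0 1) \<phi>"
proof -
  let ?S = "sphere (0::real ^ 2) 1"
  \<comment> \<open>Rotation by a right angle: \<open>J x\<close> spans the tangent line of the circle at \<open>x\<close>.\<close>
  define J :: "real ^ 2 \<Rightarrow> real ^ 2" where "J = (\<lambda>x. vector [- x $ 2, x $ 1])"
  define \<mu> where "\<mu> = (\<lambda>x. differential ?S \<phi> x (J x) \<bullet> differential ?S \<phi> x (J x))"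
  note d = diffeomorphismD[OF assms]
  have "\<forall>x\<in>?S. 0 < \<mu> x \<and> (\<forall>v\<in>tangent_space ?S x. \<forall>w\<in>tangent_space ?S x.
      pullback ?S \<phi> (\<lambda>_. inner) x v w = \<mu> x * (v \<bullet> w))"
  proof
    fix x assume x: "x \<in> ?S"
    have xx: "x $ 1 * x $ 1 + x $ 2 * x $ 2 = 1"
      using x by (simp add: norm_eq_1 inner_vec_def sum_2)
    have T: "tangent_space ?S x = {v. x \<bullet> v = 0}" by (rule tangent_space_sphere[OF x])
    have J: "x \<bullet> J x = 0" "J x \<bullet> J x = 1" using xx by (simp_all add: J_def inner_vec_def sum_2 add.commute)
    have span: "v = (v \<bullet> J x) *\<^sub>R J x" if "x \<bullet> v = 0" for v
    proof -
      have o: "x $ 1 * v $ 1 + x $ 2 * v $ 2 = 0" using that by (simp add: inner_vec_def sum_2)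
      have "v $ 1 = (- v $ 1 * x $ 2 + v $ 2 * x $ 1) * (- x $ 2)"
        "v $ 2 = (- v $ 1 * x $ 2 + v $ 2 * x $ 1) * x $ 1"
        using o xx by algebra+
      then show ?thesis by (simp add: vec_eq_iff forall_2 J_def inner_vec_def sum_2)
    qed
    note lin = linear_differential[OF d(2) x]
    have "differential ?S \<phi> x (J x) \<noteq> 0"
    proof
      assume 0: "differential ?S \<phi> x (J x) = 0"
      have "J x = differential ?S (inv_into ?S \<phi>) (\<phi> x) 0"
        using differential_inverse[OF assms x, of "J x"] J(1) T 0 by simp
      also have "\<dots> = 0" by (rule linear_0[OF linear_differential[OF d(3)]]) (use d(4) x in blast)
      finally show False using J(2) by simp
    qed
    then have "0 < \<mu> x" by (simp add: \<mu>_def)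
    moreover have "pullback ?S \<phi> (\<lambda>_. inner) x v w = \<mu> x * (v \<bullet> w)" if v: "x \<bullet> v = 0" and w:
      "x \<bullet> w = 0" for v w
    proof -
      have "differential ?S \<phi> x v = (v \<bullet> J x) *\<^sub>R differential ?S \<phi> x (J x)"
        "differential ?S \<phi> x w = (w \<bullet> J x) *\<^sub>R differential ?S \<phi> x (J x)"
        using span[OF v] span[OF w] linear_cmul[OF lin] by metis+
      moreover have "v \<bullet> w = (v \<bullet> J x) * (w \<bullet> J x)"
        by (subst span[OF w]) (simp add: mult.commute)
      ultimately show ?thesis by (simp add: pullback_def Let_def \<mu>_def)
    qed
    ultimately show "0 < \<mu> x \<and> (\<forall>v\<in>tangent_space ?S x. \<forall>w\<in>tangent_space ?S x.
      pullback ?S \<phi> (\<lambda>_. inner) x v w = \<mu> x * (v \<bullet> w))" by (simp add: T)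
  qed
  then show ?thesis using assms unfolding sphere_conformal_def conformal_between_def by blast
qed

lemma null_direction_lightcone: "null_direction ` lightcone = sphere 0 1"
proof (intro equalityI subsetI)
  fix x assume x: "x \<in> sphere (0::real ^ 'a) 1"
  show "x \<in> null_direction ` lightcone"
    using lightcone_ray[OF x zero_less_one] null_direction_ray[of 1 x] by (intro image_eqI) auto
qed (use null_direction_sphere in blast)

theorem circle_diffeomorphism_lifts:
  fixes \<phi> :: "real ^ 2 \<Rightarrow> real ^ 2"
  assumes "diffeomorphism (sphere 0 1) (sphere 0 1) \<phi>"
  shows "\<exists>f. cone_isometry lightcone lightcone f \<and> induces lightcone f \<phi>"
proof -
  have n: "2 \<le> CARD(2)" by simp
  have nc: "null_connected (lightcone :: 2 minkowski set)" using null_connected_convex[OF convex_UNIV] by simp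
  have c: "sphere_conformal (null_direction ` lightcone) (sphere 0 1) \<phi>"
    unfolding null_direction_lightcone by (rule circle_diffeomorphism_conformal[OF assms])
  obtain V f where f: "cone_isometry lightcone V f" "induces lightcone f \<phi>" "V = cone_over (sphere 0 1)"
    using conformal_map_lifts[OF n open_in_cone_lightcone nc openin_subtopology_self c] by metis
  have "cone_over (sphere 0 1) = (lightcone :: 2 minkowski set)"
    using null_direction_sphere by (auto simp: cone_over_def)
  then show ?thesis using f by auto
qed

section \<open>Isometries of lightcones\<close>

theorem theorem1p1:
  "(3 \<le> CARD('n::finite) \<longrightarrow>
      (\<forall>f :: 'n minkowski \<Rightarrow> 'n minkowski. cone_isometry lightcone lightcone f \<longrightarrow>
        (\<exists>A\<in>O_plus. \<forall>p\<in>lightcone. f p = A p)))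
   \<and>
   (4 \<le> CARD('n) \<longrightarrow>
      (\<forall>U V :: 'n minkowski set. \<forall>f.
        open_in_cone U \<and> connected U \<and> open_in_cone V \<and> connected V \<and> cone_isometry U V f \<longrightarrow>
        (\<exists>A\<in>O_plus. \<forall>p\<in>U. f p = A p)))
   \<and>
   ((\<forall>U :: 3 minkowski set. open_in_cone U \<and> null_connected U \<longrightarrow>
        (\<forall>f\<in>local_isometries U. \<exists>!\<phi>. \<phi> \<in> local_conformal_maps (null_direction ` U) \<and> induces U f \<phi>) \<and>
        (\<forall>\<phi>\<in>local_conformal_maps (null_direction ` U). \<exists>!f. f \<in> local_isometries U \<and> induces U f \<phi>))
    \<and>
    (\<forall>U V :: 3 minkowski set. \<forall>f. open_in_cone U \<and> open_in_cone V \<and> cone_isometry U V f \<longrightarrow>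
        (\<forall>p\<in>U. \<exists>W. p \<in> W \<and> W \<subseteq> U \<and> open_in_cone W \<and> null_connected W \<and>
           restrict f W \<in> local_isometries W)))
   \<and>
   (\<forall>\<phi> :: real ^ 2 \<Rightarrow> real ^ 2. diffeomorphism (sphere 0 1) (sphere 0 1) \<phi> \<longrightarrow>
      (\<exists>f. cone_isometry lightcone lightcone f \<and> induces lightcone f \<phi>))"
proof (intro conjI allI impI ballI)
  fix f :: "'n minkowski \<Rightarrow> 'n minkowski"
  assume "3 \<le> CARD('n)" "cone_isometry lightcone lightcone f"
  then show "\<exists>A\<in>O_plus. \<forall>p\<in>lightcone. f p = A p" by (rule global_rigidity)
next
  fix U V :: "'n minkowski set" and f
  assume "4 \<le> CARD('n)"
    and "open_in_cone U \<and> connected U \<and> open_in_cone V \<and> connected V \<and> cone_isometry U V f"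
  then show "\<exists>A\<in>O_plus. \<forall>p\<in>U. f p = A p" using local_rigidity by blast
next
  fix U :: "3 minkowski set" and f
  assume "open_in_cone U \<and> null_connected U" "f \<in> local_isometries U"
  then show "\<exists>!\<phi>. \<phi> \<in> local_conformal_maps (null_direction ` U) \<and> induces U f \<phi>"
    by (intro isometry_conformal_correspondence(1)) simp_all
next
  fix U :: "3 minkowski set" and \<phi>
  assume "open_in_cone U \<and> null_connected U" "\<phi> \<in> local_conformal_maps (null_direction ` U)"
  then show "\<exists>!f. f \<in> local_isometries U \<and> induces U f \<phi>"
    by (intro isometry_conformal_correspondence(2)) simp_all
next
  fix U V :: "3 minkowski set" and f p
  assume "open_in_cone U \<and> open_in_cone V \<and> cone_isometry U V f" "p \<in> U"
  then show "\<exists>W. p \<in> W \<and> W \<subseteq> U \<and> open_in_cone W \<and> null_connected W \<and> restrict f W \<in> local_isometries W"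
    by (intro isometry_locally_null_connected[of U V]) simp_all
next
  fix \<phi> :: "real ^ 2 \<Rightarrow> real ^ 2"
  assume "diffeomorphism (sphere 0 1) (sphere 0 1) \<phi>"
  then show "\<exists>f. cone_isometry lightcone lightcone f \<and> induces lightcone f \<phi>"
    by (rule circle_diffeomorphism_lifts)
qed

end
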